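(* Let $k\ge0$ be an integer. If $k$ is odd, the space of modes of wavenumber $k$ of the Poincaré dodecahedral space $S^3/I^*$ is $\{0\}$. If $k$ is even, put $\tilde k=\lfloor\frac{k/2}{2}\rfloor+\lfloor\frac{k/2}{3}\rfloor+\lfloor\frac{k/2}{5}\rfloor-\frac k2$ (so $\tilde k\ge-1$). For $i=0,1,\dots,\tilde k$ let $$B_i=I_{12}^{\,5i+\mathrm{mod}(k/2,5)}\;I_{20}^{\,3(\tilde k-i)+\mathrm{mod}(k/2,3)}\;I_{30}^{\,\mathrm{mod}(k/2,2)},$$ a homogeneous polynomial of degree $k$ in $\alpha,\beta$. Then the $(\tilde k+1)(k+1)$ functions consisting of the siblings of $B_0,\dots,B_{\tilde k}$ (restricted to $S^3$) form a basis of the space of modes of wavenumber $k$ of $S^3/I^*$; in particular this space has dimension $(\tilde k+1)(k+1)$ (zero when $\tilde k=-1$).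
   Context: Identify $\mathbb R^4$ with $\mathbb C^2$ via $\alpha=x+iy$, $\beta=z+iw$, $S^3=\{|\alpha|^2+|\beta|^2=1\}$. Wirtinger derivatives $\frac{\partial}{\partial\alpha}=\frac12(\partial_x-i\partial_y)$, $\frac{\partial}{\partial\bar\alpha}=\frac12(\partial_x+i\partial_y)$, similarly for $\beta$ with $(z,w)$. $\mathrm{twist}_-=-\bar\beta\frac{\partial}{\partial\alpha}+\bar\alpha\frac{\partial}{\partial\beta}$. For a polynomial $f$ in $\alpha,\beta$ only, homogeneous of degree $k$, its siblings are $\mathrm{twist}_-^j f$, $j=0,\dots,k$. $\gamma\in SU(2)$ acts on $\mathbb C^2$ by $(\alpha,\beta)^T\mapsto\gamma(\alpha,\beta)^T$ and on functions by $(R_\gamma F)(x)=F(\gamma^{-1}x)$. For a finite subgroup $\Gamma\subset SU(2)$, the space of modes of wavenumber $k$ of $S^3/\Gamma$ is the complex vector space of $\Gamma$-invariant functions $F:S^3\to\mathbb C$ with $\Delta_{S^3}F=-k(k+2)F$. $\mathrm{mod}(m,n)$ is the remainder of $m$ upon division by $n$, $\lfloor\cdot\rfloor$ the floor. $I_{12}=\alpha^{11}\beta+11\alpha^6\beta^6-\alpha\beta^{11}$, $I_{20}=\alpha^{20}-228\alpha^{15}\beta^5+494\alpha^{10}\beta^{10}+228\alpha^5\beta^{15}+\beta^{20}$, $I_{30}=\alpha^{30}+522\alpha^{25}\beta^5-10005\alpha^{20}\beta^{10}-10005\alpha^{10}\beta^{20}-522\alpha^5\beta^{25}+\beta^{30}$.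 A matrix $\begin{pmatrix}a&b\\c&d\end{pmatrix}\in SU(2)$ induces the Möbius map $z\mapsto\frac{az+b}{cz+d}$ of $\mathbb C\cup\{\infty\}$. Let $V_I=\{0,\infty\}\cup\{z:z^{10}+11z^5-1=0\}$ (vertices of a regular icosahedron under stereographic projection), $I$ the order-60 group of such Möbius maps preserving $V_I$, and $I^*\subset SU(2)$ (order 120) the set of matrices inducing elements of $I$. *)

theory Defs
  imports "HOL-Analysis.Analysis"
begin

type_synonym C2pt = "complex \<times> complex"
(* a 2x2 complex matrix (a,b,c,d) = [[a,b],[c,d]] *)
type_synonym mat2 = "complex \<times> complex \<times> complex \<times> complex"

definition S3 :: "C2pt set" where
  "S3 = {p. (cmod (fst p))^2 + (cmod (snd p))^2 = 1}"

definition SU2 :: "mat2 set" where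
  "SU2 = {(a,b,c,d). (cmod a)^2 + (cmod c)^2 = 1 \<and> (cmod b)^2 + (cmod d)^2 = 1
            \<and> cnj a * b + cnj c * d = 0 \<and> a * d - b * c = 1}"

definition mat_act :: "mat2 \<Rightarrow> C2pt \<Rightarrow> C2pt" where
  "mat_act g p = (case g of (a,b,c,d) \<Rightarrow> (a * fst p + b * snd p, c * fst p + d * snd p))"

(* inverse of a 2x2 matrix of determinant 1 *)
definition mat_inv2 :: "mat2 \<Rightarrow> mat2" where
  "mat_inv2 g = (case g of (a,b,c,d) \<Rightarrow> (d, -b, -c, a))"

(* Moebius map on C \<union> {\<infinity>}, with None = \<infinity> *)
definition mobius :: "mat2 \<Rightarrow> complex option \<Rightarrow> complex option" where
  "mobius g z = (case g of (a,b,c,d) \<Rightarrow>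
     (case z of None \<Rightarrow> (if c = 0 then None else Some (a / c))
              | Some w \<Rightarrow> (if c * w + d = 0 then None else Some ((a * w + b) / (c * w + d)))))"

definition V_I :: "complex option set" where
  "V_I = {Some 0, None} \<union> Some ` {z. z^10 + 11 * z^5 - 1 = 0}"

definition Istar :: "mat2 set" where
  "Istar = {g \<in> SU2. mobius g ` V_I = V_I}"

definition dirderiv :: "(C2pt \<Rightarrow> complex) \<Rightarrow> C2pt \<Rightarrow> C2pt \<Rightarrow> complex" where
  "dirderiv G v x = vector_derivative (\<lambda>t::real. G (x + t *\<^sub>R v)) (at 0)"

definition lapR4 :: "(C2pt \<Rightarrow> complex) \<Rightarrow> C2pt \<Rightarrow> complex" where
  "lapR4 G x = (\<Sum>b\<in>(Basis :: C2pt set). dirderiv (\<lambda>y. dirderiv G b y) b x)"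

definition ext0 :: "(C2pt \<Rightarrow> complex) \<Rightarrow> C2pt \<Rightarrow> complex" where
  "ext0 F y = F (inverse (norm y) *\<^sub>R y)"

definition lapS3 :: "(C2pt \<Rightarrow> complex) \<Rightarrow> C2pt \<Rightarrow> complex" where
  "lapS3 F x = lapR4 (ext0 F) x"

definition C2_on :: "C2pt set \<Rightarrow> (C2pt \<Rightarrow> complex) \<Rightarrow> bool" where
  "C2_on U G \<longleftrightarrow> (\<exists>D1 D2.
      (\<forall>x\<in>U. (G has_derivative D1 x) (at x) \<and>
               (\<forall>v. ((\<lambda>y. D1 y v) has_derivative D2 x v) (at x))) \<and>
      (\<forall>v w. continuous_on U (\<lambda>x. D2 x v w)))"

(* functions on S^3 are represented by functions on C^2 vanishing off S^3 *)
definition restrS3 :: "(C2pt \<Rightarrow> complex) \<Rightarrow> C2pt \<Rightarrow> complex" where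
  "restrS3 f x = (if x \<in> S3 then f x else 0)"

definition modes :: "mat2 set \<Rightarrow> nat \<Rightarrow> (C2pt \<Rightarrow> complex) set" where
  "modes \<Gamma> k = {F. (\<forall>x. x \<notin> S3 \<longrightarrow> F x = 0)
      \<and> C2_on (- {0}) (ext0 F)
      \<and> (\<forall>x\<in>S3. lapS3 F x = - of_nat (k * (k + 2)) * F x)
      \<and> (\<forall>g\<in>\<Gamma>. \<forall>x\<in>S3. F (mat_act (mat_inv2 g) x) = F x)}"

(* Wirtinger derivatives; alpha = x + iy is the first coordinate, beta = z + iw the second *)
definition d_alpha :: "(C2pt \<Rightarrow> complex) \<Rightarrow> C2pt \<Rightarrow> complex" where
  "d_alpha f p = (dirderiv f (1, 0) p - \<i> * dirderiv f (\<i>, 0) p) / 2"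

definition d_beta :: "(C2pt \<Rightarrow> complex) \<Rightarrow> C2pt \<Rightarrow> complex" where
  "d_beta f p = (dirderiv f (0, 1) p - \<i> * dirderiv f (0, \<i>) p) / 2"

definition twist_minus :: "(C2pt \<Rightarrow> complex) \<Rightarrow> C2pt \<Rightarrow> complex" where
  "twist_minus f p = - cnj (snd p) * d_alpha f p + cnj (fst p) * d_beta f p"

definition I12 :: "C2pt \<Rightarrow> complex" where
  "I12 p = (let a = fst p; b = snd p in a^11 * b + 11 * a^6 * b^6 - a * b^11)"

definition I20 :: "C2pt \<Rightarrow> complex" where
  "I20 p = (let a = fst p; b = snd p in
     a^20 - 228 * a^15 * b^5 + 494 * a^10 * b^10 + 228 * a^5 * b^15 + b^20)"

definition I30 :: "C2pt \<Rightarrow> complex" where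
  "I30 p = (let a = fst p; b = snd p in
     a^30 + 522 * a^25 * b^5 - 10005 * a^20 * b^10 - 10005 * a^10 * b^20 - 522 * a^5 * b^25 + b^30)"

definition ktilde :: "nat \<Rightarrow> int" where
  "ktilde k = (let m = k div 2 in int (m div 2) + int (m div 3) + int (m div 5) - int m)"

(* B_i for even k, 0 \<le> i \<le> ktilde k *)
definition Bpoly :: "nat \<Rightarrow> nat \<Rightarrow> C2pt \<Rightarrow> complex" where
  "Bpoly k i p = (let m = k div 2 in
      I12 p ^ (5 * i + m mod 5) * I20 p ^ (3 * (nat (ktilde k) - i) + m mod 3) * I30 p ^ (m mod 2))"

definition sibling :: "nat \<Rightarrow> nat \<Rightarrow> nat \<Rightarrow> C2pt \<Rightarrow> complex" where
  "sibling k i j = restrS3 ((twist_minus ^^ j) (Bpoly k i))"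

end

theory Submission
  imports
    Defs
    "HOL-Computational_Algebra.Fundamental_Theorem_Algebra"
    "HOL-Library.Function_Algebras"
begin

text \<open>
  Write \<open>J (\<alpha>, \<beta>) = (- cnj \<beta>, cnj \<alpha>)\<close>. On binary forms \<open>twist_minus\<close> is the parameter derivative
  of \<open>f (p + t J p)\<close>, so the siblings of \<open>f\<close> are, up to factorials, the coefficients of this
  polynomial in \<open>t\<close>. For the monomials \<open>\<alpha> ^ a * \<beta> ^ b\<close> they are the matrix coefficients of \<open>SU(2)\<close>.
  These are harmonic, they span all polynomials on the sphere, and they are pairwise orthogonal:
  those of different degrees by Green's formula, those of the same degree because the torus acts
  on them by different characters. By the Stone--Weierstrass theorem every eigenfunction of
  wavenumber \<open>k\<close> is therefore a unique sum over \<open>j\<close> of \<open>j\<close>-th siblings of forms of degree \<open>k\<close>.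
  As \<open>J\<close> commutes with \<open>SU(2)\<close>, an invariant mode is a sum of siblings of invariant forms.

  An invariant form that vanishes at one vertex of the icosahedron is divisible by \<open>I12\<close>. A form
  that does not vanish there has degree \<open>10 n\<close> with \<open>n \<noteq> 1\<close>, and subtracting a multiple of some
  \<open>I20 ^ b * I30 ^ c\<close> with \<open>n = 2 b + 3 c\<close> makes it vanish. Hence the forms \<open>I12 ^ a * I20 ^ b * I30 ^ c\<close>
  with \<open>c \<le> 1\<close> span the invariants. They are invariant because \<open>I20\<close> and \<open>I30\<close> are covariants of \<open>I12\<close>,
  and the syzygy between the three forms forces the character by which \<open>I12\<close> transforms to be trivial.
\<close>

subsection \<open>Second-order jets\<close>

definition has_jet ::
  "('a::real_normed_vector \<Rightarrow> 'b::real_normed_vector) \<Rightarrow> ('a \<Rightarrow> 'a \<Rightarrow> 'b) \<Rightarrow> ('a \<Rightarrow> 'a \<Rightarrow> 'a \<Rightarrow> 'b) \<Rightarrow>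
   'a set \<Rightarrow> bool"
  where "has_jet f f1 f2 U \<longleftrightarrow>
    (\<forall>x\<in>U. (f has_derivative f1 x) (at x) \<and> (\<forall>v. ((\<lambda>y. f1 y v) has_derivative f2 x v) (at x))) \<and>
    (\<forall>v w. continuous_on U (\<lambda>x. f2 x v w))"

lemma C2_on_iff_has_jet: "C2_on U f \<longleftrightarrow> (\<exists>f1 f2. has_jet f f1 f2 U)"
  by (simp add: C2_on_def has_jet_def)

lemma
  assumes "has_jet f f1 f2 U"
  shows has_jet_derivative: "x \<in> U \<Longrightarrow> (f has_derivative f1 x) (at x)"
    and has_jet_second_derivative: "x \<in> U \<Longrightarrow> ((\<lambda>y. f1 y v) has_derivative f2 x v) (at x)"
    and has_jet_continuous_second: "continuous_on U (\<lambda>x. f2 x v w)"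
  using assms unfolding has_jet_def by blast+

lemma
  assumes "has_jet f f1 f2 U"
  shows has_jet_continuous_first: "continuous_on U (\<lambda>x. f1 x v)"
    and has_jet_continuous: "continuous_on U f"
  using has_jet_derivative[OF assms] has_jet_second_derivative[OF assms]
  by (meson continuous_at_imp_continuous_on has_derivative_continuous)+

lemmas has_jet_continuous_intros =
  has_jet_continuous has_jet_continuous_first has_jet_continuous_second

lemma has_jet_cong:
  assumes "has_jet f f1 f2 U" "open U" "\<And>x. x \<in> U \<Longrightarrow> f x = g x"
  shows "has_jet g f1 f2 U"
  using assms unfolding has_jet_def by (metis has_derivative_transform_within_open)

lemma has_jet_add:
  assumes f: "has_jet f f1 f2 U" and g: "has_jet g g1 g2 U"
  shows "has_jet (\<lambda>x. f x + g x) (\<lambda>x v. f1 x v + g1 x v) (\<lambda>x v w. f2 x v w + g2 x v w) U"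
  unfolding has_jet_def
  by (auto intro!: has_derivative_add continuous_intros
      has_jet_derivative[OF f] has_jet_second_derivative[OF f] has_jet_continuous_second[OF f]
      has_jet_derivative[OF g] has_jet_second_derivative[OF g] has_jet_continuous_second[OF g])

lemma has_jet_bounded_linear:
  assumes "bounded_linear h" and f: "has_jet f f1 f2 U"
  shows "has_jet (\<lambda>x. h (f x)) (\<lambda>x v. h (f1 x v)) (\<lambda>x v w. h (f2 x v w)) U"
  unfolding has_jet_def
  by (auto intro!: bounded_linear.has_derivative[OF assms(1)] bounded_linear.continuous_on[OF assms(1)]
      has_jet_derivative[OF f] has_jet_second_derivative[OF f] has_jet_continuous_second[OF f])

lemma has_jet_mult:
  fixes f g :: "'a::real_normed_vector \<Rightarrow> 'b::real_normed_algebra"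
  assumes f: "has_jet f f1 f2 U" and g: "has_jet g g1 g2 U"
  shows "has_jet (\<lambda>x. f x * g x) (\<lambda>x v. f x * g1 x v + f1 x v * g x)
    (\<lambda>x v w. (f x * g2 x v w + f1 x w * g1 x v) + (f1 x v * g1 x w + f2 x v w * g x)) U"
  unfolding has_jet_def
  by (auto intro!: has_derivative_add has_derivative_mult continuous_intros
      has_jet_derivative[OF f] has_jet_second_derivative[OF f] has_jet_continuous_intros[OF f]
      has_jet_derivative[OF g] has_jet_second_derivative[OF g] has_jet_continuous_intros[OF g])

lemma has_derivative_compose_scaleR:
  assumes "(f has_derivative f') (at (r *\<^sub>R y))"
  shows "((\<lambda>z. f (r *\<^sub>R z)) has_derivative (\<lambda>h. r *\<^sub>R f' h)) (at y)"
proof -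
  have "((\<lambda>z. f (r *\<^sub>R z)) has_derivative (\<lambda>h. f' (r *\<^sub>R h))) (at y)"
    by (rule has_derivative_compose[where g = f]) (auto intro!: derivative_eq_intros assms)
  then show ?thesis
    by (simp add: linear_scale[OF has_derivative_linear[OF assms]])
qed

lemma homogeneous_0_radial_derivative:
  assumes f: "(f has_derivative f') (at y)" and homogeneous: "\<And>r. r > 0 \<Longrightarrow> f (r *\<^sub>R y) = f y"
  shows "f' y = 0"
proof -
  have "(f has_derivative f') (at (1 *\<^sub>R y))"
    using f by simp
  then have "((\<lambda>t::real. f (t *\<^sub>R y)) has_derivative (\<lambda>t. f' (t *\<^sub>R y))) (at 1)"
    by (rule has_derivative_compose[rotated]) (auto intro!: derivative_eq_intros)
  moreover have "((\<lambda>t::real. f (t *\<^sub>R y)) has_derivative (\<lambda>t. 0)) (at 1)"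
    by (rule has_derivative_transform_within_open[of "\<lambda>t. f y" _ _ _ "{0<..}"]) (auto simp: homogeneous)
  ultimately have "(\<lambda>t::real. f' (t *\<^sub>R y)) = (\<lambda>t. 0)"
    by (rule has_derivative_unique)
  from fun_cong[OF this, of 1] show ?thesis
    by simp
qed

lemma homogeneous_0_first_derivative:
  assumes f: "\<And>x. x \<noteq> 0 \<Longrightarrow> (f has_derivative f1 x) (at x)"
    and homogeneous: "\<And>r y. r > 0 \<Longrightarrow> f (r *\<^sub>R y) = f y" and "r > 0" "y \<noteq> 0"
  shows "f1 (r *\<^sub>R y) v = f1 y v /\<^sub>R r"
proof -
  have "(f has_derivative (\<lambda>h. r *\<^sub>R f1 (r *\<^sub>R y) h)) (at y)"
    using has_derivative_compose_scaleR[OF f, of r y] assms(3,4) by (simp add: homogeneous)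
  then have "(\<lambda>h. r *\<^sub>R f1 (r *\<^sub>R y) h) = f1 y"
    using f[OF \<open>y \<noteq> 0\<close>] by (rule has_derivative_unique)
  from fun_cong[OF this, of v] show ?thesis
    using \<open>r > 0\<close> by (simp flip: \<open>_ = f1 y v\<close>)
qed

lemma homogeneous_0_second_derivative:
  assumes f: "has_jet f f1 f2 (- {0})" and homogeneous: "\<And>r y. r > 0 \<Longrightarrow> f (r *\<^sub>R y) = f y"
    and "r > 0" "y \<noteq> 0"
  shows "f2 (r *\<^sub>R y) v w = f2 y v w /\<^sub>R r\<^sup>2"
proof -
  have first: "f1 (r *\<^sub>R y) v = f1 y v /\<^sub>R r" if "y \<noteq> 0" for y
    by (rule homogeneous_0_first_derivative[OF _ homogeneous \<open>r > 0\<close> that])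
      (auto intro: has_jet_derivative[OF f])
  have "((\<lambda>z. f1 (r *\<^sub>R z) v) has_derivative (\<lambda>h. f2 y v h /\<^sub>R r)) (at y)"
  proof (rule has_derivative_transform_within_open[where s = "- {0}"])
    show "((\<lambda>z. f1 z v /\<^sub>R r) has_derivative (\<lambda>h. f2 y v h /\<^sub>R r)) (at y)"
      using has_jet_second_derivative[OF f] \<open>y \<noteq> 0\<close> by (intro has_derivative_scaleR_right) simp
  qed (use \<open>y \<noteq> 0\<close> first in auto)
  moreover have "((\<lambda>z. f1 (r *\<^sub>R z) v) has_derivative (\<lambda>h. r *\<^sub>R f2 (r *\<^sub>R y) v h)) (at y)"
    using has_derivative_compose_scaleR[OF has_jet_second_derivative[OF f]] \<open>r > 0\<close> \<open>y \<noteq> 0\<close> by simp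
  ultimately have "(\<lambda>h. f2 y v h /\<^sub>R r) = (\<lambda>h. r *\<^sub>R f2 (r *\<^sub>R y) v h)"
    by (rule has_derivative_unique)
  from arg_cong[OF fun_cong[OF this, of w], of "(*\<^sub>R) (inverse r)"] show ?thesis
    using \<open>r > 0\<close> by (simp add: power2_eq_square)
qed

subsection \<open>The Laplacian and functions of the direction\<close>

definition basis_trace :: "('a::euclidean_space \<Rightarrow> 'a \<Rightarrow> 'b::comm_monoid_add) \<Rightarrow> 'b" where
  "basis_trace B = (\<Sum>b\<in>Basis. B b b)"

lemma dirderiv_eq:
  assumes "(G has_derivative D) (at x)"
  shows "dirderiv G v x = D v"
proof -
  have "((\<lambda>t::real. x + t *\<^sub>R v) has_derivative (\<lambda>t. t *\<^sub>R v)) (at 0)"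
    by (auto intro!: derivative_eq_intros)
  moreover have "(G has_derivative D) (at (x + 0 *\<^sub>R v))"
    using assms by simp
  ultimately have "((\<lambda>t::real. G (x + t *\<^sub>R v)) has_derivative (\<lambda>t. D (t *\<^sub>R v))) (at 0)"
    by (rule has_derivative_compose)
  then show ?thesis
    unfolding dirderiv_def linear_scale[OF has_derivative_linear[OF assms]]
    by (simp add: has_vector_derivative_def vector_derivative_at)
qed

lemma lapR4_eq_basis_trace:
  assumes f: "has_jet f f1 f2 U" and "open U" "x \<in> U"
  shows "lapR4 f x = basis_trace (f2 x)"
  unfolding lapR4_def basis_trace_def
proof (rule sum.cong[OF refl])
  fix b :: C2pt
  have "((\<lambda>y. dirderiv f b y) has_derivative f2 x b) (at x)"
    by (rule has_derivative_transform_within_open[OF has_jet_second_derivative[OF f \<open>x \<in> U\<close>]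
      \<open>open U\<close> \<open>x \<in> U\<close>])
      (simp add: dirderiv_eq[OF has_jet_derivative[OF f]])
  then show "dirderiv (dirderiv f b) b x = f2 x b b"
    by (rule dirderiv_eq)
qed

lemma linear_sum_Basis:
  fixes x :: "'a::euclidean_space"
  assumes "linear f"
  shows "(\<Sum>b\<in>Basis. (x \<bullet> b) *\<^sub>R f b) = f x"
proof -
  have "(\<Sum>b\<in>Basis. (x \<bullet> b) *\<^sub>R f b) = f (\<Sum>b\<in>Basis. (x \<bullet> b) *\<^sub>R b)"
    using assms by (simp add: linear_sum linear_scale)
  then show ?thesis
    by (simp add: euclidean_representation)
qed

definition angular_eigenfunction :: "real \<Rightarrow> ('a::euclidean_space \<Rightarrow> complex) \<Rightarrow> bool" where
  "angular_eigenfunction \<mu> u \<longleftrightarrow> (\<exists>u1 u2. has_jet u u1 u2 (- {0}) \<and>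
     (\<forall>y. y \<noteq> 0 \<longrightarrow> u1 y y = 0 \<and> basis_trace (u2 y) = of_real (\<mu> / (norm y)\<^sup>2) * u y))"

lemma angular_eigenfunctionI:
  assumes "has_jet u u1 u2 (- {0})" "\<And>y. y \<noteq> 0 \<Longrightarrow> u1 y y = 0"
    "\<And>y. y \<noteq> 0 \<Longrightarrow> basis_trace (u2 y) = of_real (\<mu> / (norm y)\<^sup>2) * u y"
  shows "angular_eigenfunction \<mu> u"
  using assms unfolding angular_eigenfunction_def by blast

lemma angular_eigenfunctionE:
  assumes "angular_eigenfunction \<mu> u"
  obtains u1 u2 where "has_jet u u1 u2 (- {0})" "\<And>y. y \<noteq> 0 \<Longrightarrow> u1 y y = 0"
    "\<And>y. y \<noteq> 0 \<Longrightarrow> basis_trace (u2 y) = of_real (\<mu> / (norm y)\<^sup>2) * u y"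
  using assms unfolding angular_eigenfunction_def by blast

lemma angular_eigenfunction_continuous: "angular_eigenfunction \<mu> u \<Longrightarrow> continuous_on (- {0}) u"
  by (erule angular_eigenfunctionE) (rule has_jet_continuous)

lemma angular_eigenfunction_add:
  assumes "angular_eigenfunction \<mu> u" "angular_eigenfunction \<mu> v"
  shows "angular_eigenfunction \<mu> (\<lambda>y. u y + v y)"
proof -
  obtain u1 u2 where u: "has_jet u u1 u2 (- {0})" "\<And>y. y \<noteq> 0 \<Longrightarrow> u1 y y = 0"
    "\<And>y. y \<noteq> 0 \<Longrightarrow> basis_trace (u2 y) = of_real (\<mu> / (norm y)\<^sup>2) * u y"
    using angular_eigenfunctionE[OF assms(1)] by blast
  obtain v1 v2 where v: "has_jet v v1 v2 (- {0})" "\<And>y. y \<noteq> 0 \<Longrightarrow> v1 y y = 0"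
    "\<And>y. y \<noteq> 0 \<Longrightarrow> basis_trace (v2 y) = of_real (\<mu> / (norm y)\<^sup>2) * v y"
    using angular_eigenfunctionE[OF assms(2)] by blast
  show ?thesis
    by (rule angular_eigenfunctionI[OF has_jet_add[OF u(1) v(1)]])
      (use u(2,3) v(2,3) in \<open>simp_all add: basis_trace_def sum.distrib distrib_left\<close>)
qed

lemma angular_eigenfunction_scale:
  assumes "angular_eigenfunction \<mu> u"
  shows "angular_eigenfunction \<mu> (\<lambda>y. c * u y)"
proof -
  obtain u1 u2 where u: "has_jet u u1 u2 (- {0})" "\<And>y. y \<noteq> 0 \<Longrightarrow> u1 y y = 0"
    "\<And>y. y \<noteq> 0 \<Longrightarrow> basis_trace (u2 y) = of_real (\<mu> / (norm y)\<^sup>2) * u y"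
    using angular_eigenfunctionE[OF assms] by blast
  show ?thesis
    by (rule angular_eigenfunctionI[OF has_jet_bounded_linear[OF bounded_linear_mult_right u(1)]])
      (use u(2,3) in \<open>simp_all add: basis_trace_def flip: sum_distrib_left\<close>)
qed

lemma angular_eigenfunction_cnj:
  assumes "angular_eigenfunction \<mu> u"
  shows "angular_eigenfunction \<mu> (\<lambda>y. cnj (u y))"
proof -
  obtain u1 u2 where u: "has_jet u u1 u2 (- {0})" "\<And>y. y \<noteq> 0 \<Longrightarrow> u1 y y = 0"
    "\<And>y. y \<noteq> 0 \<Longrightarrow> basis_trace (u2 y) = of_real (\<mu> / (norm y)\<^sup>2) * u y"
    using angular_eigenfunctionE[OF assms] by blast
  show ?thesis
    by (rule angular_eigenfunctionI[OF has_jet_bounded_linear[OF bounded_linear_cnj u(1)]])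
      (use u(2,3) in \<open>simp_all add: basis_trace_def flip: cnj_sum\<close>)
qed

lemma angular_eigenfunction_cong:
  assumes "angular_eigenfunction \<mu> u" "\<And>y. y \<noteq> 0 \<Longrightarrow> u y = v y"
  shows "angular_eigenfunction \<mu> v"
proof -
  obtain u1 u2 where u: "has_jet u u1 u2 (- {0})" "\<And>y. y \<noteq> 0 \<Longrightarrow> u1 y y = 0"
    "\<And>y. y \<noteq> 0 \<Longrightarrow> basis_trace (u2 y) = of_real (\<mu> / (norm y)\<^sup>2) * u y"
    using angular_eigenfunctionE[OF assms(1)] by blast
  have "has_jet v u1 u2 (- {0})"
    using u(1) assms(2) by (auto intro: has_jet_cong)
  then show ?thesis
    by (rule angular_eigenfunctionI) (use u(2,3) assms(2) in auto)
qed

lemma angular_eigenfunction_0: "angular_eigenfunction \<mu> (\<lambda>y. 0)"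
proof (rule angular_eigenfunctionI)
  show "has_jet (\<lambda>y. 0) (\<lambda>_ _. 0) (\<lambda>_ _ _. 0) (- {0})"
    by (simp add: has_jet_def)
qed (simp_all add: basis_trace_def)

lemma angular_eigenfunction_sum:
  assumes "\<And>i. i \<in> A \<Longrightarrow> angular_eigenfunction \<mu> (u i)"
  shows "angular_eigenfunction \<mu> (\<lambda>y. \<Sum>i\<in>A. c i * u i y)"
  using assms
  by (induction A rule: infinite_finite_induct)
    (auto intro!: angular_eigenfunction_0 angular_eigenfunction_add angular_eigenfunction_scale)

lemma has_derivative_inverse_norm_power:
  fixes x :: "'a::real_inner"
  assumes "x \<noteq> 0"
  shows "((\<lambda>y. inverse (norm y) ^ m) has_derivative
    (\<lambda>v. - real m * (x \<bullet> v) * inverse (norm x) ^ (m + 2))) (at x)"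
proof -
  have "(norm has_derivative (\<lambda>v. sgn x \<bullet> v)) (at x)"
    using has_derivative_norm[OF assms] by (simp add: inner_commute)
  then have "((\<lambda>y. inverse (norm y) ^ m) has_derivative
    (\<lambda>v. real m * (- (inverse (norm x) * (sgn x \<bullet> v) * inverse (norm x)))
      * inverse (norm x) ^ (m - 1))) (at x)"
    using assms by (auto intro!: derivative_eq_intros simp: fun_eq_iff)
  then show ?thesis
    by (rule has_derivative_eq_rhs)
      (cases m; auto simp: fun_eq_iff sgn_div_norm inner_commute divide_inverse algebra_simps)
qed

definition inverse_norm_power_D1 :: "nat \<Rightarrow> 'a::real_inner \<Rightarrow> 'a \<Rightarrow> real" where
  "inverse_norm_power_D1 k x v = - real k * (x \<bullet> v) * inverse (norm x) ^ (k + 2)"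

definition inverse_norm_power_D2 :: "nat \<Rightarrow> 'a::real_inner \<Rightarrow> 'a \<Rightarrow> 'a \<Rightarrow> real" where
  "inverse_norm_power_D2 k x v w = - real k * ((w \<bullet> v) * inverse (norm x) ^ (k + 2)
     - (x \<bullet> v) * (real (k + 2) * (x \<bullet> w) * inverse (norm x) ^ (k + 4)))"

lemma has_jet_inverse_norm_power:
  "has_jet (\<lambda>y::'a::real_inner. inverse (norm y) ^ k) (inverse_norm_power_D1 k)
      (inverse_norm_power_D2 k) (- {0})"
  unfolding has_jet_def
proof (intro conjI ballI allI)
  fix x v :: 'a assume "x \<in> - {0}"
  then have x: "x \<noteq> 0" by simp
  show "((\<lambda>y. inverse (norm y) ^ k) has_derivative inverse_norm_power_D1 k x) (at x)"
    unfolding inverse_norm_power_D1_def[abs_def] by (rule has_derivative_inverse_norm_power[OF x])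
  have "((\<lambda>y. - real k * (y \<bullet> v)) has_derivative (\<lambda>w. - real k * (w \<bullet> v))) (at x)"
    by (auto intro!: derivative_eq_intros)
  from has_derivative_mult[OF this has_derivative_inverse_norm_power[OF x, of "k + 2"]]
  show "((\<lambda>y. inverse_norm_power_D1 k y v) has_derivative inverse_norm_power_D2 k x v) (at x)"
    unfolding inverse_norm_power_D1_def
    by (rule has_derivative_eq_rhs)
      (simp add: inverse_norm_power_D2_def fun_eq_iff algebra_simps numeral_eq_Suc)
next
  fix v w :: 'a
  show "continuous_on (- {0}) (\<lambda>x. inverse_norm_power_D2 k x v w)"
    unfolding inverse_norm_power_D2_def by (intro continuous_intros) auto
qed

lemma has_jet_of_real_inverse_norm_power:
  "has_jet (\<lambda>y::'a::real_inner. of_real (inverse (norm y) ^ k) :: complex)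
     (\<lambda>y v. of_real (inverse_norm_power_D1 k y v)) (\<lambda>y v w. of_real (inverse_norm_power_D2 k y v w))
       (- {0})"
  by (rule has_jet_bounded_linear[OF bounded_linear_of_real has_jet_inverse_norm_power])

lemma inner_self_inverse_norm: "x \<noteq> 0 \<Longrightarrow> (x \<bullet> x) * inverse (norm x) ^ (k + 2) = inverse (norm x) ^ k"
  by (simp add: dot_square_norm power_add power2_eq_square field_simps)

lemma inverse_norm_power_D1_radial:
  assumes "y \<noteq> 0"
  shows "inverse_norm_power_D1 k y y = - real k * inverse (norm y) ^ k"
  unfolding inverse_norm_power_D1_def mult.assoc inner_self_inverse_norm[OF assms] ..

lemma basis_trace_inverse_norm_power_D2:
  fixes y :: "'a::euclidean_space"
  assumes "y \<noteq> 0"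
  shows "basis_trace (inverse_norm_power_D2 k y)
      = - real k * (DIM('a) - (real k + 2)) * inverse (norm y) ^ (k + 2)"
proof -
  define s where "s = inverse (norm y)"
  have "basis_trace (inverse_norm_power_D2 k y)
      = (\<Sum>b\<in>Basis. - real k * (s ^ (k + 2) - (y \<bullet> b) * (y \<bullet> b) * (real (k + 2) * s ^ (k + 2 + 2))))"
    unfolding basis_trace_def
    by (intro sum.cong refl) (simp add: inverse_norm_power_D2_def s_def inner_Basis numeral_eq_Suc)
  also have "\<dots> = - real k * (DIM('a) * s ^ (k + 2) - real (k + 2) * ((y \<bullet> y) * s ^ (k + 2 + 2)))"
    by (simp add: sum_negf sum_subtractf euclidean_inner[of y y]
      flip: sum_distrib_left sum_distrib_right)
  also have "(y \<bullet> y) * s ^ (k + 2 + 2) = s ^ (k + 2)"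
    unfolding s_def by (rule inner_self_inverse_norm[OF assms])
  finally show ?thesis
    by (simp add: s_def algebra_simps)
qed

lemma angular_eigenfunction_harmonic:
  fixes f :: "'a::euclidean_space \<Rightarrow> complex"
  assumes f: "has_jet f f1 f2 (- {0})"
    and euler: "\<And>y. y \<noteq> 0 \<Longrightarrow> f1 y y = of_nat k * f y"
    and harmonic: "\<And>y. y \<noteq> 0 \<Longrightarrow> basis_trace (f2 y) = 0"
  shows "angular_eigenfunction (- real k * (real k + DIM('a) - 2))
    (\<lambda>y. of_real (inverse (norm y) ^ k) * f y)"
proof -
  let ?\<rho> = "\<lambda>y::'a. complex_of_real (inverse (norm y) ^ k)"
  let ?\<rho>1 = "\<lambda>y v::'a. complex_of_real (inverse_norm_power_D1 k y v)"
  let ?\<rho>2 = "\<lambda>y v w::'a. complex_of_real (inverse_norm_power_D2 k y v w)"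
  let ?\<mu> = "- real k * (real k + DIM('a) - 2)"
  from has_jet_mult[OF has_jet_of_real_inverse_norm_power f] show ?thesis
  proof (rule angular_eigenfunctionI)
    fix y :: 'a assume y: "y \<noteq> 0"
    define s where "s = inverse (norm y) ^ (k + 2)"
    show "?\<rho> y * f1 y y + ?\<rho>1 y y * f y = 0"
      using euler[OF y] inverse_norm_power_D1_radial[OF y, of k] by simp
    have "(\<Sum>b\<in>Basis. ?\<rho>1 y b * f1 y b) = - of_nat k * of_real s * (\<Sum>b\<in>Basis. (y \<bullet> b) *\<^sub>R f1 y b)"
      unfolding sum_distrib_left
      by (intro sum.cong) (simp_all add: inverse_norm_power_D1_def s_def scaleR_conv_of_real)
    also have "\<dots> = - of_nat k * of_nat k * of_real s * f y"
      using linear_sum_Basis[OF has_derivative_linear[OF has_jet_derivative[OF f]]] y euler by simp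
    finally have cross: "(\<Sum>b\<in>Basis. ?\<rho>1 y b * f1 y b) = - of_nat k * of_nat k * of_real s * f y" .
    have trace: "basis_trace (?\<rho>2 y) = of_real (- real k * (DIM('a) - (real k + 2)) * s)"
      unfolding s_def basis_trace_inverse_norm_power_D2[OF y, symmetric] by (simp add: basis_trace_def)
    have "basis_trace (\<lambda>v w. (?\<rho> y * f2 y v w + ?\<rho>1 y w * f1 y v)
        + (?\<rho>1 y v * f1 y w + ?\<rho>2 y v w * f y))
      = ?\<rho> y * basis_trace (f2 y) + 2 * (\<Sum>b\<in>Basis. ?\<rho>1 y b * f1 y b) + basis_trace (?\<rho>2 y) * f y"
      by (simp add: basis_trace_def sum.distrib sum_distrib_left sum_distrib_right mult.commute)
    also have "\<dots> = of_real (?\<mu> * s) * f y"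
      unfolding cross trace using harmonic[OF y] by (simp add: algebra_simps)
    also have "\<dots> = of_real (?\<mu> / (norm y)\<^sup>2) * (?\<rho> y * f y)"
      by (simp add: s_def divide_inverse power2_eq_square)
    finally show "basis_trace (\<lambda>v w. (?\<rho> y * f2 y v w + ?\<rho>1 y w * f1 y v)
        + (?\<rho>1 y v * f1 y w + ?\<rho>2 y v w * f y))
      = of_real (?\<mu> / (norm y)\<^sup>2) * (?\<rho> y * f y)" .
  qed
qed

subsection \<open>Integration by parts with compact support\<close>

lemma integrable_continuous_compact_support:
  fixes f :: "'a::euclidean_space \<Rightarrow> 'b::{banach, second_countable_topology}"
  assumes "continuous_on UNIV f" "\<And>x. R \<le> norm x \<Longrightarrow> f x = 0"
  shows "integrable lborel f"
proof -
  have "integrable lborel (\<lambda>x. indicator (cball 0 R) x *\<^sub>R f x)"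
    using assms(1) by (intro borel_integrable_compact) (auto intro: continuous_on_subset)
  also have "(\<lambda>x. indicator (cball 0 R) x *\<^sub>R f x) = f"
    using assms(2) by (auto simp: fun_eq_iff indicator_def)
  finally show ?thesis .
qed

lemma
  fixes f :: "'a::euclidean_space \<Rightarrow> 'b::{banach, second_countable_topology}"
  assumes "integrable lborel f"
  shows integrable_translation: "integrable lborel (\<lambda>x. f (c + x))"
    and integral_translation: "(\<integral>x. f (c + x) \<partial>lborel) = (\<integral>x. f x \<partial>lborel)"
proof -
  have f: "f \<in> borel_measurable borel"
    using borel_measurable_integrable[OF assms] by simp
  show "integrable lborel (\<lambda>x. f (c + x))"
    using integrable_distr_eq[of "(+) c" lborel borel f] assms f by (simp add: lborel_distr_plus)
  show "(\<integral>x. f (c + x) \<partial>lborel) = (\<integral>x. f x \<partial>lborel)"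
    using integral_distr[of "(+) c" lborel borel f] f by (simp add: lborel_distr_plus)
qed

lemma integral_eq_lborel:
  fixes f :: "'a::euclidean_space \<Rightarrow> 'b::euclidean_space"
  assumes "integrable lborel f" "\<And>x. x \<notin> S \<Longrightarrow> f x = 0"
  shows "integral S f = (\<integral>x. f x \<partial>lborel)"
proof -
  have "(f has_integral (\<integral>x. f x \<partial>lborel)) UNIV"
    by (rule has_integral_integral_lborel[OF assms(1)])
  moreover have "(\<lambda>x. if x \<in> S then f x else 0) = f"
    using assms(2) by auto
  ultimately have "(f has_integral (\<integral>x. f x \<partial>lborel)) S"
    by (metis has_integral_restrict_UNIV)
  then show ?thesis
    by (rule integral_unique)
qed

lemma has_derivative_eq_0_outside_support:
  assumes "(f has_derivative D) (at x)" "\<And>y. R \<le> norm y \<Longrightarrow> f y = 0" "R < norm x"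
  shows "D v = 0"
proof -
  have "(f has_derivative (\<lambda>_. 0)) (at x)"
  proof (rule has_derivative_transform_within_open[where f = "\<lambda>_. 0"])
    show "open {y. R < norm y}"
      by (intro open_Collect_less continuous_intros)
  qed (use assms in auto)
  then show ?thesis
    using has_derivative_unique[OF assms(1)] by (simp add: fun_eq_iff)
qed

lemma integral_translate_over_box:
  fixes f :: "'a::euclidean_space \<Rightarrow> 'b::euclidean_space"
  assumes int: "integrable lborel f" and supp: "\<And>x. R \<le> norm x \<Longrightarrow> f x = 0"
    and box: "cball 0 (R + norm v) \<subseteq> C" and t: "\<bar>t\<bar> \<le> 1"
  shows "integral C (\<lambda>x. f (t *\<^sub>R v + x)) = (\<integral>x. f x \<partial>lborel)"
proof -
  have "f (t *\<^sub>R v + x) = 0" if "x \<notin> C" for x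
  proof (rule supp)
    have "R + norm v < norm x"
      using that box by (auto simp: not_le[symmetric])
    moreover have "norm x \<le> norm (t *\<^sub>R v + x) + norm (t *\<^sub>R v)"
      using norm_triangle_ineq4[of "t *\<^sub>R v + x" "t *\<^sub>R v"] by simp
    moreover have "norm (t *\<^sub>R v) \<le> norm v"
      using t by (simp add: mult_left_le_one_le)
    ultimately show "R \<le> norm (t *\<^sub>R v + x)" by linarith
  qed
  then show ?thesis
    using integral_eq_lborel[OF integrable_translation[OF int], of C "t *\<^sub>R v"]
    by (simp add: integral_translation[OF int])
qed

lemma has_vector_derivative_integral_translate:
  fixes f :: "'a::euclidean_space \<Rightarrow> 'b::euclidean_space"
  assumes D: "\<And>x. (f has_derivative D x) (at x)" and cont: "continuous_on UNIV (\<lambda>x. D x v)"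
  shows "((\<lambda>t. integral (cbox a b) (\<lambda>x. f (t *\<^sub>R v + x))) has_vector_derivative
    integral (cbox a b) (\<lambda>x. D x v)) (at 0)"
proof -
  let ?U = "ball (0::real) 1"
  have cont_f: "continuous_on UNIV f"
    using D by (meson continuous_at_imp_continuous_on has_derivative_continuous)
  have "((\<lambda>t. integral (cbox a b) (\<lambda>x. f (t *\<^sub>R v + x))) has_vector_derivative
      integral (cbox a b) (\<lambda>x. D (0 *\<^sub>R v + x) v)) (at 0 within ?U)"
  proof (rule leibniz_rule_vector_derivative)
    fix t :: real and x :: 'a
    have "((\<lambda>t. f (t *\<^sub>R v + x)) has_derivative (\<lambda>r. D (t *\<^sub>R v + x) (r *\<^sub>R v))) (at t)"
      by (rule has_derivative_compose[OF _ D]) (auto intro!: derivative_eq_intros)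
    then show "((\<lambda>t. f (t *\<^sub>R v + x)) has_vector_derivative D (t *\<^sub>R v + x) v) (at t within ?U)"
      unfolding has_vector_derivative_def
      by (simp add: has_derivative_at_withinI linear_scale[OF has_derivative_linear[OF D]])
    show "(\<lambda>x. f (t *\<^sub>R v + x)) integrable_on cbox a b"
      by (intro integrable_continuous continuous_on_compose2[OF cont_f] continuous_intros) auto
    show "continuous_on (?U \<times> cbox a b) (\<lambda>(t, x). D (t *\<^sub>R v + x) v)"
      unfolding split_beta by (intro continuous_on_compose2[OF cont] continuous_intros) auto
  qed auto
  then show ?thesis
    using at_within_open[of "0::real" ?U] by simp
qed

lemma integral_directional_derivative_compact_support:
  fixes f :: "'a::euclidean_space \<Rightarrow> 'b::euclidean_space"
  assumes D: "\<And>x. (f has_derivative D x) (at x)"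
    and cont: "continuous_on UNIV (\<lambda>x. D x v)"
    and supp: "\<And>x. R \<le> norm x \<Longrightarrow> f x = 0"
  shows "(\<integral>x. D x v \<partial>lborel) = 0"
proof -
  have "continuous_on UNIV f"
    using D by (meson continuous_at_imp_continuous_on has_derivative_continuous)
  then have int_f: "integrable lborel f"
    using supp by (rule integrable_continuous_compact_support)
  obtain a :: 'a where box: "cball 0 (R + norm v) \<subseteq> cbox (- a) a"
    using bounded_subset_cbox_symmetric[OF bounded_cball] by blast
  let ?C = "cbox (- a) a"
  have "((\<lambda>t. integral ?C (\<lambda>x. f (t *\<^sub>R v + x))) has_vector_derivative integral ?C (\<lambda>x. D x v)) (at 0)"
    using D cont by (rule has_vector_derivative_integral_translate)
  then have "((\<lambda>t. \<integral>x. f x \<partial>lborel) has_vector_derivative integral ?C (\<lambda>x. D x v)) (at 0)"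
    by (rule has_vector_derivative_transform_within_open[where S = "ball 0 1"])
      (auto intro!: integral_translate_over_box[OF int_f supp box])
  then have "integral ?C (\<lambda>x. D x v) = 0"
    by (rule vector_derivative_unique_at) (rule has_vector_derivative_const)
  moreover have vanish: "D x v = 0" if "x \<notin> cball 0 (R + norm v)" for x
  proof (rule has_derivative_eq_0_outside_support[OF D supp])
    have "R + norm v < norm x"
      using that by (simp add: not_le)
    then show "R < norm x"
      using norm_ge_zero[of v] by linarith
  qed
  have "integral ?C (\<lambda>x. D x v) = (\<integral>x. D x v \<partial>lborel)"
  proof (rule integral_eq_lborel)
    show "integrable lborel (\<lambda>x. D x v)"
      using cont vanish
      by (intro integrable_continuous_compact_support[where R = "R + norm v + 1"]) auto
  qed (use vanish box in blast)
  ultimately show ?thesis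
    by simp
qed

text \<open>The sphere carries no measure in the library, so functions on it are integrated, as functions
  of the direction, over the shell between the radii 1 and 2 with a smooth radial weight.\<close>

definition vanishes_off_shell :: "('a::real_normed_vector \<Rightarrow> 'b::zero) \<Rightarrow> bool" where
  "vanishes_off_shell f \<longleftrightarrow> (\<forall>y. norm y \<le> 1 \<or> 2 \<le> norm y \<longrightarrow> f y = 0)"

lemma continuous_on_UNIV_if_vanishes_off_shell:
  fixes f :: "'a::real_normed_vector \<Rightarrow> 'b::real_normed_vector"
  assumes "continuous_on (- {0}) f" "vanishes_off_shell f"
  shows "continuous_on UNIV f"
proof -
  have "continuous_on (ball 0 1) f"
    using continuous_on_const[of "ball 0 1" 0]
    by (rule continuous_on_eq) (use assms(2) in \<open>auto simp: vanishes_off_shell_def\<close>)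
  then have "continuous_on (- {0} \<union> ball 0 1) f"
    using assms(1) by (intro continuous_on_open_Un) auto
  moreover have "- {0} \<union> ball 0 1 = (UNIV :: 'a set)"
    by auto
  ultimately show ?thesis by simp
qed

lemma integrable_if_vanishes_off_shell:
  fixes f :: "'a::euclidean_space \<Rightarrow> 'b::{banach, second_countable_topology}"
  assumes "continuous_on (- {0}) f" "vanishes_off_shell f"
  shows "integrable lborel f"
  using continuous_on_UNIV_if_vanishes_off_shell[OF assms] assms(2)
  by (intro integrable_continuous_compact_support[where R = 2]) (auto simp: vanishes_off_shell_def)

lemma integral_shell_divergence:
  fixes w :: "'a::euclidean_space \<Rightarrow> 'a \<Rightarrow> 'b::euclidean_space"
  assumes D: "\<And>b y. y \<noteq> 0 \<Longrightarrow> (w b has_derivative D b y) (at y)"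
    and cont: "\<And>b. continuous_on (- {0}) (\<lambda>y. D b y b)"
    and supp: "\<And>b. vanishes_off_shell (w b)" "\<And>b. vanishes_off_shell (\<lambda>y. D b y b)"
  shows "(\<integral>y. (\<Sum>b\<in>Basis. D b y b) \<partial>lborel) = 0"
proof -
  define E where "E b y = (if y = 0 then \<lambda>_. 0 else D b y)" for b y
  have E_eq: "E b y b = D b y b" for b y
    using supp(2)[of b] by (simp add: E_def vanishes_off_shell_def)
  have E: "(w b has_derivative E b y) (at y)" for b y
  proof (cases "y = 0")
    case True
    have "(w b has_derivative (\<lambda>_. 0)) (at 0)"
      by (rule has_derivative_transform_within_open[where f = "\<lambda>_. 0" and s = "ball 0 1"])
        (use supp(1) in \<open>auto simp: vanishes_off_shell_def\<close>)
    then show ?thesis using True by (simp add: E_def)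
  qed (simp add: E_def D)
  have "(\<integral>y. E b y b \<partial>lborel) = 0" for b
  proof (rule integral_directional_derivative_compact_support[OF E])
    show "continuous_on UNIV (\<lambda>y. E b y b)"
      unfolding E_eq by (rule continuous_on_UNIV_if_vanishes_off_shell[OF cont supp(2)])
    show "w b y = 0" if "2 \<le> norm y" for y
      using supp(1) that by (simp add: vanishes_off_shell_def)
  qed
  moreover have "(\<integral>y. (\<Sum>b\<in>Basis. D b y b) \<partial>lborel) = (\<Sum>b\<in>Basis. \<integral>y. D b y b \<partial>lborel)"
    by (rule Bochner_Integration.integral_sum) (rule integrable_if_vanishes_off_shell[OF cont supp(2)])
  ultimately show ?thesis
    by (simp add: E_eq)
qed

subsection \<open>An inner product on functions of the direction\<close>

lemma has_real_derivative_max_0_square: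
  "((\<lambda>x::real. (max 0 x)\<^sup>2) has_real_derivative 2 * max 0 x) (at x)"
proof -
  consider "x > 0" | "x < 0" | "x = 0" by linarith
  then show ?thesis
  proof cases
    assume "x > 0"
    then have "((\<lambda>x::real. x\<^sup>2) has_real_derivative 2 * max 0 x) (at x)"
      by (auto intro!: derivative_eq_intros)
    then show ?thesis
      by (rule has_field_derivative_transform_within_open[where S = "{0<..}"]) (use \<open>x > 0\<close> in auto)
  next
    assume "x < 0"
    then have "((\<lambda>x::real. 0) has_real_derivative 2 * max 0 x) (at x)"
      by (auto intro!: derivative_eq_intros)
    then show ?thesis
      by (rule has_field_derivative_transform_within_open[where S = "{..<0}"]) (use \<open>x < 0\<close> in auto)
  next
    assume "x = 0"
    have "((\<lambda>y::real. (max 0 y)\<^sup>2 / y) \<longlongrightarrow> 0) (at 0)"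
    proof (rule Lim_null_comparison)
      show "\<forall>\<^sub>F y in at 0. norm ((max 0 y)\<^sup>2 / y) \<le> \<bar>y\<bar>"
        by (intro always_eventually) (auto simp: max_def power2_eq_square)
      show "((\<lambda>y::real. \<bar>y\<bar>) \<longlongrightarrow> 0) (at 0)"
        by (intro tendsto_eq_intros) auto
    qed
    then show ?thesis
      using \<open>x = 0\<close> by (simp add: has_field_derivative_iff)
  qed
qed

definition shell_weight :: "'a::real_inner \<Rightarrow> real" where
  "shell_weight y = (max 0 ((y \<bullet> y - 1) * (4 - y \<bullet> y)))\<^sup>2"

definition shell_weight_slope :: "'a::real_inner \<Rightarrow> real" where
  "shell_weight_slope y = 4 * max 0 ((y \<bullet> y - 1) * (4 - y \<bullet> y)) * (5 - 2 * (y \<bullet> y))"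

lemma has_derivative_shell_weight:
  "(shell_weight has_derivative (\<lambda>v. shell_weight_slope y * (y \<bullet> v))) (at y)"
proof -
  have "((\<lambda>y. (y \<bullet> y - 1) * (4 - y \<bullet> y)) has_derivative (\<lambda>v. 2 * (5 - 2 * (y \<bullet> y)) * (y \<bullet> v))) (at y)"
    by (auto intro!: derivative_eq_intros simp: fun_eq_iff inner_commute algebra_simps)
  from has_derivative_compose[OF this
      has_real_derivative_max_0_square[unfolded has_field_derivative_def]]
  show ?thesis
    unfolding shell_weight_def[abs_def]
    by (rule has_derivative_eq_rhs) (simp add: shell_weight_slope_def fun_eq_iff)
qed

lemma
  shows shell_weight_vanishes: "vanishes_off_shell (shell_weight :: 'a::real_inner \<Rightarrow> real)"
    and shell_weight_slope_vanishes: "vanishes_off_shell (shell_weight_slope :: 'a \<Rightarrow> real)"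
proof -
  have "(y \<bullet> y - 1) * (4 - y \<bullet> y) \<le> 0" if "norm y \<le> 1 \<or> 2 \<le> norm y" for y :: 'a
  proof -
    have "norm y ^ 2 \<le> 1 \<or> 4 \<le> norm y ^ 2"
      using that power_mono[of "norm y" 1 2] power_mono[of 2 "norm y" 2] by auto
    moreover have "norm y ^ 2 \<ge> 0" by simp
    ultimately show ?thesis
      unfolding dot_square_norm by (auto simp: mult_le_0_iff)
  qed
  then show "vanishes_off_shell (shell_weight :: 'a \<Rightarrow> real)"
    "vanishes_off_shell (shell_weight_slope :: 'a \<Rightarrow> real)"
    by (simp_all add: vanishes_off_shell_def shell_weight_def shell_weight_slope_def)
qed

lemma shell_weight_nonneg: "shell_weight y \<ge> 0"
  by (simp add: shell_weight_def)

lemma shell_weight_pos: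
  assumes "1 < norm y" "norm y < 2"
  shows "shell_weight y > 0"
proof -
  have "1 < norm y ^ 2" "norm y ^ 2 < 2 ^ 2"
    using assms power_strict_mono[of 1 "norm y" 2] power_strict_mono[of "norm y" 2 2] by auto
  then show ?thesis
    by (simp add: shell_weight_def dot_square_norm max_def not_le)
qed

lemma continuous_shell_weight: "continuous_on S shell_weight" "continuous_on S shell_weight_slope"
  unfolding shell_weight_def[abs_def] shell_weight_slope_def[abs_def] by (intro continuous_intros)+

lemma shell_weight_0 [simp]: "shell_weight 0 = 0" "shell_weight_slope 0 = 0"
  by (simp_all add: shell_weight_def shell_weight_slope_def)

definition shell_prod :: "('a::euclidean_space \<Rightarrow> complex) \<Rightarrow> ('a \<Rightarrow> complex) \<Rightarrow> complex" where
  "shell_prod u v = (\<integral>y. of_real (shell_weight y) * (u y * cnj (v y)) \<partial>lborel)"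

lemma integrable_shell_prod:
  fixes u v :: "'a::euclidean_space \<Rightarrow> complex"
  assumes "continuous_on (- {0}) u" "continuous_on (- {0}) v"
  shows "integrable lborel (\<lambda>y. of_real (shell_weight y) * (u y * cnj (v y)))"
proof (rule integrable_if_vanishes_off_shell)
  show "continuous_on (- {0}) (\<lambda>y. of_real (shell_weight y) * (u y * cnj (v y)))"
    by (intro continuous_intros continuous_shell_weight assms)
  show "vanishes_off_shell (\<lambda>y. of_real (shell_weight y) * (u y * cnj (v y)))"
    using shell_weight_vanishes[where 'a = 'a] by (simp add: vanishes_off_shell_def)
qed

lemma shell_prod_diff_left:
  assumes "continuous_on (- {0}) u" "continuous_on (- {0}) u'" "continuous_on (- {0}) v"
  shows "shell_prod (\<lambda>y. u y - u' y) v = shell_prod u v - shell_prod u' v"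
  unfolding shell_prod_def using integrable_shell_prod[OF assms(1,3)]
    integrable_shell_prod[OF assms(2,3)]
  by (simp add: algebra_simps)

lemma shell_prod_add_left:
  assumes "continuous_on (- {0}) u" "continuous_on (- {0}) u'" "continuous_on (- {0}) v"
  shows "shell_prod (\<lambda>y. u y + u' y) v = shell_prod u v + shell_prod u' v"
  unfolding shell_prod_def using integrable_shell_prod[OF assms(1,3)]
    integrable_shell_prod[OF assms(2,3)]
  by (simp add: algebra_simps)

lemma shell_prod_scale_left: "shell_prod (\<lambda>y. c * u y) v = c * shell_prod u v"
proof -
  have "shell_prod (\<lambda>y. c * u y) v = (\<integral>y. c * (of_real (shell_weight y) * (u y * cnj (v y))) \<partial>lborel)"
    unfolding shell_prod_def by (simp add: mult_ac)
  then show ?thesis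
    unfolding shell_prod_def by (simp only: integral_mult_right_zero)
qed

lemma shell_prod_0_left [simp]: "shell_prod (\<lambda>y. 0) v = 0"
  by (simp add: shell_prod_def)

lemma shell_prod_sum_left:
  assumes "\<And>i. i \<in> A \<Longrightarrow> continuous_on (- {0}) (\<phi> i)" "continuous_on (- {0}) v"
  shows "shell_prod (\<lambda>y. \<Sum>i\<in>A. c i * \<phi> i y) v = (\<Sum>i\<in>A. c i * shell_prod (\<phi> i) v)"
  using assms(1)
  by (induction A rule: infinite_finite_induct)
    (simp_all add: shell_prod_add_left shell_prod_scale_left assms(2) continuous_intros)

lemma shell_prod_cnj: "cnj (shell_prod u v) = shell_prod v u"
proof -
  have "cnj (shell_prod u v) = (\<integral>y. cnj (of_real (shell_weight y) * (u y * cnj (v y))) \<partial>lborel)"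
    unfolding shell_prod_def by (rule Bochner_Integration.integral_cnj[symmetric])
  then show ?thesis
    unfolding shell_prod_def by (simp add: mult.commute)
qed

lemma shell_prod_cong:
  assumes "\<And>y. y \<noteq> 0 \<Longrightarrow> u y = u' y" "\<And>y. y \<noteq> 0 \<Longrightarrow> v y = v' y"
  shows "shell_prod u v = shell_prod u' v'"
proof -
  have "of_real (shell_weight y) * (u y * cnj (v y))
      = of_real (shell_weight y) * (u' y * cnj (v' y))" for y
    using assms by (cases "y = 0") simp_all
  then show ?thesis
    unfolding shell_prod_def by (intro Bochner_Integration.integral_cong refl)
qed

lemma cmod_shell_prod_le:
  fixes u v :: "'a::euclidean_space \<Rightarrow> complex"
  assumes "continuous_on (- {0}) u" "continuous_on (- {0}) v"
    and u: "\<And>y. y \<noteq> 0 \<Longrightarrow> cmod (u y) \<le> M" and v: "\<And>y. y \<noteq> 0 \<Longrightarrow> cmod (v y) \<le> N"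
  shows "cmod (shell_prod u v) \<le> (\<integral>y. shell_weight (y :: 'a) \<partial>lborel) * (M * N)"
proof -
  have int: "integrable lborel (shell_weight :: 'a \<Rightarrow> real)"
    by (rule integrable_if_vanishes_off_shell[OF continuous_shell_weight(1) shell_weight_vanishes])
  have pointwise: "cmod (of_real (shell_weight y) * (u y * cnj (v y))) \<le> shell_weight y * (M * N)" for y
  proof (cases "y = 0")
    case False
    have "cmod (u y) * cmod (v y) \<le> M * N"
      using u[OF False] v[OF False] by (intro mult_mono) (auto intro: order_trans[OF norm_ge_zero])
    then show ?thesis
      by (simp add: norm_mult shell_weight_nonneg mult_left_mono)
  qed simp
  have "cmod (shell_prod u v) \<le> (\<integral>y. cmod (of_real (shell_weight y) * (u y * cnj (v y))) \<partial>lborel)"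
    unfolding shell_prod_def by (rule integral_norm_bound)
  also have "\<dots> \<le> (\<integral>y. shell_weight (y :: 'a) * (M * N) \<partial>lborel)"
    using pointwise int integrable_shell_prod[OF assms(1,2)]
    by (intro Bochner_Integration.integral_mono integrable_norm) auto
  finally show ?thesis by simp
qed

lemma shell_prod_self_eq_0:
  fixes u :: "'a::euclidean_space \<Rightarrow> complex"
  assumes cont: "continuous_on (- {0}) u" and "shell_prod u u = 0" and y: "1 < norm y" "norm y < 2"
  shows "u y = 0"
proof (rule ccontr)
  assume "u y \<noteq> 0"
  let ?g = "\<lambda>y. shell_weight y * (cmod (u y))\<^sup>2"
  have g: "of_real (shell_weight y) * (u y * cnj (u y)) = complex_of_real (?g y)" for y
    by (simp only: complex_norm_square[symmetric] of_real_power[symmetric] of_real_mult[symmetric])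
  have int: "integrable lborel ?g"
    using integrable_Re[OF integrable_shell_prod[OF cont cont]] unfolding g Re_complex_of_real .
  have "complex_of_real (\<integral>y. ?g y \<partial>lborel) = 0"
    using assms(2) unfolding shell_prod_def g integral_complex_of_real .
  then have zero: "AE y in lborel. ?g y = 0"
    by (subst (asm) of_real_eq_0_iff, subst (asm) integral_nonneg_eq_0_iff_AE[OF int])
      (simp_all add: shell_weight_nonneg)
  define U where "U = (- {0} \<inter> u -` (- {0})) \<inter> {y. 1 < norm y \<and> norm y < 2}"
  have "open (- {0} \<inter> u -` (- {0}))"
    by (intro continuous_open_preimage cont open_Compl closed_singleton)
  moreover have "open {y :: 'a. 1 < norm y \<and> norm y < 2}"
    by (intro open_Collect_conj open_Collect_less continuous_intros)
  ultimately have "open U"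
    unfolding U_def by (rule open_Int)
  have "?g y \<noteq> 0" if "y \<in> U" for y
    using that shell_weight_pos[of y] by (auto simp: U_def)
  with zero have "AE y in lborel. y \<notin> U"
    by (auto elim: eventually_mono)
  then have "U \<in> null_sets lborel"
    using \<open>open U\<close> by (subst AE_iff_null_sets) auto
  moreover have "y \<in> U"
    using y \<open>u y \<noteq> 0\<close> by (auto simp: U_def)
  ultimately show False
    using open_not_negligible[OF \<open>open U\<close>] null_sets_completionI unfolding negligible_iff_null_sets
    by blast
qed

lemma shell_prod_orthogonal_residual:
  assumes "finite A" "\<And>i. i \<in> A \<Longrightarrow> continuous_on (- {0}) (\<phi> i)" "continuous_on (- {0}) u"
    and orth: "\<And>i l. i \<in> A \<Longrightarrow> l \<in> A \<Longrightarrow> i \<noteq> l \<Longrightarrow> shell_prod (\<phi> i) (\<phi> l) = 0"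
    and "l \<in> A" "shell_prod (\<phi> l) (\<phi> l) \<noteq> 0"
  shows "shell_prod (\<lambda>y. u y - (\<Sum>i\<in>A. shell_prod u (\<phi> i) / shell_prod (\<phi> i) (\<phi> i) * \<phi> i y)) (\<phi> l) = 0"
proof -
  let ?c = "\<lambda>i. shell_prod u (\<phi> i) / shell_prod (\<phi> i) (\<phi> i)"
  have "shell_prod (\<lambda>y. u y - (\<Sum>i\<in>A. ?c i * \<phi> i y)) (\<phi> l)
      = shell_prod u (\<phi> l) - shell_prod (\<lambda>y. \<Sum>i\<in>A. ?c i * \<phi> i y) (\<phi> l)"
    using assms(2,3,5) by (intro shell_prod_diff_left continuous_on_sum continuous_on_mult_left)
  also have "shell_prod (\<lambda>y. \<Sum>i\<in>A. ?c i * \<phi> i y) (\<phi> l) = (\<Sum>i\<in>A. ?c i * shell_prod (\<phi> i) (\<phi> l))"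
    using assms(2,5) by (intro shell_prod_sum_left)
  also have "\<dots> = (\<Sum>i\<in>A. if i = l then shell_prod u (\<phi> l) else 0)"
    using orth assms(5,6) by (intro sum.cong) auto
  finally show ?thesis
    using assms(1,5) by simp
qed

lemma shell_prod_orthogonal_independent:
  assumes "finite A" "\<And>i. i \<in> A \<Longrightarrow> continuous_on (- {0}) (\<phi> i)"
    and orth: "\<And>i l. i \<in> A \<Longrightarrow> l \<in> A \<Longrightarrow> i \<noteq> l \<Longrightarrow> shell_prod (\<phi> i) (\<phi> l) = 0"
    and zero: "\<And>y. y \<noteq> 0 \<Longrightarrow> (\<Sum>i\<in>A. c i * \<phi> i y) = 0"
    and "l \<in> A" "shell_prod (\<phi> l) (\<phi> l) \<noteq> 0"
  shows "c l = 0"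
proof -
  have "0 = shell_prod (\<lambda>y. \<Sum>i\<in>A. c i * \<phi> i y) (\<phi> l)"
    using shell_prod_cong[of "\<lambda>y. \<Sum>i\<in>A. c i * \<phi> i y" "\<lambda>_. 0" "\<phi> l" "\<phi> l"] zero by simp
  also have "\<dots> = (\<Sum>i\<in>A. c i * shell_prod (\<phi> i) (\<phi> l))"
    using assms(2,5) by (intro shell_prod_sum_left)
  also have "\<dots> = (\<Sum>i\<in>A. if i = l then c l * shell_prod (\<phi> l) (\<phi> l) else 0)"
    using orth assms(5) by (intro sum.cong) auto
  finally show ?thesis
    using assms(1,5,6) by simp
qed

definition green_weight :: "'a::real_inner \<Rightarrow> real" where
  "green_weight y = (y \<bullet> y) * shell_weight y"

definition green_weight_slope :: "'a::real_inner \<Rightarrow> real" where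
  "green_weight_slope y = 2 * shell_weight y + (y \<bullet> y) * shell_weight_slope y"

lemma has_derivative_green_weight:
  "(green_weight has_derivative (\<lambda>h. green_weight_slope y * (y \<bullet> h))) (at y)"
  unfolding green_weight_def[abs_def] green_weight_slope_def
  by (auto intro!: derivative_eq_intros has_derivative_shell_weight
      simp: fun_eq_iff inner_commute algebra_simps)

lemma
  shows green_weight_vanishes: "vanishes_off_shell (green_weight :: 'a::real_inner \<Rightarrow> real)"
    and green_weight_slope_vanishes: "vanishes_off_shell (green_weight_slope :: 'a \<Rightarrow> real)"
  using shell_weight_vanishes[where 'a = 'a] shell_weight_slope_vanishes[where 'a = 'a]
  by (simp_all add: vanishes_off_shell_def green_weight_def green_weight_slope_def)

lemma continuous_green_weight: "continuous_on S green_weight" "continuous_on S green_weight_slope"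
  unfolding green_weight_def[abs_def] green_weight_slope_def[abs_def]
  by (intro continuous_intros continuous_shell_weight)+

lemma integral_green_identity:
  fixes u v :: "'a::euclidean_space \<Rightarrow> complex"
  assumes u: "has_jet u u1 u2 (- {0})" "\<And>y. y \<noteq> 0 \<Longrightarrow> u1 y y = 0"
    and v: "has_jet v v1 v2 (- {0})" "\<And>y. y \<noteq> 0 \<Longrightarrow> v1 y y = 0"
  shows "(\<integral>y. of_real (green_weight y) *
    (u y * basis_trace (v2 y) - v y * basis_trace (u2 y)) \<partial>lborel) = 0"
proof -
  define w where "w b y = of_real (green_weight y) * (u y * v1 y b - v y * u1 y b)" for b y
  define D where "D b y h = of_real (green_weight y) *
      ((u y * v2 y b h + u1 y h * v1 y b) - (v y * u2 y b h + v1 y h * u1 y b))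
     + of_real (green_weight_slope y * (y \<bullet> h)) * (u y * v1 y b - v y * u1 y b)" for b y h
  have "(\<integral>y. (\<Sum>b\<in>Basis. D b y b) \<partial>lborel) = 0"
  proof (rule integral_shell_divergence[where w = w and D = D])
    show "(w b has_derivative D b y) (at y)" if "y \<noteq> 0" for b y
      unfolding w_def D_def using that
      by (intro has_derivative_mult has_derivative_diff has_derivative_of_real
        has_derivative_green_weight
          has_jet_derivative[OF u(1)] has_jet_second_derivative[OF u(1)]
          has_jet_derivative[OF v(1)] has_jet_second_derivative[OF v(1)]) auto
    show "continuous_on (- {0}) (\<lambda>y. D b y b)" for b
      unfolding D_def
      by (intro continuous_intros continuous_green_weight
          has_jet_continuous_intros[OF u(1)] has_jet_continuous_intros[OF v(1)])
    show "vanishes_off_shell (w b)" "vanishes_off_shell (\<lambda>y. D b y b)" for b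
      using green_weight_vanishes[where 'a = 'a] green_weight_slope_vanishes[where 'a = 'a]
      by (simp_all add: vanishes_off_shell_def w_def D_def)
  qed
  moreover have "(\<Sum>b\<in>Basis. D b y b)
      = of_real (green_weight y) * (u y * basis_trace (v2 y) - v y * basis_trace (u2 y))" for y
  proof (cases "y = 0")
    case False
    have "(\<Sum>b\<in>Basis. D b y b)
      = of_real (green_weight y) * (u y * basis_trace (v2 y) - v y * basis_trace (u2 y))
       + of_real (green_weight_slope y) *
         (u y * (\<Sum>b\<in>Basis. (y \<bullet> b) *\<^sub>R v1 y b) - v y * (\<Sum>b\<in>Basis. (y \<bullet> b) *\<^sub>R u1 y b))"
      unfolding D_def basis_trace_def scaleR_conv_of_real
      by (simp add: sum.distrib sum_subtractf sum_distrib_left algebra_simps)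
    then show ?thesis
      using False linear_sum_Basis[OF has_derivative_linear[OF has_jet_derivative[OF u(1)]]]
        linear_sum_Basis[OF has_derivative_linear[OF has_jet_derivative[OF v(1)]]]
        by (simp add: u(2) v(2))
  qed (simp add: D_def green_weight_def green_weight_slope_def)
  ultimately show ?thesis
    by simp
qed

lemma angular_eigenfunction_orthogonal:
  fixes u v :: "'a::euclidean_space \<Rightarrow> complex"
  assumes "angular_eigenfunction \<mu> u" "angular_eigenfunction \<nu> v" "\<mu> \<noteq> \<nu>"
  shows "shell_prod u v = 0"
proof -
  obtain u1 u2 where u: "has_jet u u1 u2 (- {0})" "\<And>y. y \<noteq> 0 \<Longrightarrow> u1 y y = 0"
    "\<And>y. y \<noteq> 0 \<Longrightarrow> basis_trace (u2 y) = of_real (\<mu> / (norm y)\<^sup>2) * u y"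
    using angular_eigenfunctionE[OF assms(1)] by blast
  obtain v1 v2 where v: "has_jet (\<lambda>y. cnj (v y)) v1 v2 (- {0})" "\<And>y. y \<noteq> 0 \<Longrightarrow> v1 y y = 0"
    "\<And>y. y \<noteq> 0 \<Longrightarrow> basis_trace (v2 y) = of_real (\<nu> / (norm y)\<^sup>2) * cnj (v y)"
    using angular_eigenfunctionE[OF angular_eigenfunction_cnj[OF assms(2)]] by blast
  have "of_real (green_weight y) * (u y * basis_trace (v2 y) - cnj (v y) * basis_trace (u2 y))
      = of_real (\<nu> - \<mu>) * (of_real (shell_weight y) * (u y * cnj (v y)))" for y
  proof (cases "y = 0")
    case False
    have "green_weight y * (\<nu> / (norm y)\<^sup>2 - \<mu> / (norm y)\<^sup>2) = (\<nu> - \<mu>) * shell_weight y"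
      using False by (simp add: green_weight_def dot_square_norm flip: diff_divide_distrib)
    from arg_cong[OF this, of "\<lambda>r. of_real r * (u y * cnj (v y))"] show ?thesis
      unfolding u(3)[OF False] v(3)[OF False] by (simp add: algebra_simps)
  qed (simp add: green_weight_def)
  moreover have "(\<integral>y. of_real (green_weight y) *
      (u y * basis_trace (v2 y) - cnj (v y) * basis_trace (u2 y)) \<partial>lborel) = 0"
    by (rule integral_green_identity[OF u(1,2) v(1,2)])
  ultimately have "of_real (\<nu> - \<mu>) * shell_prod u v = 0"
    unfolding shell_prod_def by (simp only: integral_mult_right_zero)
  then show ?thesis
    using assms(3) by simp
qed

lemma integral_rotation_derivative:
  fixes p :: "'a::euclidean_space \<Rightarrow> complex"
  assumes "linear J" and skew: "\<And>y. y \<bullet> J y = 0"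
    and p: "\<And>y. y \<noteq> 0 \<Longrightarrow> (p has_derivative p1 y) (at y)"
    and cont: "continuous_on (- {0}) p" "\<And>h. continuous_on (- {0}) (\<lambda>y. p1 y h)"
  shows "(\<integral>y. of_real (shell_weight y) * p1 y (J y) \<partial>lborel) = 0"
proof -
  define w where "w b y = of_real ((J y \<bullet> b) * shell_weight y) * p y" for b y
  define D where "D b y h = of_real ((J y \<bullet> b) * shell_weight y) * p1 y h
      + of_real ((J y \<bullet> b) * (shell_weight_slope y * (y \<bullet> h)) + (J h \<bullet> b) * shell_weight y) * p y"
          for b y h
  have "(\<integral>y. (\<Sum>b\<in>Basis. D b y b) \<partial>lborel) = 0"
  proof (rule integral_shell_divergence[where w = w and D = D])
    have "((\<lambda>y. J y \<bullet> b) has_derivative (\<lambda>h. J h \<bullet> b)) (at y)" for b y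
      using assms(1) by (intro has_derivative_inner_left linear_imp_has_derivative)
    then show "(w b has_derivative D b y) (at y)" if "y \<noteq> 0" for b y
      unfolding w_def D_def using that
      by (intro has_derivative_mult has_derivative_of_real has_derivative_shell_weight p)
    show "continuous_on (- {0}) (\<lambda>y. D b y b)" for b
      unfolding D_def
      by (intro continuous_intros continuous_shell_weight cont linear_continuous_on)
        (simp_all add: assms(1) flip: linear_conv_bounded_linear)
    show "vanishes_off_shell (w b)" "vanishes_off_shell (\<lambda>y. D b y b)" for b
      using shell_weight_vanishes[where 'a = 'a] shell_weight_slope_vanishes[where 'a = 'a]
      by (simp_all add: vanishes_off_shell_def w_def D_def)
  qed
  moreover have "(\<Sum>b\<in>Basis. D b y b) = of_real (shell_weight y) * p1 y (J y)" for y
  proof (cases "y = 0")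
    case False
    have "(\<Sum>b\<in>Basis. (J y \<bullet> b) * (y \<bullet> b)) = 0"
      using skew[of y] euclidean_inner[of "J y" y] by (simp add: inner_commute)
    then have tangent: "(\<Sum>b\<in>Basis. complex_of_real ((J y \<bullet> b) * (y \<bullet> b))) = 0"
      by (simp only: of_real_sum[symmetric] of_real_0)
    have "J b \<bullet> b = 0" for b
      using skew[of b] by (simp add: inner_commute)
    then have "(\<Sum>b\<in>Basis. D b y b) = of_real (shell_weight y) * (\<Sum>b\<in>Basis. (J y \<bullet> b) *\<^sub>R p1 y b)
        + of_real (shell_weight_slope y) * p y * (\<Sum>b\<in>Basis. complex_of_real ((J y \<bullet> b) * (y \<bullet> b)))"
      by (simp add: D_def sum.distrib sum_distrib_left scaleR_conv_of_real mult_ac)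
    also have "\<dots> = of_real (shell_weight y) * p1 y (J y)"
      unfolding tangent linear_sum_Basis[OF has_derivative_linear[OF p[OF False]]] by simp
    finally show ?thesis .
  qed (use assms(1) in \<open>simp add: D_def linear_0\<close>)
  ultimately show ?thesis
    by simp
qed

lemma rotation_weights_orthogonal:
  fixes u v :: "'a::euclidean_space \<Rightarrow> complex"
  assumes "linear J" "\<And>y. y \<bullet> J y = 0"
    and u: "has_jet u u1 u2 (- {0})" "\<And>y. y \<noteq> 0 \<Longrightarrow> u1 y (J y) = \<i> * of_real s * u y"
    and v: "has_jet v v1 v2 (- {0})" "\<And>y. y \<noteq> 0 \<Longrightarrow> v1 y (J y) = \<i> * of_real t * v y"
    and "s \<noteq> t"
  shows "shell_prod u v = 0"
proof -
  define p where "p y = u y * cnj (v y)" for y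
  define p1 where "p1 y h = u y * cnj (v1 y h) + u1 y h * cnj (v y)" for y h
  have "(p has_derivative p1 y) (at y)" if "y \<noteq> 0" for y
    unfolding p_def[abs_def] p1_def[abs_def] using that
    by (intro has_derivative_mult bounded_linear.has_derivative[OF bounded_linear_cnj]
        has_jet_derivative[OF u(1)] has_jet_derivative[OF v(1)]) auto
  moreover have "continuous_on (- {0}) p" "continuous_on (- {0}) (\<lambda>y. p1 y h)" for h
    unfolding p_def p1_def
    by (intro continuous_intros has_jet_continuous_intros[OF u(1)] has_jet_continuous_intros[OF v(1)])+
  ultimately have "(\<integral>y. of_real (shell_weight y) * p1 y (J y) \<partial>lborel) = 0"
    by (rule integral_rotation_derivative[OF assms(1,2)])
  moreover have "of_real (shell_weight y) * p1 y (J y)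
      = \<i> * of_real (s - t) * (of_real (shell_weight y) * (u y * cnj (v y)))" for y
    by (cases "y = 0") (simp_all add: p1_def u(2) v(2) algebra_simps)
  ultimately have "\<i> * of_real (s - t) * shell_prod u v = 0"
    unfolding shell_prod_def by (simp only: integral_mult_right_zero)
  then show ?thesis
    using \<open>s \<noteq> t\<close> by simp
qed

subsection \<open>Eigenfunctions on the three-sphere\<close>

lemma S3_iff_norm: "p \<in> S3 \<longleftrightarrow> norm p = 1"
  by (cases p) (simp add: S3_def norm_Pair real_sqrt_eq_1_iff)

lemma normalize_in_S3: "y \<noteq> 0 \<Longrightarrow> inverse (norm y) *\<^sub>R y \<in> S3"
  by (simp add: S3_iff_norm)

lemma sum_Basis_C2:
  fixes f :: "C2pt \<Rightarrow> 'a::comm_monoid_add"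
  shows "(\<Sum>b\<in>Basis. f b) = f (1, 0) + f (\<i>, 0) + f (0, 1) + f (0, \<i>)"
proof -
  have "(Basis :: C2pt set) = (\<lambda>u. (u, 0)) ` {1, \<i>} \<union> (\<lambda>u. (0, u)) ` {1, \<i>}"
    by (simp only: Basis_prod_def Basis_complex_def)
  also have "\<dots> = {(1, 0), (\<i>, 0), (0, 1), (0, \<i>)}"
    by auto
  finally have Basis: "(Basis :: C2pt set) = {(1, 0), (\<i>, 0), (0, 1), (0, \<i>)}" .
  show ?thesis
    unfolding Basis by (simp add: add.assoc complex_eq_iff)
qed

lemma ext0_scaleR: "r > 0 \<Longrightarrow> ext0 F (r *\<^sub>R y) = ext0 F y"
  by (simp add: ext0_def field_simps)

lemma ext0_S3: "x \<in> S3 \<Longrightarrow> ext0 F x = F x"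
  by (simp add: ext0_def S3_iff_norm)

lemma ext0_eq_0_imp:
  assumes "\<And>y. 1 < norm y \<Longrightarrow> norm y < 2 \<Longrightarrow> ext0 F y = 0" "x \<in> S3"
  shows "F x = 0"
  using assms(1)[of "(3 / 2) *\<^sub>R x"] assms(2) by (simp add: ext0_scaleR ext0_S3 S3_iff_norm)

lemma continuous_on_ext0:
  assumes "continuous_on S3 F"
  shows "continuous_on (- {0}) (ext0 F)"
  unfolding ext0_def[abs_def]
proof (rule continuous_on_compose2[OF assms])
  show "continuous_on (- {0}) (\<lambda>y::C2pt. inverse (norm y) *\<^sub>R y)"
    by (intro continuous_intros) simp
qed (use normalize_in_S3 in blast)

lemma angular_eigenfunction_ext0_iff:
  "angular_eigenfunction \<mu> (ext0 F) \<longleftrightarrow>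
     C2_on (- {0}) (ext0 F) \<and> (\<forall>x\<in>S3. lapS3 F x = of_real \<mu> * F x)"
proof
  assume "angular_eigenfunction \<mu> (ext0 F)"
  then obtain u1 u2 where u: "has_jet (ext0 F) u1 u2 (- {0})" "\<And>y. y \<noteq> 0 \<Longrightarrow> u1 y y = 0"
    "\<And>y. y \<noteq> 0 \<Longrightarrow> basis_trace (u2 y) = of_real (\<mu> / (norm y)\<^sup>2) * ext0 F y"
    using angular_eigenfunctionE by blast
  have "lapS3 F x = of_real \<mu> * F x" if "x \<in> S3" for x
  proof -
    have "norm x = 1" "x \<noteq> 0"
      using that by (auto simp: S3_iff_norm)
    then show ?thesis
      unfolding lapS3_def using lapR4_eq_basis_trace[OF u(1)] u(3)[of x] ext0_S3[OF that, of F]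
      by (simp add: open_Compl)
  qed
  then show "C2_on (- {0}) (ext0 F) \<and> (\<forall>x\<in>S3. lapS3 F x = of_real \<mu> * F x)"
    using u(1) C2_on_iff_has_jet by blast
next
  assume F: "C2_on (- {0}) (ext0 F) \<and> (\<forall>x\<in>S3. lapS3 F x = of_real \<mu> * F x)"
  then obtain u1 u2 where u: "has_jet (ext0 F) u1 u2 (- {0})"
    using C2_on_iff_has_jet by blast
  show "angular_eigenfunction \<mu> (ext0 F)"
  proof (rule angular_eigenfunctionI[OF u])
    fix y :: C2pt assume y: "y \<noteq> 0"
    then show "u1 y y = 0"
      using homogeneous_0_radial_derivative[OF has_jet_derivative[OF u] ext0_scaleR] by simp
    define x where "x = inverse (norm y) *\<^sub>R y"
    have x: "x \<in> S3" "x \<noteq> 0" and y_eq: "y = norm y *\<^sub>R x"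
      using y normalize_in_S3[OF y] by (auto simp: x_def)
    have "basis_trace (u2 y) = basis_trace (u2 x) /\<^sub>R (norm y)\<^sup>2"
      using homogeneous_0_second_derivative[OF u ext0_scaleR, of "norm y" x] x(2) y
      by (subst y_eq) (simp add: basis_trace_def flip: scaleR_sum_right)
    also have "basis_trace (u2 x) = of_real \<mu> * F x"
      using lapR4_eq_basis_trace[OF u, of x] x F by (simp add: lapS3_def open_Compl)
    also have "F x = ext0 F y"
      by (simp add: ext0_def x_def)
    finally show "basis_trace (u2 y) = of_real (\<mu> / (norm y)\<^sup>2) * ext0 F y"
      by (simp add: scaleR_conv_of_real divide_inverse mult_ac)
  qed
qed

definition sphere_eigenfunction :: "nat \<Rightarrow> (C2pt \<Rightarrow> complex) \<Rightarrow> bool" where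
  "sphere_eigenfunction k F \<longleftrightarrow> angular_eigenfunction (- real (k * (k + 2))) (ext0 F)"

lemma modes_iff:
  "F \<in> modes \<Gamma> k \<longleftrightarrow> (\<forall>x. x \<notin> S3 \<longrightarrow> F x = 0) \<and> sphere_eigenfunction k F
     \<and> (\<forall>g\<in>\<Gamma>. \<forall>x\<in>S3. F (mat_act (mat_inv2 g) x) = F x)"
  unfolding modes_def sphere_eigenfunction_def angular_eigenfunction_ext0_iff by simp

lemma sphere_eigenfunction_continuous_ext0: "sphere_eigenfunction k F \<Longrightarrow> continuous_on (- {0}) (ext0 F)"
  unfolding sphere_eigenfunction_def by (rule angular_eigenfunction_continuous)

lemma sphere_eigenfunction_continuous:
  assumes "sphere_eigenfunction k F"
  shows "continuous_on S3 F"
proof (rule continuous_on_eq)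
  show "continuous_on S3 (ext0 F)"
    by (rule continuous_on_subset[OF sphere_eigenfunction_continuous_ext0[OF assms]])
      (auto simp: S3_iff_norm)
qed (simp add: ext0_S3)

lemma sphere_eigenfunction_sum:
  assumes "\<And>i. i \<in> A \<Longrightarrow> sphere_eigenfunction k (F i)"
  shows "sphere_eigenfunction k (\<lambda>x. \<Sum>i\<in>A. c i * F i x)"
  using angular_eigenfunction_sum[of A _ "\<lambda>i. ext0 (F i)" c] assms
  unfolding sphere_eigenfunction_def by (simp add: ext0_def[abs_def])

lemma sphere_eigenfunction_diff:
  assumes "sphere_eigenfunction k F" "sphere_eigenfunction k G"
  shows "sphere_eigenfunction k (\<lambda>x. F x - G x)"
  using angular_eigenfunction_add[OF _ angular_eigenfunction_scale[of _ _ "- 1"]] assms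
  unfolding sphere_eigenfunction_def by (simp add: ext0_def[abs_def])

lemma sphere_eigenfunction_orthogonal:
  assumes "sphere_eigenfunction k F" "sphere_eigenfunction l G" "k \<noteq> l"
  shows "shell_prod (ext0 F) (ext0 G) = 0"
proof -
  have "m * (m + 2) < n * (n + 2)" if "m < n" for m n :: nat
    using that by (intro mult_strict_mono) auto
  then have "k * (k + 2) \<noteq> l * (l + 2)"
    using assms(3) by (metis less_irrefl nat_neq_iff)
  then have "- real (k * (k + 2)) \<noteq> - real (l * (l + 2))"
    by (simp only: neg_equal_iff_equal of_nat_eq_iff not_False_eq_True)
  then show ?thesis
    using assms(1,2) unfolding sphere_eigenfunction_def
    by (rule angular_eigenfunction_orthogonal[rotated 2])
qed

subsection \<open>Siblings of monomials\<close>

definition cscale :: "'a::times \<Rightarrow> 'a \<times> 'a \<Rightarrow> 'a \<times> 'a" where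
  "cscale c p = (c * fst p, c * snd p)"

definition quat_j :: "C2pt \<Rightarrow> C2pt" where
  "quat_j p = (- cnj (snd p), cnj (fst p))"

definition line_fst :: "C2pt \<Rightarrow> complex poly" where
  "line_fst p = [:fst p, fst (quat_j p):]"

definition line_snd :: "C2pt \<Rightarrow> complex poly" where
  "line_snd p = [:snd p, snd (quat_j p):]"

definition line_monom :: "nat \<Rightarrow> nat \<Rightarrow> C2pt \<Rightarrow> complex poly" where
  "line_monom a b p = line_fst p ^ a * line_snd p ^ b"

definition monom_sibling :: "nat \<Rightarrow> nat \<Rightarrow> nat \<Rightarrow> C2pt \<Rightarrow> complex" where
  "monom_sibling a b j p = coeff (line_monom a b p) j"

definition line_monom_D1 :: "nat \<Rightarrow> nat \<Rightarrow> C2pt \<Rightarrow> C2pt \<Rightarrow> complex poly" where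
  "line_monom_D1 a b p v =
     of_nat a * line_fst v * line_monom (a - 1) b p + of_nat b * line_snd v * line_monom a (b - 1) p"

definition line_monom_D2 :: "nat \<Rightarrow> nat \<Rightarrow> C2pt \<Rightarrow> C2pt \<Rightarrow> C2pt \<Rightarrow> complex poly" where
  "line_monom_D2 a b p v w =
     of_nat a * line_fst v * line_monom_D1 (a - 1) b p w
       + of_nat b * line_snd v * line_monom_D1 a (b - 1) p w"

lemma line_monom_Suc:
  "line_monom (Suc a) b p = line_fst p * line_monom a b p"
  "line_monom a (Suc b) p = line_snd p * line_monom a b p"
  by (simp_all add: line_monom_def mult_ac)

lemma of_nat_line_monom:
  "of_nat a * line_fst p * line_monom (a - 1) b p = of_nat a * line_monom a b p"
  "of_nat b * line_snd p * line_monom a (b - 1) p = of_nat b * line_monom a b p"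
  by (cases a; simp add: line_monom_Suc mult_ac) (cases b; simp add: line_monom_Suc mult_ac)

text \<open>Polynomials carry no topology in the library, hence derivatives are taken coefficientwise.\<close>

definition has_coeff_derivative ::
  "('a::real_normed_vector \<Rightarrow> complex poly) \<Rightarrow> ('a \<Rightarrow> complex poly) \<Rightarrow> 'a \<Rightarrow> bool" where
  "has_coeff_derivative P P' x \<longleftrightarrow> (\<forall>j. ((\<lambda>y. coeff (P y) j) has_derivative (\<lambda>v. coeff (P' v) j)) (at x))"

lemma has_coeff_derivative_const: "has_coeff_derivative (\<lambda>y. c) (\<lambda>v. 0) x"
  by (simp add: has_coeff_derivative_def)

lemma has_coeff_derivative_add:
  "has_coeff_derivative P P' x \<Longrightarrow> has_coeff_derivative Q Q' x \<Longrightarrow>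
   has_coeff_derivative (\<lambda>y. P y + Q y) (\<lambda>v. P' v + Q' v) x"
  by (auto simp: has_coeff_derivative_def intro!: has_derivative_add)

lemma has_coeff_derivative_mult:
  assumes "has_coeff_derivative P P' x" "has_coeff_derivative Q Q' x"
  shows "has_coeff_derivative (\<lambda>y. P y * Q y) (\<lambda>v. P x * Q' v + P' v * Q x) x"
  unfolding has_coeff_derivative_def
proof
  fix j
  have "((\<lambda>y. \<Sum>i\<le>j. coeff (P y) i * coeff (Q y) (j - i)) has_derivative
     (\<lambda>v. \<Sum>i\<le>j. coeff (P x) i * coeff (Q' v) (j - i) + coeff (P' v) i * coeff (Q x) (j - i))) (at x)"
    using assms by (intro has_derivative_sum has_derivative_mult) (auto simp: has_coeff_derivative_def)
  then show "((\<lambda>y. coeff (P y * Q y) j) has_derivative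
     (\<lambda>v. coeff (P x * Q' v + P' v * Q x) j)) (at x)"
    by (simp add: coeff_mult sum.distrib)
qed

lemma has_coeff_derivative_power:
  assumes "has_coeff_derivative P P' x"
  shows "has_coeff_derivative (\<lambda>y. P y ^ n) (\<lambda>v. of_nat n * P' v * P x ^ (n - 1)) x"
proof (induction n)
  case (Suc n)
  have "(\<lambda>v. P x * (of_nat n * P' v * P x ^ (n - 1)) + P' v * P x ^ n)
      = (\<lambda>v. of_nat (Suc n) * P' v * P x ^ (Suc n - 1))"
    by (cases n) (auto simp: algebra_simps)
  then show ?case
    using has_coeff_derivative_mult[OF assms Suc.IH] by simp
qed (simp add: has_coeff_derivative_const)

lemma has_coeff_derivative_line:
  shows "has_coeff_derivative line_fst line_fst x" and "has_coeff_derivative line_snd line_snd x"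
proof -
  have "linear (\<lambda>p. coeff (line_fst p) j)" "linear (\<lambda>p. coeff (line_snd p) j)" for j
    by (rule linearI; auto simp: line_fst_def line_snd_def quat_j_def coeff_pCons
      scaleR_conv_of_real algebra_simps
        split: nat.split)+
  then show "has_coeff_derivative line_fst line_fst x" "has_coeff_derivative line_snd line_snd x"
    by (simp_all add: has_coeff_derivative_def linear_imp_has_derivative)
qed

lemma has_coeff_derivative_line_monom: "has_coeff_derivative (line_monom a b) (line_monom_D1 a b x) x"
  using has_coeff_derivative_mult[OF has_coeff_derivative_power[OF has_coeff_derivative_line(1), of a]
      has_coeff_derivative_power[OF has_coeff_derivative_line(2), of b], of x]
  by (simp add: line_monom_def[abs_def] line_monom_D1_def[abs_def] algebra_simps)

lemma has_coeff_derivative_line_monom_D1: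
  "has_coeff_derivative (\<lambda>y. line_monom_D1 a b y v) (line_monom_D2 a b x v) x"
proof -
  have "has_coeff_derivative (\<lambda>y. c * line_monom a b y) (\<lambda>v. c * line_monom_D1 a b x v) x" for c a b
    using has_coeff_derivative_mult[OF has_coeff_derivative_const has_coeff_derivative_line_monom]
    by simp
  from has_coeff_derivative_add[OF this this] show ?thesis
    unfolding line_monom_D1_def[of a b _ v] line_monom_D2_def[abs_def] .
qed

lemma has_jet_monom_sibling:
  "has_jet (monom_sibling a b j) (\<lambda>x v. coeff (line_monom_D1 a b x v) j)
     (\<lambda>x v w. coeff (line_monom_D2 a b x v w) j) U"
proof -
  have first: "(monom_sibling a b j has_derivative (\<lambda>v. coeff (line_monom_D1 a b x v) j)) (at x)" for x
    using has_coeff_derivative_line_monom[of a b x]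
    by (simp add: has_coeff_derivative_def monom_sibling_def[abs_def])
  have "continuous_on U (\<lambda>x. coeff (line_monom_D1 a b x v) j)" for a b j v
    using has_coeff_derivative_line_monom_D1[of a b v]
    by (metis has_coeff_derivative_def continuous_at_imp_continuous_on has_derivative_continuous)
  then have "continuous_on U (\<lambda>x. coeff (c * line_monom_D1 a b x v) j)" for a b j v c
    unfolding coeff_mult by (intro continuous_intros)
  then have "continuous_on U (\<lambda>x. coeff (line_monom_D2 a b x v w) j)" for v w
    unfolding line_monom_D2_def coeff_add by (intro continuous_on_add)
  then show ?thesis
    unfolding has_jet_def using first has_coeff_derivative_line_monom_D1
    by (auto simp: has_coeff_derivative_def)
qed

lemma pderiv_line_monom:
  "pderiv (line_monom a b p) = of_nat a * pderiv (line_fst p) * line_monom (a - 1) b p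
     + of_nat b * pderiv (line_snd p) * line_monom a (b - 1) p"
  unfolding line_monom_def
  by (cases a; cases b)
    (simp_all add: pderiv_mult pderiv_power_Suc of_nat_poly algebra_simps del: power_Suc)

text \<open>The radial field, the torus fields and the fields \<open>p \<mapsto> J p\<close> and \<open>p \<mapsto> \<i> J p\<close> all have this form.\<close>

lemma line_monom_D1_eq:
  assumes "line_fst v = A * line_fst p + Q * pderiv (line_fst p)"
    and "line_snd v = B * line_snd p + Q * pderiv (line_snd p)"
  shows "line_monom_D1 a b p v
    = (of_nat a * A + of_nat b * B) * line_monom a b p + Q * pderiv (line_monom a b p)"
proof -
  have "line_monom_D1 a b p v = A * (of_nat a * line_fst p * line_monom (a - 1) b p)
     + B * (of_nat b * line_snd p * line_monom a (b - 1) p) + Q * pderiv (line_monom a b p)"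
    unfolding line_monom_D1_def assms pderiv_line_monom by (simp add: algebra_simps)
  then show ?thesis
    unfolding of_nat_line_monom by (simp add: algebra_simps)
qed

lemma line_monom_D1_radial: "line_monom_D1 a b p p = of_nat (a + b) * line_monom a b p"
  using line_monom_D1_eq[of p 1 p 0 1 a b] by simp

definition torus_field :: "real \<Rightarrow> real \<Rightarrow> C2pt \<Rightarrow> C2pt" where
  "torus_field s t p = (\<i> * of_real s * fst p, \<i> * of_real t * snd p)"

lemma line_monom_D1_torus_field:
  "coeff (line_monom_D1 a b p (torus_field s t p)) j
    = \<i> * of_real (s * a + t * b - (s + t) * j) * monom_sibling a b j p"
proof -
  have "line_monom_D1 a b p (torus_field s t p)
      = (of_nat a * [:\<i> * of_real s:] + of_nat b * [:\<i> * of_real t:]) * line_monom a b p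
        + [:0, - \<i> * of_real (s + t):] * pderiv (line_monom a b p)"
    by (rule line_monom_D1_eq)
      (simp_all add: line_fst_def line_snd_def quat_j_def torus_field_def pderiv_pCons algebra_simps)
  then show ?thesis
    by (cases j) (simp_all add: monom_sibling_def coeff_pderiv of_nat_poly algebra_simps)
qed

lemma
  shows line_monom_D1_quat_j: "line_monom_D1 a b p (quat_j p)
      = - of_nat (a + b) * [:0, 1:] * line_monom a b p + [:1, 0, 1:] * pderiv (line_monom a b p)"
    and line_monom_D1_i_quat_j: "line_monom_D1 a b p (cscale \<i> (quat_j p))
      = of_nat (a + b) * [:0, \<i>:] * line_monom a b p + [:\<i>, 0, - \<i>:] * pderiv (line_monom a b p)"
proof -
  have "line_monom_D1 a b p (quat_j p)
      = (of_nat a * [:0, - 1:] + of_nat b * [:0, - 1:]) * line_monom a b p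
        + [:1, 0, 1:] * pderiv (line_monom a b p)"
    by (rule line_monom_D1_eq)
      (simp_all add: line_fst_def line_snd_def quat_j_def pderiv_pCons)
  then show "line_monom_D1 a b p (quat_j p)
      = - of_nat (a + b) * [:0, 1:] * line_monom a b p + [:1, 0, 1:] * pderiv (line_monom a b p)"
    by (simp add: algebra_simps)
  have "line_monom_D1 a b p (cscale \<i> (quat_j p))
      = (of_nat a * [:0, \<i>:] + of_nat b * [:0, \<i>:]) * line_monom a b p
        + [:\<i>, 0, - \<i>:] * pderiv (line_monom a b p)"
    by (rule line_monom_D1_eq)
      (simp_all add: line_fst_def line_snd_def quat_j_def cscale_def pderiv_pCons)
  then show "line_monom_D1 a b p (cscale \<i> (quat_j p))
      = of_nat (a + b) * [:0, \<i>:] * line_monom a b p + [:\<i>, 0, - \<i>:] * pderiv (line_monom a b p)"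
    by (simp add: algebra_simps)
qed

lemma monom_sibling_raising:
  "coeff (line_monom_D1 a b p (quat_j p)) j - \<i> * coeff (line_monom_D1 a b p (cscale \<i> (quat_j p))) j
    = 2 * of_nat (Suc j) * monom_sibling a b (Suc j) p"
  unfolding line_monom_D1_quat_j line_monom_D1_i_quat_j
  by (cases j; cases "j - 1") (simp_all add: monom_sibling_def coeff_pderiv of_nat_poly algebra_simps)

lemma monom_sibling_lowering:
  "coeff (line_monom_D1 a b p (quat_j p)) (Suc j)
      + \<i> * coeff (line_monom_D1 a b p (cscale \<i> (quat_j p))) (Suc j)
    = - 2 * ((of_nat (a + b) - of_nat j) * monom_sibling a b j p)"
  unfolding line_monom_D1_quat_j line_monom_D1_i_quat_j
  by (cases j) (simp_all add: monom_sibling_def coeff_pderiv of_nat_poly algebra_simps)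

lemma monom_sibling_0: "monom_sibling a b 0 p = fst p ^ a * snd p ^ b"
  by (simp add: monom_sibling_def line_monom_def coeff_mult coeff_0_power line_fst_def line_snd_def)

lemma monom_sibling_not_identically_0:
  assumes "j \<le> a + b"
  shows "\<exists>y. y \<noteq> 0 \<and> monom_sibling a b j y \<noteq> 0"
  using assms
proof (induction j)
  case 0
  show ?case
    by (rule exI[of _ "(1, 1)"]) (simp add: monom_sibling_0 zero_prod_def)
next
  case (Suc j)
  then obtain y where y: "y \<noteq> 0" "monom_sibling a b j y \<noteq> 0"
    by auto
  show ?case
  proof (rule ccontr)
    assume "\<not> ?case"
    then have zero: "monom_sibling a b (Suc j) x = 0" if "x \<noteq> 0" for x
      using that by blast
    have "(monom_sibling a b (Suc j) has_derivative (\<lambda>_. 0)) (at y)"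
      by (rule has_derivative_transform_within_open[where f = "\<lambda>_. 0" and s = "- {0}"])
        (use y(1) zero in \<open>simp_all add: open_Compl\<close>)
    then have "(\<lambda>_. 0) = (\<lambda>v. coeff (line_monom_D1 a b y v) (Suc j))"
      by (rule has_derivative_unique) (rule has_jet_derivative[OF has_jet_monom_sibling UNIV_I])
    then have "coeff (line_monom_D1 a b y v) (Suc j) = 0" for v
      by metis
    then have "- 2 * ((of_nat (a + b) - of_nat j) * monom_sibling a b j y) = 0"
      unfolding monom_sibling_lowering[symmetric] by simp
    moreover have "of_nat (a + b) - of_nat j \<noteq> (0 :: complex)"
      using Suc.prems by (simp only: right_minus_eq of_nat_eq_iff)
    ultimately show False
      using y(2) by (auto simp only: mult_eq_0_iff neg_equal_0_iff_equal zero_neq_numeral[symmetric])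
  qed
qed

lemma monom_sibling_eq_0:
  assumes "a + b < j"
  shows "monom_sibling a b j p = 0"
proof -
  have "degree (line_fst p) * a \<le> 1 * a" "degree (line_snd p) * b \<le> 1 * b"
    by (intro mult_le_mono1; simp add: line_fst_def line_snd_def)+
  then have "degree (line_monom a b p) \<le> a + b"
    unfolding line_monom_def
    using degree_mult_le[of "line_fst p ^ a" "line_snd p ^ b"]
      degree_power_le[of "line_fst p" a] degree_power_le[of "line_snd p" b] by linarith
  then show ?thesis
    unfolding monom_sibling_def using assms by (intro coeff_eq_0) simp
qed

lemma monom_sibling_scaleR:
  "monom_sibling a b j (r *\<^sub>R p) = of_real (r ^ (a + b)) * monom_sibling a b j p"
proof -
  have "line_fst (r *\<^sub>R p) = smult (of_real r) (line_fst p)"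
    "line_snd (r *\<^sub>R p) = smult (of_real r) (line_snd p)"
    by (simp_all add: line_fst_def line_snd_def quat_j_def scaleR_conv_of_real)
  then show ?thesis
    by (simp add: monom_sibling_def line_monom_def smult_power power_add)
qed

lemma monom_sibling_harmonic: "basis_trace (\<lambda>v w. coeff (line_monom_D2 a b x v w) j) = 0"
proof -
  let ?t = "[:0, 1::complex:]" and ?i = "[:\<i>:]"
  have basis: "line_fst (1,0) = 1" "line_fst (\<i>,0) = ?i" "line_fst (0,1) = - ?t"
    "line_fst (0,\<i>) = ?i * ?t"
    "line_snd (1,0) = ?t" "line_snd (\<i>,0) = - ?i * ?t" "line_snd (0,1) = 1" "line_snd (0,\<i>) = ?i"
    by (auto simp: line_fst_def line_snd_def quat_j_def one_pCons)
  have i: "?i * ?i = - 1" "?i * (?i * y) = - y" for y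
    by (simp_all add: one_pCons)
  have "(\<Sum>v\<in>Basis. line_monom_D2 a b x v v) = 0"
    unfolding sum_Basis_C2 line_monom_D2_def line_monom_D1_def basis
    by (simp only: algebra_simps i) (simp add: algebra_simps i)
  then show ?thesis
    by (simp add: basis_trace_def flip: coeff_sum)
qed

subsection \<open>Orthogonality of the monomial modes\<close>

definition monom_mode :: "nat \<Rightarrow> nat \<Rightarrow> nat \<Rightarrow> C2pt \<Rightarrow> complex" where
  "monom_mode a b j = restrS3 (monom_sibling a b j)"

lemma ext0_monom_mode:
  assumes "y \<noteq> 0"
  shows "ext0 (monom_mode a b j) y = of_real (inverse (norm y) ^ (a + b)) * monom_sibling a b j y"
  using normalize_in_S3[OF assms]
  by (simp add: ext0_def monom_mode_def restrS3_def monom_sibling_scaleR)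

lemma sphere_eigenfunction_monom_mode: "sphere_eigenfunction (a + b) (monom_mode a b j)"
proof -
  have "angular_eigenfunction (- real (a + b) * (real (a + b) + DIM(C2pt) - 2))
      (\<lambda>y. of_real (inverse (norm y) ^ (a + b)) * monom_sibling a b j y)"
    by (rule angular_eigenfunction_harmonic[OF has_jet_monom_sibling])
      (simp_all add: line_monom_D1_radial monom_sibling_harmonic monom_sibling_def of_nat_poly)
  moreover have "- real (a + b) * (real (a + b) + DIM(C2pt) - 2) = - real ((a + b) * (a + b + 2))"
    by (simp add: algebra_simps)
  ultimately have "angular_eigenfunction (- real ((a + b) * (a + b + 2)))
      (\<lambda>y. of_real (inverse (norm y) ^ (a + b)) * monom_sibling a b j y)"
    by simp
  then show ?thesis
    unfolding sphere_eigenfunction_def by (rule angular_eigenfunction_cong) (simp add: ext0_monom_mode)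
qed

lemma has_jet_ext0_monom_mode:
  obtains u2 where "has_jet (ext0 (monom_mode a b j))
    (\<lambda>y v. of_real (inverse (norm y) ^ (a + b)) * coeff (line_monom_D1 a b y v) j
       + of_real (inverse_norm_power_D1 (a + b) y v) * monom_sibling a b j y) u2 (- {0})"
proof -
  note normalized = has_jet_mult[OF has_jet_of_real_inverse_norm_power has_jet_monom_sibling]
  show thesis
    by (rule that, rule has_jet_cong[OF normalized]) (simp_all add: ext0_monom_mode open_Compl)
qed

lemma monom_mode_orthogonal_if_weights_differ:
  fixes s t :: real
  assumes "s * a + t * b - (s + t) * j \<noteq> s * a' + t * b' - (s + t) * j'"
  shows "shell_prod (ext0 (monom_mode a b j)) (ext0 (monom_mode a' b' j')) = 0"
proof -
  define u1 where "u1 a b j y v = of_real (inverse (norm y) ^ (a + b)) * coeff (line_monom_D1 a b y v) j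
     + of_real (inverse_norm_power_D1 (a + b) y v) * monom_sibling a b j y" for a b j y v
  have skew: "y \<bullet> torus_field s t y = 0" for y
    by (simp add: torus_field_def inner_prod_def inner_complex_def)
  have u1: "u1 a b j y (torus_field s t y)
      = \<i> * of_real (s * a + t * b - (s + t) * j) * ext0 (monom_mode a b j) y" if "y \<noteq> 0" for a b j y
    using that
    by (simp add: u1_def line_monom_D1_torus_field inverse_norm_power_D1_def skew ext0_monom_mode)
  obtain u2 where u: "has_jet (ext0 (monom_mode a b j)) (u1 a b j) u2 (- {0})"
    unfolding u1_def by (rule has_jet_ext0_monom_mode)
  obtain v2 where v: "has_jet (ext0 (monom_mode a' b' j')) (u1 a' b' j') v2 (- {0})"
    unfolding u1_def by (rule has_jet_ext0_monom_mode)
  have "linear (torus_field s t)"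
    by (rule linearI) (simp_all add: torus_field_def algebra_simps)
  then show ?thesis
    by (rule rotation_weights_orthogonal[OF _ skew u u1 v u1 assms])
qed

lemma monom_mode_orthogonal:
  assumes "(a, b, j) \<noteq> (a', b', j')"
  shows "shell_prod (ext0 (monom_mode a b j)) (ext0 (monom_mode a' b' j')) = 0"
proof -
  consider "a + b \<noteq> a' + b'" | "real a - real j \<noteq> real a' - real j'"
    | "real b - real j \<noteq> real b' - real j'"
    using assms by force
  then show ?thesis
  proof cases
    case 1
    then show ?thesis
      by (rule sphere_eigenfunction_orthogonal[OF sphere_eigenfunction_monom_mode
        sphere_eigenfunction_monom_mode])
  next
    case 2
    then show ?thesis
      using monom_mode_orthogonal_if_weights_differ[of 1 a 0] by simp
  next
    case 3
    then show ?thesis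
      using monom_mode_orthogonal_if_weights_differ[of 0 a 1] by simp
  qed
qed

lemma shell_prod_monom_mode_self:
  assumes "j \<le> a + b"
  shows "shell_prod (ext0 (monom_mode a b j)) (ext0 (monom_mode a b j)) \<noteq> 0"
proof
  assume "shell_prod (ext0 (monom_mode a b j)) (ext0 (monom_mode a b j)) = 0"
  then have mode_0: "monom_mode a b j x = 0" if "x \<in> S3" for x
    using shell_prod_self_eq_0 sphere_eigenfunction_continuous_ext0[OF sphere_eigenfunction_monom_mode]
      ext0_eq_0_imp[OF _ that] by blast
  obtain y where y: "y \<noteq> 0" "monom_sibling a b j y \<noteq> 0"
    using monom_sibling_not_identically_0[OF assms] by blast
  then have "monom_mode a b j (inverse (norm y) *\<^sub>R y) \<noteq> 0"
    using normalize_in_S3 by (simp add: monom_mode_def restrS3_def monom_sibling_scaleR)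
  then show False
    using mode_0[OF normalize_in_S3[OF y(1)]] by simp
qed

subsection \<open>Density of the monomial modes\<close>

interpretation fun_space: vector_space "\<lambda>(c::complex) (f::'a \<Rightarrow> complex) x. c * f x"
  by unfold_locales (auto simp: plus_fun_def algebra_simps)

lemmas fun_subspace_def = fun_space.subspace_def[unfolded plus_fun_def zero_fun_def]
lemmas fun_span_add = fun_space.span_add[unfolded plus_fun_def]

lemma fun_span_scale_cancel:
  assumes "(\<lambda>x. c * f x) \<in> fun_space.span S" "c \<noteq> 0"
  shows "f \<in> fun_space.span S"
  using fun_space.span_scale[OF assms(1), of "inverse c"] assms(2) by (simp flip: mult.assoc)

definition monom_mode_span :: "(C2pt \<Rightarrow> complex) set" where
  "monom_mode_span = fun_space.span (range (\<lambda>(a, b, j). monom_mode a b j))"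

lemma monom_mode_in_span: "monom_mode a b j \<in> monom_mode_span"
  unfolding monom_mode_span_def
  by (rule fun_space.span_base) (auto intro: range_eqI[of _ _ "(a, b, j)"])

lemma monom_mode_span_add:
  "f \<in> monom_mode_span \<Longrightarrow> g \<in> monom_mode_span \<Longrightarrow> (\<lambda>x. f x + g x) \<in> monom_mode_span"
  unfolding monom_mode_span_def by (rule fun_span_add)

lemma monom_mode_span_diff:
  "f \<in> monom_mode_span \<Longrightarrow> g \<in> monom_mode_span \<Longrightarrow> (\<lambda>x. f x - g x) \<in> monom_mode_span"
  unfolding monom_mode_span_def by (rule fun_space.span_diff[unfolded fun_diff_def])

lemma monom_mode_span_scale: "f \<in> monom_mode_span \<Longrightarrow> (\<lambda>x. c * f x) \<in> monom_mode_span"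
  unfolding monom_mode_span_def by (rule fun_space.span_scale)

lemma monom_mode_span_induct [consumes 1, case_names subspace monom_mode]:
  assumes "f \<in> monom_mode_span" "fun_space.subspace {f. P f}" "\<And>a b j. P (monom_mode a b j)"
  shows "P f"
  using assms(1,2) unfolding monom_mode_span_def
  by (rule fun_space.span_induct) (use assms(3) in auto)

definition span_multiplier :: "(C2pt \<Rightarrow> complex) \<Rightarrow> bool" where
  "span_multiplier m \<longleftrightarrow> (\<forall>f\<in>monom_mode_span. (\<lambda>x. m x * f x) \<in> monom_mode_span)"

lemma span_multiplierI:
  assumes "\<And>a b j. (\<lambda>x. m x * monom_mode a b j x) \<in> monom_mode_span"
  shows "span_multiplier m"
  unfolding span_multiplier_def
proof
  fix f assume "f \<in> monom_mode_span"
  then show "(\<lambda>x. m x * f x) \<in> monom_mode_span"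
  proof (induction rule: monom_mode_span_induct)
    case subspace
    have "(\<lambda>x. 0) \<in> monom_mode_span"
      using monom_mode_span_scale[OF monom_mode_in_span, of 0] by simp
    then show ?case
      using monom_mode_span_add monom_mode_span_scale
      by (auto simp: fun_subspace_def distrib_left mult.left_commute[of "m _"])
  qed (rule assms)
qed

lemma span_multiplier_add: "span_multiplier f \<Longrightarrow> span_multiplier g \<Longrightarrow> span_multiplier (\<lambda>x. f x + g x)"
  unfolding span_multiplier_def by (auto simp: distrib_right intro: monom_mode_span_add)

lemma span_multiplier_mult: "span_multiplier f \<Longrightarrow> span_multiplier g \<Longrightarrow> span_multiplier (\<lambda>x. f x * g x)"
  unfolding span_multiplier_def by (auto simp: mult.assoc)

lemma span_multiplier_const: "span_multiplier (\<lambda>x. c)"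
  unfolding span_multiplier_def by (auto intro: monom_mode_span_scale)

lemma S3_cnj: "p \<in> S3 \<Longrightarrow> cnj (fst p) * fst p + cnj (snd p) * snd p = 1"
proof -
  assume "p \<in> S3"
  then have "complex_of_real ((cmod (fst p))^2 + (cmod (snd p))^2) = 1"
    by (simp add: S3_def)
  then show ?thesis
    by (simp only: of_real_add complex_norm_square mult.commute)
qed

lemma
  assumes "p \<in> S3"
  shows cnj_snd_line_monom: "of_nat (a + b + 1) * ([:cnj (snd p):] * line_monom a b p)
      = of_nat b * line_monom a (b - 1) p - pderiv (line_monom (Suc a) b p)"
    and cnj_fst_line_monom: "of_nat (a + b + 1) * ([:cnj (fst p):] * line_monom a b p)
      = of_nat a * line_monom (a - 1) b p + pderiv (line_monom a (Suc b) p)"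
proof -
  let ?A = "[:cnj (fst p):]" and ?B = "[:cnj (snd p):]"
  have unit: "?A * line_fst p + ?B * line_snd p = 1"
    using S3_cnj[OF assms] by (simp add: line_fst_def line_snd_def quat_j_def one_pCons algebra_simps)
  have deriv: "pderiv (line_fst p) = - ?B" "pderiv (line_snd p) = ?A"
    by (simp_all add: line_fst_def line_snd_def quat_j_def pderiv_pCons)
  have "of_nat b * line_monom a (b - 1) p
      = of_nat b * ((?A * line_fst p + ?B * line_snd p) * line_monom a (b - 1) p)"
    unfolding unit by simp
  also have "\<dots> = ?A * (of_nat b * line_monom (Suc a) (b - 1) p) + ?B * (of_nat b * line_monom a b p)"
    unfolding of_nat_line_monom(2)[symmetric] line_monom_Suc(1) by (simp add: algebra_simps)
  finally show "of_nat (a + b + 1) * (?B * line_monom a b p)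
    = of_nat b * line_monom a (b - 1) p - pderiv (line_monom (Suc a) b p)"
    unfolding pderiv_line_monom deriv by (simp add: algebra_simps smult_add_right)
  have "of_nat a * line_monom (a - 1) b p
      = of_nat a * ((?A * line_fst p + ?B * line_snd p) * line_monom (a - 1) b p)"
    unfolding unit by simp
  also have "\<dots> = ?A * (of_nat a * line_monom a b p) + ?B * (of_nat a * line_monom (a - 1) (Suc b) p)"
    unfolding of_nat_line_monom(1)[symmetric] line_monom_Suc(2) by (simp add: algebra_simps)
  finally show "of_nat (a + b + 1) * (?A * line_monom a b p)
    = of_nat a * line_monom (a - 1) b p + pderiv (line_monom a (Suc b) p)"
    unfolding pderiv_line_monom deriv by (simp add: algebra_simps smult_add_right)
qed

lemma
  shows cnj_snd_monom_mode: "of_nat (a + b + 1) * (cnj (snd p) * monom_mode a b j p)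
      = of_nat b * monom_mode a (b - 1) j p - of_nat (Suc j) * monom_mode (Suc a) b (Suc j) p"
    and cnj_fst_monom_mode: "of_nat (a + b + 1) * (cnj (fst p) * monom_mode a b j p)
      = of_nat a * monom_mode (a - 1) b j p + of_nat (Suc j) * monom_mode a (Suc b) (Suc j) p"
  using arg_cong[OF cnj_snd_line_monom, of p "\<lambda>P. coeff P j"]
    arg_cong[OF cnj_fst_line_monom, of p "\<lambda>P. coeff P j"]
  by (simp_all add: monom_mode_def restrS3_def monom_sibling_def coeff_pderiv of_nat_poly mult_ac)

lemma
  shows fst_monom_mode: "fst p * monom_mode a b j p
      = monom_mode (Suc a) b j p + (if j = 0 then 0 else cnj (snd p) * monom_mode a b (j - 1) p)"
    and snd_monom_mode: "snd p * monom_mode a b j p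
      = monom_mode a (Suc b) j p
        + (if j = 0 then 0 else - 1 * (cnj (fst p) * monom_mode a b (j - 1) p))"
  by (cases j; simp add: monom_mode_def restrS3_def monom_sibling_def line_monom_Suc line_fst_def
    line_snd_def quat_j_def)+

lemma
  shows span_multiplier_cnj_snd: "span_multiplier (\<lambda>p. cnj (snd p))"
    and span_multiplier_cnj_fst: "span_multiplier (\<lambda>p. cnj (fst p))"
proof -
  have nonzero: "of_nat (a + b + 1) \<noteq> (0 :: complex)" for a b
    by (metis of_nat_eq_0_iff add_is_0 one_neq_zero)
  have cancel: "f \<in> monom_mode_span" if "(\<lambda>x. of_nat (a + b + 1) * f x) \<in> monom_mode_span" for f a b
    using that nonzero unfolding monom_mode_span_def by (rule fun_span_scale_cancel)
  have times_cnj_snd: "(\<lambda>x. of_nat (a + b + 1) * (cnj (snd x) * monom_mode a b j x))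
      \<in> monom_mode_span" for a b j
    unfolding cnj_snd_monom_mode
    by (intro monom_mode_span_diff monom_mode_span_scale monom_mode_in_span)
  show "span_multiplier (\<lambda>p. cnj (snd p))"
    by (rule span_multiplierI, rule cancel, rule times_cnj_snd)
  have times_cnj_fst: "(\<lambda>x. of_nat (a + b + 1) * (cnj (fst x) * monom_mode a b j x))
      \<in> monom_mode_span" for a b j
    unfolding cnj_fst_monom_mode
    by (intro monom_mode_span_add monom_mode_span_scale monom_mode_in_span)
  show "span_multiplier (\<lambda>p. cnj (fst p))"
    by (rule span_multiplierI, rule cancel, rule times_cnj_fst)
qed

lemma
  shows span_multiplier_fst: "span_multiplier fst"
    and span_multiplier_snd: "span_multiplier snd"
proof -
  have "(\<lambda>x. if j = 0 then 0 else c * (m x * monom_mode a b (j - 1) x)) \<in> monom_mode_span"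
    if "span_multiplier m" for m :: "C2pt \<Rightarrow> complex" and c a b j
    using monom_mode_span_scale[OF monom_mode_in_span, of 0]
      that monom_mode_in_span monom_mode_span_scale
    by (cases "j = 0") (auto simp: span_multiplier_def)
  from monom_mode_span_add[OF monom_mode_in_span this[OF span_multiplier_cnj_snd, where c = 1]]
    monom_mode_span_add[OF monom_mode_in_span this[OF span_multiplier_cnj_fst, where c = "- 1"]]
  show "span_multiplier fst" "span_multiplier snd"
    by (intro span_multiplierI; simp only: fst_monom_mode snd_monom_mode mult_1_left)+
qed

lemma span_multiplier_real_polynomial:
  fixes f :: "C2pt \<Rightarrow> real"
  assumes "real_polynomial_function f"
  shows "span_multiplier (\<lambda>x. of_real (f x))"
  using assms
proof induction
  case (linear f)
  have re_im: "of_real (Re z) = (1 / 2) * (z + cnj z)"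
    "of_real (Im z) = (1 / (2 * \<i>)) * (z + - 1 * cnj z)" for z
    by (simp_all add: complex_eq_iff)
  have expand: "f x = Re (fst x) * f (1, 0) + Im (fst x) * f (\<i>, 0) + Re (snd x) * f (0, 1)
      + Im (snd x) * f (0, \<i>)" for x
    using linear_sum_Basis[OF bounded_linear.linear[OF linear], of x]
    by (simp add: sum_Basis_C2 inner_prod_def)
  have f: "(\<lambda>x. complex_of_real (f x)) = (\<lambda>x.
      (1 / 2) * (fst x + cnj (fst x)) * of_real (f (1, 0))
      + (1 / (2 * \<i>)) * (fst x + - 1 * cnj (fst x)) * of_real (f (\<i>, 0))
      + (1 / 2) * (snd x + cnj (snd x)) * of_real (f (0, 1))
      + (1 / (2 * \<i>)) * (snd x + - 1 * cnj (snd x)) * of_real (f (0, \<i>)))"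
    unfolding re_im[symmetric] by (rule ext, subst expand) simp
  show ?case
    unfolding f by (intro span_multiplier_add span_multiplier_mult span_multiplier_const
        span_multiplier_fst span_multiplier_snd span_multiplier_cnj_fst span_multiplier_cnj_snd)
qed (simp_all add: span_multiplier_const span_multiplier_add span_multiplier_mult)

lemma polynomial_restrS3_in_span:
  fixes g :: "C2pt \<Rightarrow> complex"
  assumes "polynomial_function g"
  shows "restrS3 g \<in> monom_mode_span"
proof -
  have "real_polynomial_function (Re \<circ> g)" "real_polynomial_function (Im \<circ> g)"
    using assms bounded_linear_Re bounded_linear_Im unfolding polynomial_function_def by blast+
  from this[THEN span_multiplier_real_polynomial]
  have "span_multiplier (\<lambda>x. of_real (Re (g x)) + \<i> * of_real (Im (g x)))"
    by (intro span_multiplier_add span_multiplier_mult span_multiplier_const) simp_all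
  then have "(\<lambda>x. g x * monom_mode 0 0 0 x) \<in> monom_mode_span"
    using monom_mode_in_span by (simp add: span_multiplier_def flip: complex_eq)
  moreover have "(\<lambda>x. g x * monom_mode 0 0 0 x) = restrS3 g"
    by (simp add: monom_mode_def restrS3_def monom_sibling_0 fun_eq_iff)
  ultimately show ?thesis
    by simp
qed

subsection \<open>Completeness and independence of the monomial modes\<close>

lemma compact_S3: "compact S3"
proof -
  have sphere: "S3 = sphere 0 1"
    by (rule set_eqI) (simp add: S3_iff_norm)
  show ?thesis
    unfolding sphere by (rule compact_sphere)
qed

lemma continuous_on_monom_mode: "continuous_on S3 (monom_mode a b j)"
  by (rule sphere_eigenfunction_continuous[OF sphere_eigenfunction_monom_mode])

lemma cmod_ext0_le: "(\<And>x. x \<in> S3 \<Longrightarrow> cmod (F x) \<le> M) \<Longrightarrow> y \<noteq> 0 \<Longrightarrow> cmod (ext0 F y) \<le> M"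
  by (simp add: ext0_def normalize_in_S3)

lemma real_le_0_if_le_all_multiples:
  fixes x c :: real
  assumes "\<And>\<epsilon>. \<epsilon> > 0 \<Longrightarrow> x \<le> c * \<epsilon>"
  shows "x \<le> 0"
proof (rule field_le_epsilon)
  fix e :: real assume "e > 0"
  have "x \<le> c * (e / (\<bar>c\<bar> + 1))"
    using \<open>e > 0\<close> by (intro assms) simp
  also have "\<dots> \<le> (\<bar>c\<bar> + 1) * (e / (\<bar>c\<bar> + 1))"
    using \<open>e > 0\<close> by (intro mult_right_mono) auto
  finally show "x \<le> 0 + e" by simp
qed

lemma shell_prod_monom_mode_span_eq_0:
  assumes "continuous_on S3 H" "\<And>a b j. shell_prod (ext0 (monom_mode a b j)) (ext0 H) = 0"
    and "f \<in> monom_mode_span"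
  shows "continuous_on S3 f \<and> shell_prod (ext0 f) (ext0 H) = 0"
  using assms(3)
proof (induction rule: monom_mode_span_induct)
  case subspace
  have ext0: "ext0 (\<lambda>_. 0) = (\<lambda>_. 0)" "ext0 (\<lambda>x. f x + g x) = (\<lambda>y. ext0 f y + ext0 g y)"
    "ext0 (\<lambda>x. c * f x) = (\<lambda>y. c * ext0 f y)" for f g c
    by (simp_all add: ext0_def fun_eq_iff)
  show ?case
    using assms(1)
    by (auto simp: fun_subspace_def ext0 shell_prod_add_left shell_prod_scale_left continuous_on_ext0
        intro!: continuous_intros)
qed (simp add: assms(2) continuous_on_monom_mode)

theorem orthogonal_to_monom_modes_imp_0:
  assumes cont: "continuous_on S3 H"
    and orth: "\<And>a b j. shell_prod (ext0 (monom_mode a b j)) (ext0 H) = 0"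
    and "x \<in> S3"
  shows "H x = 0"
proof -
  have "bounded (H ` S3)"
    using compact_S3 cont by (intro compact_imp_bounded compact_continuous_image)
  then obtain M where M: "\<And>x. x \<in> S3 \<Longrightarrow> cmod (H x) \<le> M"
    unfolding bounded_iff by auto
  have "cmod (shell_prod (ext0 H) (ext0 H)) \<le> ((\<integral>y. shell_weight (y :: C2pt) \<partial>lborel) * M) * \<epsilon>"
    if "\<epsilon> > 0" for \<epsilon>
  proof -
    obtain g where g: "polynomial_function g" "\<And>x. x \<in> S3 \<Longrightarrow> cmod (H x - g x) < \<epsilon>"
      using Stone_Weierstrass_polynomial_function[OF compact_S3 cont \<open>\<epsilon> > 0\<close>] by blast
    note g_span = shell_prod_monom_mode_span_eq_0[OF cont orth polynomial_restrS3_in_span[OF g(1)]]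
    have diff: "ext0 (\<lambda>x. H x - restrS3 g x) = (\<lambda>y. ext0 H y - ext0 (restrS3 g) y)"
      by (simp add: ext0_def fun_eq_iff)
    have "shell_prod (ext0 H) (ext0 H) = shell_prod (ext0 (\<lambda>x. H x - restrS3 g x)) (ext0 H)"
      unfolding diff using g_span cont by (simp add: shell_prod_diff_left continuous_on_ext0)
    also have "cmod \<dots> \<le> (\<integral>y. shell_weight (y :: C2pt) \<partial>lborel) * (\<epsilon> * M)"
    proof (rule cmod_shell_prod_le)
      show "cmod (ext0 (\<lambda>x. H x - restrS3 g x) y) \<le> \<epsilon>" if "y \<noteq> 0" for y
        using that g(2) by (intro cmod_ext0_le) (auto simp: restrS3_def intro: less_imp_le)
      show "cmod (ext0 H y) \<le> M" if "y \<noteq> 0" for y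
        using that M by (intro cmod_ext0_le)
    qed (use g_span cont in \<open>auto intro!: continuous_on_ext0 continuous_intros\<close>)
    finally show ?thesis by (simp add: mult_ac)
  qed
  then have "cmod (shell_prod (ext0 H) (ext0 H)) \<le> 0"
    by (rule real_le_0_if_le_all_multiples)
  then have "shell_prod (ext0 H) (ext0 H) = 0"
    by simp
  then show ?thesis
    using shell_prod_self_eq_0[OF continuous_on_ext0[OF cont]] ext0_eq_0_imp[OF _ \<open>x \<in> S3\<close>] by blast
qed

lemma sphere_eigenfunction_eq_0_if_orthogonal:
  assumes H: "sphere_eigenfunction k H"
    and orth: "\<And>a j. a \<le> k \<Longrightarrow> j \<le> k \<Longrightarrow> shell_prod (ext0 H) (ext0 (monom_mode a (k - a) j)) = 0"
    and "x \<in> S3"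
  shows "H x = 0"
proof -
  have "shell_prod (ext0 H) (ext0 (monom_mode a b j)) = 0" for a b j
  proof -
    consider "a + b \<noteq> k" | "b = k - a" "a \<le> k" "j \<le> k" | "a + b < j" by linarith
    then show ?thesis
    proof cases
      case 1
      then show ?thesis
        using sphere_eigenfunction_orthogonal[OF H sphere_eigenfunction_monom_mode] by simp
    next
      case 2
      then show ?thesis
        using orth by simp
    next
      case 3
      then have "ext0 (monom_mode a b j) = (\<lambda>_. 0)"
        by (simp add: ext0_def monom_mode_def restrS3_def monom_sibling_eq_0 fun_eq_iff)
      then show ?thesis
        by (simp add: shell_prod_def)
    qed
  qed
  then have "shell_prod (ext0 (monom_mode a b j)) (ext0 H) = 0" for a b j
    using shell_prod_cnj[of "ext0 H" "ext0 (monom_mode a b j)"] by simp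
  then show ?thesis
    by (rule orthogonal_to_monom_modes_imp_0[OF sphere_eigenfunction_continuous[OF H] _ \<open>x \<in> S3\<close>])
qed

theorem sphere_eigenfunction_expansion:
  assumes F: "sphere_eigenfunction k F"
  obtains c where "\<And>x. x \<in> S3 \<Longrightarrow> F x = (\<Sum>(a, j)\<in>{..k} \<times> {..k}. c a j * monom_mode a (k - a) j x)"
proof -
  let ?A = "{..k} \<times> {..k}"
  define \<phi> where "\<phi> = (\<lambda>(a, j). monom_mode a (k - a) j)"
  define c where "c i = shell_prod (ext0 F) (ext0 (\<phi> i)) / shell_prod (ext0 (\<phi> i)) (ext0 (\<phi> i))" for i
  define H where "H x = F x - (\<Sum>i\<in>?A. c i * \<phi> i x)" for x
  have mode: "sphere_eigenfunction k (\<phi> i)" if "i \<in> ?A" for i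
    using that sphere_eigenfunction_monom_mode[of "fst i" "k - fst i" "snd i"] by (auto simp: \<phi>_def)
  have "H x = 0" if "x \<in> S3" for x
  proof (rule sphere_eigenfunction_eq_0_if_orthogonal[OF _ _ that])
    show "sphere_eigenfunction k H"
      unfolding H_def[abs_def] using F sphere_eigenfunction_sum[OF mode]
      by (rule sphere_eigenfunction_diff)
    fix a j assume aj: "a \<le> k" "j \<le> k"
    have "ext0 H = (\<lambda>y. ext0 F y - (\<Sum>i\<in>?A. c i * ext0 (\<phi> i) y))"
      by (simp add: H_def ext0_def fun_eq_iff)
    moreover have "shell_prod (ext0 (\<phi> i)) (ext0 (\<phi> l)) = 0" if "i \<noteq> l" for i l
      using that by (auto simp: \<phi>_def split: prod.splits intro!: monom_mode_orthogonal)
    moreover have "shell_prod (ext0 (\<phi> (a, j))) (ext0 (\<phi> (a, j))) \<noteq> 0"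
      using aj shell_prod_monom_mode_self[of j a "k - a"] by (simp add: \<phi>_def)
    ultimately have "shell_prod (ext0 H) (ext0 (\<phi> (a, j))) = 0"
      unfolding c_def using aj mode F
      by (simp only:) (intro shell_prod_orthogonal_residual sphere_eigenfunction_continuous_ext0; simp)
    then show "shell_prod (ext0 H) (ext0 (monom_mode a (k - a) j)) = 0"
      by (simp add: \<phi>_def)
  qed
  then have "F x = (\<Sum>(a, j)\<in>?A. c (a, j) * monom_mode a (k - a) j x)" if "x \<in> S3" for x
    using that by (simp add: H_def \<phi>_def split_def)
  then show thesis
    by (rule that)
qed

theorem monom_mode_independent:
  assumes zero: "\<And>x. x \<in> S3 \<Longrightarrow> (\<Sum>(a, j)\<in>{..k} \<times> {..k}. c a j * monom_mode a (k - a) j x) = 0"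
    and "a \<le> k" "j \<le> k"
  shows "c a j = 0"
proof -
  define \<phi> where "\<phi> = (\<lambda>(a, j). ext0 (monom_mode a (k - a) j))"
  have "(\<lambda>(a, j). c a j) (a, j) = 0"
  proof (rule shell_prod_orthogonal_independent[where A = "{..k} \<times> {..k}" and \<phi> = \<phi>])
    show "continuous_on (- {0}) (\<phi> i)" for i
      by (auto simp: \<phi>_def split: prod.splits intro!: continuous_on_ext0 continuous_on_monom_mode)
    show "shell_prod (\<phi> i) (\<phi> l) = 0" if "i \<noteq> l" for i l
      using that by (auto simp: \<phi>_def split: prod.splits intro!: monom_mode_orthogonal)
    show "(\<Sum>i\<in>{..k} \<times> {..k}. (\<lambda>(a, j). c a j) i * \<phi> i y) = 0" if "y \<noteq> 0" for y
      using zero[OF normalize_in_S3[OF that]] by (simp add: \<phi>_def ext0_def split_def)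
    show "shell_prod (\<phi> (a, j)) (\<phi> (a, j)) \<noteq> 0"
      using shell_prod_monom_mode_self[of j a "k - a"] assms(2,3) by (simp add: \<phi>_def)
  qed (use assms in auto)
  then show ?thesis by simp
qed

subsection \<open>Binary forms\<close>

definition binary_form :: "nat \<Rightarrow> 'a::field poly \<Rightarrow> 'a \<times> 'a \<Rightarrow> 'a" where
  "binary_form k q p = (\<Sum>i\<le>k. coeff q i * (fst p ^ i * snd p ^ (k - i)))"

lemma binary_form_0: "binary_form k 0 p = 0"
  by (simp add: binary_form_def)

lemma binary_form_add: "binary_form k (q + r) p = binary_form k q p + binary_form k r p"
  by (simp add: binary_form_def algebra_simps sum.distrib)

lemma binary_form_diff: "binary_form k (q - r) p = binary_form k q p - binary_form k r p"
  by (simp add: binary_form_def algebra_simps sum_subtractf)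

lemma binary_form_smult: "binary_form k (smult c q) p = c * binary_form k q p"
  by (simp add: binary_form_def algebra_simps sum_distrib_left)

lemma binary_form_sum: "binary_form k (\<Sum>i\<in>A. q i) p = (\<Sum>i\<in>A. binary_form k (q i) p)"
  by (induction A rule: infinite_finite_induct) (simp_all add: binary_form_0 binary_form_add)

lemma binary_form_monom: "i \<le> k \<Longrightarrow> binary_form k (monom c i) p = c * (fst p ^ i * snd p ^ (k - i))"
  by (simp add: binary_form_def if_distrib[of "\<lambda>x. x * _"] cong: if_cong)

lemma binary_form_cscale: "binary_form k q (cscale c p) = c ^ k * binary_form k q p"
  unfolding binary_form_def cscale_def sum_distrib_left
  by (intro sum.cong) (auto simp: power_mult_distrib mult_ac simp flip: power_add)

lemma binary_form_at_infinity: "binary_form k q (x, 0) = coeff q k * x ^ k"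
proof -
  have "binary_form k q (x, 0) = (\<Sum>i\<le>k. if i = k then coeff q k * x ^ k else 0)"
    unfolding binary_form_def by (intro sum.cong) auto
  then show ?thesis by simp
qed

lemma binary_form_affine:
  assumes "degree q \<le> k"
  shows "binary_form k q (z, 1) = poly q z"
proof -
  have "poly q z = (\<Sum>i\<le>k. coeff q i * z ^ i)"
    unfolding poly_altdef using assms
    by (intro sum.mono_neutral_left) (auto simp: coeff_eq_0)
  then show ?thesis by (simp add: binary_form_def)
qed

lemma binary_form_finite:
  assumes "degree q \<le> k" "snd p \<noteq> 0"
  shows "binary_form k q p = snd p ^ k * poly q (fst p / snd p)"
  using binary_form_cscale[of k q "snd p" "(fst p / snd p, 1)"] assms
  by (simp add: cscale_def binary_form_affine)

lemma binary_form_eqD: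
  fixes q r :: "'a::field_char_0 poly"
  assumes "degree q \<le> k" "degree r \<le> k" "\<And>p. binary_form k q p = binary_form k r p"
  shows "q = r"
  using assms binary_form_affine by (metis poly_eq_poly_eq_iff ext)

lemma coeff_mult_top:
  fixes q r :: "'a::comm_semiring_0 poly"
  assumes "degree q \<le> k" "degree r \<le> l"
  shows "coeff (q * r) (k + l) = coeff q k * coeff r l"
proof -
  have "coeff q i * coeff r (k + l - i) = (if i = k then coeff q k * coeff r l else 0)" for i
    using assms by (cases i k rule: linorder_cases) (simp_all add: coeff_eq_0)
  then show ?thesis
    unfolding coeff_mult by simp
qed

lemma binary_form_mult:
  assumes "degree q \<le> k" "degree r \<le> l"
  shows "binary_form (k + l) (q * r) p = binary_form k q p * binary_form l r p"
proof (cases "snd p = 0")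
  case True
  then obtain x where "p = (x, 0)"
    by (metis prod.collapse)
  then show ?thesis
    by (simp add: binary_form_at_infinity coeff_mult_top[OF assms] power_add)
next
  case False
  have "degree (q * r) \<le> k + l"
    using assms degree_mult_le[of q r] by linarith
  then show ?thesis
    using assms False by (simp add: binary_form_finite power_add mult_ac)
qed

lemma degree_power_le_mult: "degree q \<le> k \<Longrightarrow> degree (q ^ n) \<le> k * n"
  using degree_power_le[of q n] by (meson le_trans mult_le_mono1)

lemma binary_form_power:
  assumes "degree q \<le> k"
  shows "binary_form (k * n) (q ^ n) p = binary_form k q p ^ n"
proof (induction n)
  case 0
  show ?case by (simp add: binary_form_def)
next
  case (Suc n)
  then show ?case
    using binary_form_mult[OF assms degree_power_le_mult[OF assms, of n], of p] by simp
qed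

definition act_form :: "mat2 \<Rightarrow> nat \<Rightarrow> complex poly \<Rightarrow> complex poly" where
  "act_form g k q = (case g of (a, b, c, d) \<Rightarrow>
     \<Sum>i\<le>k. smult (coeff q i) ([:b, a:] ^ i * [:d, c:] ^ (k - i)))"

lemma
  shows degree_act_form: "degree (act_form g k q) \<le> k"
    and binary_form_act_form: "binary_form k (act_form g k q) p = binary_form k q (mat_act g p)"
proof -
  obtain a b c d where g: "g = (a, b, c, d)" by (cases g) auto
  define m where "m i = [:b, a:] ^ i * [:d, c:] ^ (k - i)" for i
  have act: "act_form g k q = (\<Sum>i\<le>k. smult (coeff q i) (m i))"
    by (simp add: act_form_def g m_def)
  have degrees: "degree ([:b, a:] ^ i) \<le> 1 * i" "degree ([:d, c:] ^ i) \<le> 1 * i" for i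
    by (intro degree_power_le_mult; simp)+
  have "degree (m i) \<le> k" if "i \<le> k" for i
    using degree_mult_le[of "[:b, a:] ^ i" "[:d, c:] ^ (k - i)"]
      degrees(1)[of i] degrees(2)[of "k - i"] that
    by (simp add: m_def)
  then show "degree (act_form g k q) \<le> k"
    unfolding act by (intro degree_sum_le) (auto intro: order_trans[OF degree_smult_le])
  have "binary_form k (m i) p = fst (mat_act g p) ^ i * snd (mat_act g p) ^ (k - i)" if "i \<le> k" for i
  proof -
    have "binary_form 1 [:b, a:] p = fst (mat_act g p)" "binary_form 1 [:d, c:] p = snd (mat_act g p)"
      by (simp_all add: binary_form_def g mat_act_def)
    then show ?thesis
      using binary_form_mult[OF degrees, of i "k - i" p] binary_form_power[of "[:b, a:]" 1 i p]
        binary_form_power[of "[:d, c:]" 1 "k - i" p] that by (simp add: m_def)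
  qed
  then show "binary_form k (act_form g k q) p = binary_form k q (mat_act g p)"
    unfolding act by (simp add: binary_form_sum binary_form_smult) (simp add: binary_form_def)
qed

subsection \<open>The icosahedral forms\<close>

definition I12_poly :: "complex poly" where
  "I12_poly = monom 1 11 + monom 11 6 - monom 1 1"

definition I20_poly :: "complex poly" where
  "I20_poly = monom 1 20 - monom 228 15 + monom 494 10 + monom 228 5 + monom 1 0"

definition I30_poly :: "complex poly" where
  "I30_poly = monom 1 30 + monom 522 25 - monom 10005 20 - monom 10005 10 - monom 522 5 + monom 1 0"

lemma
  shows I12_eq_binary_form: "I12 p = binary_form 12 I12_poly p"
    and I20_eq_binary_form: "I20 p = binary_form 20 I20_poly p"
    and I30_eq_binary_form: "I30 p = binary_form 30 I30_poly p"
  unfolding I12_def I20_def I30_def I12_poly_def I20_poly_def I30_poly_def binary_form_add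
    binary_form_diff
  by (simp_all add: binary_form_monom Let_def algebra_simps del: monom_0 monom_eq_1)

lemma
  shows degree_I12_poly: "degree I12_poly = 11"
    and degree_I20_poly: "degree I20_poly \<le> 20"
    and degree_I30_poly: "degree I30_poly \<le> 30"
proof -
  show "degree I12_poly = 11"
  proof (rule antisym)
    show "11 \<le> degree I12_poly"
      by (rule le_degree) (simp add: I12_poly_def)
  qed (unfold I12_poly_def, intro degree_add_le degree_diff_le order_trans[OF degree_monom_le]; simp)
  show "degree I20_poly \<le> 20" "degree I30_poly \<le> 30"
    unfolding I20_poly_def I30_poly_def
    by (intro degree_add_le degree_diff_le order_trans[OF degree_monom_le]; simp)+
qed

lemma I12_poly_nonzero: "I12_poly \<noteq> 0"
  using degree_I12_poly by auto

lemma degree_I12_poly_le: "degree I12_poly \<le> 12"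
  by (simp add: degree_I12_poly)

lemma poly_I12_poly: "poly I12_poly z = z * (z ^ 10 + 11 * z ^ 5 - 1)"
  by (simp add: I12_poly_def poly_monom algebra_simps numeral_eq_Suc)

lemma rsquarefree_I12_poly: "rsquarefree I12_poly"
  unfolding rsquarefree_roots
proof (intro allI notI)
  fix z :: complex
  assume "poly I12_poly z = 0 \<and> poly (pderiv I12_poly) z = 0"
  moreover have "poly (pderiv I12_poly) z = 11 * z ^ 10 + 66 * z ^ 5 - 1"
    by (simp add: I12_poly_def pderiv_add pderiv_diff pderiv_monom poly_monom)
  ultimately have root: "z * (z ^ 10 + 11 * z ^ 5 - 1) = 0"
    and critical: "11 * z ^ 10 + 66 * z ^ 5 - 1 = 0"
    by (simp_all add: poly_I12_poly)
  have "z \<noteq> 0"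
    using critical by auto
  then have "z ^ 10 + 11 * z ^ 5 - 1 = 0"
    using root by simp
  then have "(11 * z ^ 5) ^ 2 = 121 * (1 - 11 * z ^ 5)" "11 * z ^ 5 = 2"
    using critical by algebra+
  then show False
    by simp
qed

lemma rsquarefree_dvd_if_roots:
  fixes p q :: "complex poly"
  assumes "rsquarefree p" and roots: "\<And>z. poly p z = 0 \<Longrightarrow> poly q z = 0"
  shows "p dvd q"
proof (cases "q = 0")
  case False
  have "(\<Prod>z | poly p z = 0. [:- z, 1:]) dvd (\<Prod>z | poly q z = 0. [:- z, 1:] ^ order z q)"
  proof (rule prod_dvd_prod_subset2)
    show "finite {z. poly q z = 0}"
      by (rule poly_roots_finite[OF False])
    show "[:- z, 1:] dvd [:- z, 1:] ^ order z q" if "z \<in> {z. poly p z = 0}" for z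
      using that roots False by (intro dvd_power) (auto simp: order_root)
  qed (use roots in auto)
  then have "smult (lead_coeff p) (\<Prod>z | poly p z = 0. [:- z, 1:])
      dvd smult (lead_coeff q) (\<Prod>z | poly q z = 0. [:- z, 1:] ^ order z q)"
    using assms(1) by (intro smult_dvd dvd_smult) (auto simp: rsquarefree_def)
  then show ?thesis
    by (simp only: complex_poly_decompose complex_poly_decompose_rsquarefree[OF assms(1)])
qed simp

definition homog_coords :: "complex option \<Rightarrow> C2pt" where
  "homog_coords w = (case w of None \<Rightarrow> (1, 0) | Some z \<Rightarrow> (z, 1))"

lemma V_I_iff: "w \<in> V_I \<longleftrightarrow> I12 (homog_coords w) = 0"
proof (cases w)
  case None
  then show ?thesis by (simp add: V_I_def homog_coords_def I12_def)
next
  case (Some z)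
  have "I12 (z, 1) = z * (z ^ 10 + 11 * z ^ 5 - 1)"
    by (simp add: I12_eq_binary_form binary_form_affine degree_I12_poly_le poly_I12_poly)
  then show ?thesis using Some by (auto simp: V_I_def homog_coords_def)
qed

lemma I12_poly_factor:
  assumes "degree q \<le> k" "\<And>w. w \<in> V_I \<Longrightarrow> binary_form k q (homog_coords w) = 0" "q \<noteq> 0"
  obtains l r where "k = 12 + l" "degree r \<le> l" "q = I12_poly * r"
proof -
  have "coeff q k = 0"
    using assms(2)[of None] by (simp add: V_I_def homog_coords_def binary_form_at_infinity)
  then have "degree q < k"
    using assms(1,3) by (metis le_neq_implies_less leading_coeff_0_iff)
  have "poly q z = 0" if "poly I12_poly z = 0" for z
  proof -
    have "Some z \<in> V_I"
      using that by (simp add: V_I_iff I12_eq_binary_form homog_coords_def binary_form_affine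
        degree_I12_poly_le)
    from assms(2)[OF this] show ?thesis
      by (simp add: homog_coords_def binary_form_affine[OF assms(1)])
  qed
  then obtain r where r: "q = I12_poly * r"
    using rsquarefree_dvd_if_roots[OF rsquarefree_I12_poly] by (metis dvdE)
  then have "degree q = 11 + degree r"
    using assms(3) by (auto simp: degree_mult_eq degree_I12_poly)
  then show ?thesis
    using that[of "k - 12" r] r \<open>degree q < k\<close> by simp
qed

subsection \<open>The binary icosahedral group\<close>

definition mat_det :: "mat2 \<Rightarrow> complex" where
  "mat_det g = (case g of (a, b, c, d) \<Rightarrow> a * d - b * c)"

lemma SU2_det: "g \<in> SU2 \<Longrightarrow> mat_det g = 1"
  by (auto simp: SU2_def mat_det_def)

lemma SU2E:
  assumes "g \<in> SU2"
  obtains a c where "g = (a, - cnj c, c, cnj a)" "cnj a * a + cnj c * c = 1"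
proof -
  obtain a b c d where g: "g = (a, b, c, d)" by (cases g) auto
  then have norm: "(cmod a)^2 + (cmod c)^2 = 1" and orth: "cnj a * b + cnj c * d = 0"
    and det: "a * d - b * c = 1"
    using assms by (auto simp: SU2_def)
  from arg_cong[OF norm, of complex_of_real] have unit: "cnj a * a + cnj c * c = 1"
    by (simp only: of_real_add complex_norm_square mult.commute of_real_1)
  have "d = cnj a" "b = - cnj c"
    using unit orth det by algebra+
  then show thesis
    using that unit g by blast
qed

lemma SU2I:
  assumes "cnj a * a + cnj c * c = 1"
  shows "(a, - cnj c, c, cnj a) \<in> SU2"
proof -
  have "complex_of_real ((cmod a)^2 + (cmod c)^2) = 1"
    using assms by (simp only: of_real_add complex_norm_square mult.commute)
  then have "(cmod a)^2 + (cmod c)^2 = 1"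
    by (simp only: of_real_eq_1_iff)
  then show ?thesis
    using assms by (simp add: SU2_def algebra_simps)
qed

lemma mat_inv2_SU2:
  assumes "g \<in> SU2"
  shows "mat_inv2 g \<in> SU2"
proof -
  obtain a c where g: "g = (a, - cnj c, c, cnj a)" "cnj a * a + cnj c * c = 1"
    using assms by (rule SU2E)
  then have "(cnj a, - cnj (- c), - c, cnj (cnj a)) \<in> SU2"
    by (intro SU2I) (simp add: mult.commute)
  then show ?thesis
    by (simp add: g(1) mat_inv2_def)
qed

lemma
  assumes "g \<in> SU2"
  shows mat_act_mat_inv2: "mat_act g (mat_act (mat_inv2 g) p) = p"
    and mat_inv2_mat_act: "mat_act (mat_inv2 g) (mat_act g p) = p"
proof -
  obtain a b c d where g: "g = (a, b, c, d)" by (cases g) auto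
  have det: "a * d - b * c = 1"
    using SU2_det[OF assms] by (simp add: g mat_det_def)
  have "a * (d * x - b * y) + b * (a * y - c * x) = x" "c * (d * x - b * y) + d * (a * y - c * x) = y"
    "d * (a * x + b * y) - b * (c * x + d * y) = x"
    "a * (c * x + d * y) - c * (a * x + b * y) = y" for x y
    using det by algebra+
  then show "mat_act g (mat_act (mat_inv2 g) p) = p" "mat_act (mat_inv2 g) (mat_act g p) = p"
    by (simp_all add: g mat_inv2_def mat_act_def prod_eq_iff)
qed

lemma mat_act_S3:
  assumes "g \<in> SU2" "x \<in> S3"
  shows "mat_act g x \<in> S3"
proof -
  obtain a c where g: "g = (a, - cnj c, c, cnj a)" "cnj a * a + cnj c * c = 1"
    using assms(1) by (rule SU2E)
  have "complex_of_real ((cmod (fst (mat_act g x)))^2 + (cmod (snd (mat_act g x)))^2)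
     = (cnj a * a + cnj c * c) * (cnj (fst x) * fst x + cnj (snd x) * snd x)"
    unfolding of_real_add complex_norm_square by (simp add: g(1) mat_act_def algebra_simps)
  also have "\<dots> = 1"
    using g(2) S3_cnj[OF assms(2)] by simp
  finally show ?thesis
    unfolding S3_def by (simp only: of_real_eq_1_iff mem_Collect_eq)
qed

lemma mat_act_cscale: "mat_act g (cscale s p) = cscale s (mat_act g p)"
  by (cases g) (simp add: mat_act_def cscale_def algebra_simps)

lemma mat_act_add: "mat_act g (p + q) = mat_act g p + mat_act g q"
  by (cases g) (simp add: mat_act_def algebra_simps)

lemma mat_act_quat_j:
  assumes "g \<in> SU2"
  shows "mat_act g (quat_j p) = quat_j (mat_act g p)"
  using assms by (rule SU2E) (simp add: mat_act_def quat_j_def)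

lemma mat_act_homog_coords:
  assumes "mat_det g \<noteq> 0"
  obtains s where "s \<noteq> 0" "mat_act g (homog_coords w) = cscale s (homog_coords (mobius g w))"
proof -
  obtain a b c d where g: "g = (a, b, c, d)" by (cases g) auto
  have det: "a * d - b * c \<noteq> 0"
    using assms by (simp add: g mat_det_def)
  have image: "mat_act g (homog_coords w) = cscale s (homog_coords (mobius g w))"
    if "homog_coords w = (x, y)"
      "s = (if c * x + d * y = 0 then a * x + b * y else c * x + d * y)" for x y s
    using that by (auto simp: g mat_act_def homog_coords_def mobius_def cscale_def split: option.splits)
  obtain x y where xy: "homog_coords w = (x, y)" "(x, y) \<noteq> (0, 0)"
    by (cases w) (simp_all add: homog_coords_def)
  have "a * x + b * y \<noteq> 0" if "c * x + d * y = 0"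
  proof
    assume "a * x + b * y = 0"
    then have "(a * d - b * c) * x = 0" "(a * d - b * c) * y = 0"
      using that by algebra+
    then show False
      using det xy(2) by simp
  qed
  then show thesis
    using that[OF _ image[OF xy(1) refl]] by simp
qed

lemma homog_coords_inject: "s \<noteq> 0 \<Longrightarrow> homog_coords v = cscale s (homog_coords w) \<Longrightarrow> v = w"
  by (cases v; cases w) (auto simp: homog_coords_def cscale_def)

lemma mobius_mat_inv2:
  assumes "g \<in> SU2"
  shows "mobius g (mobius (mat_inv2 g) w) = w"
proof -
  let ?v = "mobius (mat_inv2 g) w"
  have det: "mat_det g \<noteq> 0" "mat_det (mat_inv2 g) \<noteq> 0"
    using assms mat_inv2_SU2 by (simp_all add: SU2_det)
  obtain s where s: "s \<noteq> 0" "mat_act (mat_inv2 g) (homog_coords w) = cscale s (homog_coords ?v)"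
    by (rule mat_act_homog_coords[OF det(2)])
  obtain t where t: "t \<noteq> 0" "mat_act g (homog_coords ?v) = cscale t (homog_coords (mobius g ?v))"
    by (rule mat_act_homog_coords[OF det(1)])
  have "homog_coords w = cscale s (cscale t (homog_coords (mobius g ?v)))"
    using mat_act_mat_inv2[OF assms, of "homog_coords w"] by (simp add: s(2) t(2) mat_act_cscale)
  then have "homog_coords w = cscale (s * t) (homog_coords (mobius g ?v))"
    by (simp add: cscale_def mult.assoc)
  then have "w = mobius g ?v"
    by (rule homog_coords_inject[rotated]) (simp add: s(1) t(1))
  then show ?thesis
    by (rule sym)
qed

lemma Istar_SU2: "g \<in> Istar \<Longrightarrow> g \<in> SU2"
  by (simp add: Istar_def)

lemma Istar_det: "g \<in> Istar \<Longrightarrow> mat_det g = 1"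
  using Istar_SU2 SU2_det by blast

lemma IstarI:
  assumes "g \<in> SU2" "\<And>p. I12 (mat_act g p) = I12 p"
  shows "g \<in> Istar"
proof -
  have iff: "mobius g w \<in> V_I \<longleftrightarrow> w \<in> V_I" for w
  proof -
    obtain s where s: "s \<noteq> 0" "mat_act g (homog_coords w) = cscale s (homog_coords (mobius g w))"
      using mat_act_homog_coords[of g] SU2_det[OF assms(1)] by auto
    have "I12 (homog_coords w) = s ^ 12 * I12 (homog_coords (mobius g w))"
      using assms(2)[of "homog_coords w"] unfolding s(2) I12_eq_binary_form binary_form_cscale by simp
    then show ?thesis using s(1) by (simp add: V_I_iff)
  qed
  have "w \<in> mobius g ` V_I" if "w \<in> V_I" for w
    using iff[of "mobius (mat_inv2 g) w"] mobius_mat_inv2[OF assms(1), of w] that by (metis imageI)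
  then have "mobius g ` V_I = V_I"
    using iff by auto
  then show ?thesis using assms(1) by (simp add: Istar_def)
qed

lemma I12_semi_invariant:
  assumes "g \<in> Istar"
  obtains \<kappa> where "\<And>p. I12 (mat_act g p) = \<kappa> * I12 p"
proof -
  define r where "r = act_form g 12 I12_poly"
  have r: "binary_form 12 r p = I12 (mat_act g p)" for p
    by (simp add: r_def binary_form_act_form I12_eq_binary_form)
  have vertices: "binary_form 12 r (homog_coords w) = 0" if "w \<in> V_I" for w
  proof -
    obtain s where s: "mat_act g (homog_coords w) = cscale s (homog_coords (mobius g w))"
      using mat_act_homog_coords[of g] Istar_det[OF assms] by auto
    have "mobius g w \<in> V_I"
      using assms that by (auto simp: Istar_def)
    then show ?thesis
      unfolding r s by (simp add: V_I_iff I12_eq_binary_form binary_form_cscale)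
  qed
  show thesis
  proof (cases "r = 0")
    case True
    then show ?thesis
      using that[of 0] r by (simp add: binary_form_0)
  next
    case False
    obtain l t where t: "12 = 12 + l" "degree t \<le> l" "r = I12_poly * t"
      by (rule I12_poly_factor[OF _ vertices False]) (simp_all add: r_def degree_act_form)
    then obtain \<kappa> where "t = [:\<kappa>:]"
      by (auto elim: degree_eq_zeroE)
    then have "r = smult \<kappa> I12_poly"
      using t by simp
    then show ?thesis
      using that[of \<kappa>] r by (simp add: binary_form_smult I12_eq_binary_form)
  qed
qed

subsection \<open>Invariance of the icosahedral forms\<close>

definition has_partials :: "(C2pt \<Rightarrow> complex) \<Rightarrow> (C2pt \<Rightarrow> complex) \<Rightarrow> (C2pt \<Rightarrow> complex) \<Rightarrow> bool" where
  "has_partials f f1 f2 \<longleftrightarrow> (\<forall>p. (f has_derivative (\<lambda>h. f1 p * fst h + f2 p * snd h)) (at p))"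

lemma has_partialsD:
  "has_partials f f1 f2 \<Longrightarrow> (f has_derivative (\<lambda>h. f1 p * fst h + f2 p * snd h)) (at p)"
  unfolding has_partials_def by blast

lemma has_partials_linear_comb:
  "has_partials f f1 f2 \<Longrightarrow> has_partials g g1 g2 \<Longrightarrow>
   has_partials (\<lambda>p. a * f p + c * g p) (\<lambda>p. a * f1 p + c * g1 p) (\<lambda>p. a * f2 p + c * g2 p)"
  unfolding has_partials_def
  by (auto simp: fun_eq_iff algebra_simps
      intro!: has_derivative_eq_rhs[OF
        has_derivative_add[OF has_derivative_mult_right has_derivative_mult_right]])

lemma
  fixes a b c d :: complex
  defines "g \<equiv> (a, b, c, d)"
  assumes f: "has_partials f f1 f2" and h: "has_partials h h1 h2"
    and eq: "\<And>p. f (mat_act g p) = \<kappa> * h p"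
  shows partial_fst_mat_act: "a * f1 (mat_act g p) + c * f2 (mat_act g p) = \<kappa> * h1 p"
    and partial_snd_mat_act: "b * f1 (mat_act g p) + d * f2 (mat_act g p) = \<kappa> * h2 p"
proof -
  let ?A = "mat_act g"
  have "(?A has_derivative ?A) (at p)"
    unfolding mat_act_def[abs_def] g_def by (auto intro!: derivative_eq_intros)
  then have "((\<lambda>p. f (?A p)) has_derivative
      (\<lambda>v. f1 (?A p) * fst (?A v) + f2 (?A p) * snd (?A v))) (at p)"
    by (rule has_derivative_compose[OF _ has_partialsD[OF f]])
  moreover have "((\<lambda>p. \<kappa> * h p) has_derivative (\<lambda>v. \<kappa> * (h1 p * fst v + h2 p * snd v))) (at p)"
    by (intro has_derivative_mult_right has_partialsD[OF h])
  ultimately have chain: "(\<lambda>v. f1 (?A p) * fst (?A v) + f2 (?A p) * snd (?A v))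
      = (\<lambda>v. \<kappa> * (h1 p * fst v + h2 p * snd v))"
    unfolding eq by (rule has_derivative_unique)
  show "a * f1 (?A p) + c * f2 (?A p) = \<kappa> * h1 p" "b * f1 (?A p) + d * f2 (?A p) = \<kappa> * h2 p"
    using fun_cong[OF chain, of "(1, 0)"] fun_cong[OF chain, of "(0, 1)"]
    by (simp_all add: g_def mat_act_def mult.commute)
qed

lemma hessian_covariant:
  assumes f: "has_partials f f1 f2" "has_partials f1 f11 f12" "has_partials f2 f12 f22"
    and semi: "\<And>p. f (mat_act g p) = \<kappa> * f p"
  shows "(mat_det g)\<^sup>2 * (f11 (mat_act g p) * f22 (mat_act g p) - (f12 (mat_act g p))\<^sup>2)
    = \<kappa>\<^sup>2 * (f11 p * f22 p - (f12 p)\<^sup>2)"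
proof -
  obtain a b c d where g: "g = (a, b, c, d)" by (cases g) auto
  let ?A = "mat_act (a, b, c, d)"
  note first = partial_fst_mat_act[OF f(1,1) semi[unfolded g]]
    partial_snd_mat_act[OF f(1,1) semi[unfolded g]]
  note fst_second = partial_fst_mat_act[OF has_partials_linear_comb[OF f(2,3)] f(2) first(1)]
    partial_snd_mat_act[OF has_partials_linear_comb[OF f(2,3)] f(2) first(1)]
  note snd_second = partial_snd_mat_act[OF has_partials_linear_comb[OF f(2,3)] f(3) first(2)]
  have "(a * d - b * c)\<^sup>2 * (f11 (?A p) * f22 (?A p) - (f12 (?A p))\<^sup>2)
     = (a * (a * f11 (?A p) + c * f12 (?A p)) + c * (a * f12 (?A p) + c * f22 (?A p)))
       * (b * (b * f11 (?A p) + d * f12 (?A p)) + d * (b * f12 (?A p) + d * f22 (?A p)))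
     - (b * (a * f11 (?A p) + c * f12 (?A p)) + d * (a * f12 (?A p) + c * f22 (?A p)))\<^sup>2"
    by algebra
  also have "\<dots> = \<kappa>\<^sup>2 * (f11 p * f22 p - (f12 p)\<^sup>2)"
    unfolding fst_second snd_second by algebra
  finally show ?thesis
    by (simp add: g mat_det_def)
qed

lemma jacobian_covariant:
  assumes f: "has_partials f f1 f2" and h: "has_partials h h1 h2"
    and semi: "\<And>p. f (mat_act g p) = \<kappa> * f p" "\<And>p. h (mat_act g p) = \<mu> * h p"
  shows "mat_det g * (f1 (mat_act g p) * h2 (mat_act g p) - f2 (mat_act g p) * h1 (mat_act g p))
    = \<kappa> * \<mu> * (f1 p * h2 p - f2 p * h1 p)"
proof -
  obtain a b c d where g: "g = (a, b, c, d)" by (cases g) auto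
  let ?A = "mat_act (a, b, c, d)"
  note partials = partial_fst_mat_act[OF f f semi(1)[unfolded g]]
    partial_snd_mat_act[OF f f semi(1)[unfolded g]]
    partial_fst_mat_act[OF h h semi(2)[unfolded g]] partial_snd_mat_act[OF h h semi(2)[unfolded g]]
  have "(a * d - b * c) * (f1 (?A p) * h2 (?A p) - f2 (?A p) * h1 (?A p))
    = (a * f1 (?A p) + c * f2 (?A p)) * (b * h1 (?A p) + d * h2 (?A p))
    - (b * f1 (?A p) + d * f2 (?A p)) * (a * h1 (?A p) + c * h2 (?A p))"
    by algebra
  also have "\<dots> = \<kappa> * \<mu> * (f1 p * h2 p - f2 p * h1 p)"
    unfolding partials by algebra
  finally show ?thesis
    by (simp add: g mat_det_def)
qed

definition I12_1 :: "C2pt \<Rightarrow> complex" where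
  "I12_1 p = 11 * fst p ^ 10 * snd p + 66 * fst p ^ 5 * snd p ^ 6 - snd p ^ 11"

definition I12_2 :: "C2pt \<Rightarrow> complex" where
  "I12_2 p = fst p ^ 11 + 66 * fst p ^ 6 * snd p ^ 5 - 11 * fst p * snd p ^ 10"

definition I12_11 :: "C2pt \<Rightarrow> complex" where
  "I12_11 p = 110 * fst p ^ 9 * snd p + 330 * fst p ^ 4 * snd p ^ 6"

definition I12_12 :: "C2pt \<Rightarrow> complex" where
  "I12_12 p = 11 * fst p ^ 10 + 396 * fst p ^ 5 * snd p ^ 5 - 11 * snd p ^ 10"

definition I12_22 :: "C2pt \<Rightarrow> complex" where
  "I12_22 p = 330 * fst p ^ 6 * snd p ^ 4 - 110 * fst p * snd p ^ 9"

definition I20_1 :: "C2pt \<Rightarrow> complex" where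
  "I20_1 p = 20 * fst p ^ 19 - 3420 * fst p ^ 14 * snd p ^ 5 + 4940 * fst p ^ 9 * snd p ^ 10
     + 1140 * fst p ^ 4 * snd p ^ 15"

definition I20_2 :: "C2pt \<Rightarrow> complex" where
  "I20_2 p = - 1140 * fst p ^ 15 * snd p ^ 4 + 4940 * fst p ^ 10 * snd p ^ 9
      + 3420 * fst p ^ 5 * snd p ^ 14
     + 20 * snd p ^ 19"

lemma
  shows I12_partials: "has_partials I12 I12_1 I12_2"
    and I12_1_partials: "has_partials I12_1 I12_11 I12_12"
    and I12_2_partials: "has_partials I12_2 I12_12 I12_22"
    and I20_partials: "has_partials I20 I20_1 I20_2"
  unfolding has_partials_def I12_def[abs_def] I20_def[abs_def] I12_1_def[abs_def] I12_2_def[abs_def]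
    I12_11_def I12_12_def I12_22_def I20_1_def I20_2_def Let_def
  by (auto intro!: derivative_eq_intros simp: fun_eq_iff algebra_simps)

lemma I20_eq_hessian: "I12_11 p * I12_22 p - (I12_12 p)\<^sup>2 = - 121 * I20 p"
  unfolding I12_11_def I12_22_def I12_12_def I20_def Let_def by algebra

lemma I30_eq_jacobian: "I12_1 p * I20_2 p - I12_2 p * I20_1 p = - 20 * I30 p"
  unfolding I12_1_def I12_2_def I20_1_def I20_2_def I30_def Let_def by algebra

lemma klein_syzygy: "I30 p ^ 2 - I20 p ^ 3 = 1728 * I12 p ^ 5"
proof -
  define x y where "x = fst p ^ 5" and "y = snd p ^ 5"
  have fifth: "a ^ 30 = (a ^ 5) ^ 6" "a ^ 25 = (a ^ 5) ^ 5" "a ^ 20 = (a ^ 5) ^ 4"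
    "a ^ 15 = (a ^ 5) ^ 3"
    "a ^ 10 = (a ^ 5) ^ 2" for a :: complex
    by (simp_all flip: power_mult)
  have "I12 p = fst p * snd p * (fst p ^ 10 + 11 * fst p ^ 5 * snd p ^ 5 - snd p ^ 10)"
    unfolding I12_def Let_def by algebra
  then have I12: "I12 p ^ 5 = x * y * (x ^ 2 + 11 * x * y - y ^ 2) ^ 5"
    unfolding x_def y_def by (simp only: power_mult_distrib fifth)
  have I20: "I20 p = x ^ 4 - 228 * x ^ 3 * y + 494 * x ^ 2 * y ^ 2 + 228 * x * y ^ 3 + y ^ 4"
    unfolding I20_def Let_def fifth x_def y_def ..
  have I30: "I30 p = x ^ 6 + 522 * x ^ 5 * y - 10005 * x ^ 4 * y ^ 2 - 10005 * x ^ 2 * y ^ 4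
      - 522 * x * y ^ 5 + y ^ 6"
    unfolding I30_def Let_def fifth x_def y_def ..
  show ?thesis unfolding I12 I20 I30 by algebra
qed

theorem
  assumes g: "g \<in> Istar"
  shows I12_invariant: "I12 (mat_act g p) = I12 p"
    and I20_invariant: "I20 (mat_act g p) = I20 p"
    and I30_invariant: "I30 (mat_act g p) = I30 p"
proof -
  obtain \<kappa> where I12: "\<And>p. I12 (mat_act g p) = \<kappa> * I12 p"
    using I12_semi_invariant[OF g] by blast
  have I20: "I20 (mat_act g p) = \<kappa> ^ 2 * I20 p" for p
    using hessian_covariant[OF I12_partials I12_1_partials I12_2_partials I12, of p]
    by (simp add: I20_eq_hessian Istar_det[OF g])
  have I30: "I30 (mat_act g p) = \<kappa> ^ 3 * I30 p" for p
    using jacobian_covariant[OF I12_partials I20_partials I12 I20, of p]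
    by (simp add: I30_eq_jacobian Istar_det[OF g] power3_eq_cube power2_eq_square mult.assoc)
  let ?o = "(1, 1) :: C2pt"
  have o: "I12 ?o = 11"
    by (simp add: I12_def)
  have "1728 * (\<kappa> * I12 ?o) ^ 5 = (\<kappa> ^ 3 * I30 ?o) ^ 2 - (\<kappa> ^ 2 * I20 ?o) ^ 3"
    using klein_syzygy[of "mat_act g ?o"] unfolding I12 I20 I30 by simp
  also have "\<dots> = \<kappa> ^ 6 * (1728 * I12 ?o ^ 5)"
    unfolding klein_syzygy[symmetric] by algebra
  finally have "\<kappa> ^ 5 = \<kappa> ^ 6"
    unfolding o by (simp add: power_mult_distrib)
  moreover have "\<kappa> \<noteq> 0"
    using I12[of "mat_act (mat_inv2 g) ?o"] mat_act_mat_inv2[OF Istar_SU2[OF g]] o by auto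
  ultimately have "\<kappa> = 1"
    by (simp add: numeral_eq_Suc)
  then show "I12 (mat_act g p) = I12 p" "I20 (mat_act g p) = I20 p" "I30 (mat_act g p) = I30 p"
    using I12 I20 I30 by simp_all
qed

subsection \<open>Elements of the binary icosahedral group\<close>

lemma cnj_root_of_unity:
  fixes z :: complex
  assumes "z ^ n = 1" "n > 0"
  shows "cnj z * z = 1"
proof -
  have "cmod z ^ n = 1"
    using assms(1) by (metis norm_one norm_power)
  then have "cmod z = 1"
    using assms(2) power_eq_1_iff[of "cmod z" n] by simp
  then show ?thesis
    by (simp add: mult.commute[of "cnj _"] complex_norm_square[symmetric])
qed

lemma diagonal_in_Istar:
  assumes "z ^ 10 = 1"
  shows "(z, 0, 0, cnj z) \<in> Istar"
proof (rule IstarI)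
  have unit: "cnj z * z = 1"
    by (rule cnj_root_of_unity[OF assms]) simp
  then show "(z, 0, 0, cnj z) \<in> SU2"
    using SU2I[of z 0] by simp
  have cnj_power: "cnj z ^ 10 = 1"
    using arg_cong[OF assms, of cnj] by simp
  have monomials: "(z * x) ^ 11 * (cnj z * y) = z ^ 10 * (cnj z * z) * (x ^ 11 * y)"
     "(z * x) ^ 6 * (cnj z * y) ^ 6 = (cnj z * z) ^ 6 * (x ^ 6 * y ^ 6)"
     "(z * x) * (cnj z * y) ^ 11 = cnj z ^ 10 * (cnj z * z) * (x * y ^ 11)" for x y
    by (simp_all add: power_mult_distrib numeral_eq_Suc mult_ac)
  have "I12 (z * x, cnj z * y) = I12 (x, y)" for x y
    unfolding I12_def Let_def fst_conv snd_conv
    by (simp only: mult.assoc[of 11] monomials unit assms cnj_power mult_1_left mult_1_right power_one)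
  then show "I12 (mat_act (z, 0, 0, cnj z) p) = I12 p" for p
    by (cases p) (simp add: mat_act_def)
qed

lemma flip_in_Istar: "(0, - 1, 1, 0) \<in> Istar"
  by (rule IstarI) (simp_all add: SU2_def I12_def mat_act_def Let_def algebra_simps)

definition golden :: complex where
  "golden = of_real ((1 + sqrt 5) / 2)"

definition golden_scale :: complex where
  "golden_scale = of_real (1 / sqrt (1 + ((1 + sqrt 5) / 2)\<^sup>2))"

definition golden_rotation :: mat2 where
  "golden_rotation =
     (- \<i> * golden * golden_scale, \<i> * golden_scale, \<i> * golden_scale, \<i> * golden * golden_scale)"

lemma golden_square: "golden ^ 2 = golden + 1"
proof -
  have "((1 + sqrt 5) / 2)\<^sup>2 = (1 + sqrt 5) / 2 + 1"
    by (simp add: power2_eq_square field_simps)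
  from arg_cong[OF this, of complex_of_real] show ?thesis
    by (simp only: golden_def of_real_power of_real_add of_real_1)
qed

lemma golden_scale_square: "golden_scale ^ 2 * (1 + golden ^ 2) = 1"
proof -
  have "1 + ((1 + sqrt 5) / 2)\<^sup>2 > 0"
    by (simp add: add_pos_nonneg)
  then have "(1 / sqrt (1 + ((1 + sqrt 5) / 2)\<^sup>2))\<^sup>2 * (1 + ((1 + sqrt 5) / 2)\<^sup>2) = 1"
    by (simp add: power_divide)
  from arg_cong[OF this, of complex_of_real] show ?thesis
    by (simp only: golden_def golden_scale_def of_real_power of_real_add of_real_1 of_real_mult)
qed

lemma golden_nonzero: "golden \<noteq> 0" "golden_scale \<noteq> 0"
  using golden_square golden_scale_square by auto

lemma golden_rotation_SU2: "golden_rotation \<in> SU2"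
proof -
  have cnj: "cnj golden = golden" "cnj golden_scale = golden_scale"
    by (simp_all add: golden_def golden_scale_def)
  have "cnj (- \<i> * golden * golden_scale) * (- \<i> * golden * golden_scale)
      + cnj (\<i> * golden_scale) * (\<i> * golden_scale)
      = - (\<i> * \<i>) * (golden_scale ^ 2 * (1 + golden ^ 2))"
    unfolding complex_cnj_mult complex_cnj_minus complex_cnj_i cnj by algebra
  also have "\<dots> = 1"
    by (simp add: golden_scale_square)
  finally show ?thesis
    using SU2I[of "- \<i> * golden * golden_scale" "\<i> * golden_scale"]
    by (simp add: golden_rotation_def cnj)
qed

lemma mat_act_golden_rotation:
  "mat_act golden_rotation (x, y) = cscale (\<i> * golden_scale) (- golden * x + y, x + golden * y)"
  by (simp add: golden_rotation_def mat_act_def cscale_def algebra_simps)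

text \<open>Over \<open>\<rat>(\<surd>5)\<close>, which contains \<open>golden\<close>, the form \<open>I12\<close> splits into six quadratic factors,
  which \<open>golden_rotation\<close> permutes up to scalars.\<close>

lemma I12_factorization:
  "I12 (x, y) = (x * y) * (x^2 + x*y - y^2)
     * ((x^2 + x*y + golden^2*y^2) * (x^2 + x*y + (2 - golden)*y^2))
     * ((x^2 - golden^2*x*y + golden^2*y^2) * (x^2 - (2 - golden)*x*y + (2 - golden)*y^2))"
proof -
  have "(x^2 + x*y + golden^2*y^2) * (x^2 + x*y + (2 - golden)*y^2)
      = x^4 + 2*x^3*y + 4*x^2*y^2 + 3*x*y^3 + y^4"
    using golden_square by algebra
  moreover have "(x^2 - golden^2*x*y + golden^2*y^2) * (x^2 - (2 - golden)*x*y + (2 - golden)*y^2)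
     = x^4 - 3*x^3*y + 4*x^2*y^2 - 2*x*y^3 + y^4"
    using golden_square by algebra
  moreover have "I12 (x, y) = (x * y) * (x^2 + x*y - y^2) * (x^4 + 2*x^3*y + 4*x^2*y^2 + 3*x*y^3 + y^4)
     * (x^4 - 3*x^3*y + 4*x^2*y^2 - 2*x*y^3 + y^4)"
    unfolding I12_def Let_def fst_conv snd_conv by algebra
  ultimately show ?thesis by (simp only:)
qed

lemma I12_golden_rotation: "I12 (- golden * x + y, x + golden * y) = (1 + golden^2)^6 * I12 (x, y)"
proof -
  let ?X = "- golden * x + y" and ?Y = "x + golden * y"
  have permuted:
    "?X^2 + ?X*?Y - ?Y^2 = - 5 * golden * (x * y)"
    "?X^2 + ?X*?Y + golden^2*?Y^2 = (2 + golden) * (x^2 + x*y + golden^2*y^2)"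
    "?X^2 + ?X*?Y + (2 - golden)*?Y^2 = (3 - golden) * (x^2 - golden^2*x*y + golden^2*y^2)"
    "?X^2 - golden^2*?X*?Y + golden^2*?Y^2 = (3 + 4 * golden) * (x^2 + x*y + (2 - golden)*y^2)"
    "?X^2 - (2 - golden)*?X*?Y + (2 - golden)*?Y^2
        = (2 + golden) * (x^2 - (2 - golden)*x*y + (2 - golden)*y^2)"
    using golden_square by algebra+
  have product: "?X * ?Y = - golden * (x^2 + x*y - y^2)"
    using golden_square by algebra
  have scalars: "(5 * golden^2) * (2 + golden)^2 * ((3 - golden) * (3 + 4 * golden)) = (1 + golden^2)^6"
    using golden_square by algebra
  have "I12 (?X, ?Y) = (5 * golden^2) * (2 + golden)^2 * ((3 - golden) * (3 + 4 * golden)) * I12 (x, y)"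
    unfolding I12_factorization[of ?X ?Y] permuted unfolding product I12_factorization[of x y]
    by (simp only: power2_eq_square mult_ac minus_mult_minus mult_minus_left mult_minus_right
      minus_minus)
  then show ?thesis
    unfolding scalars .
qed

lemma golden_rotation_in_Istar: "golden_rotation \<in> Istar"
proof (rule IstarI[OF golden_rotation_SU2])
  fix p :: C2pt
  obtain x y where p: "p = (x, y)" by (cases p)
  have "I12 (mat_act golden_rotation p)
      = (\<i> * golden_scale)^12 * I12 (- golden * x + y, x + golden * y)"
    unfolding p mat_act_golden_rotation I12_eq_binary_form binary_form_cscale ..
  also have "\<dots> = (golden_scale ^ 2 * (1 + golden ^ 2))^6 * I12 (x, y)"
    unfolding I12_golden_rotation by (simp add: power_mult_distrib i_even_power flip: power_mult)
  finally show "I12 (mat_act golden_rotation p) = I12 p"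
    by (simp add: golden_scale_square p)
qed

subsection \<open>Klein's theorem on icosahedral invariants\<close>

definition invariant_form :: "nat \<Rightarrow> complex poly \<Rightarrow> bool" where
  "invariant_form k q \<longleftrightarrow>
     degree q \<le> k \<and> (\<forall>g\<in>Istar. \<forall>p. binary_form k q (mat_act g p) = binary_form k q p)"

lemma
  assumes "invariant_form k q"
  shows invariant_form_degree: "degree q \<le> k"
    and invariant_form_mat_act: "g \<in> Istar \<Longrightarrow> binary_form k q (mat_act g p) = binary_form k q p"
  using assms unfolding invariant_form_def by blast+

lemma invariant_form_eq_0_iff:
  assumes "invariant_form k q" "g \<in> Istar" "mat_act g p = cscale s p'" "s \<noteq> 0"
  shows "binary_form k q p' = 0 \<longleftrightarrow> binary_form k q p = 0"
  using invariant_form_mat_act[OF assms(1,2), of p] assms(3,4) by (auto simp: binary_form_cscale)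

lemma invariant_form_flip:
  assumes "invariant_form k q"
  shows "binary_form k q (- y, x) = binary_form k q (x, y)"
  using invariant_form_mat_act[OF assms flip_in_Istar, of "(x, y)"] by (simp add: mat_act_def)

lemma invariant_form_zero_orbit:
  assumes q: "invariant_form k q" and zero: "coeff q k = 0" and z: "z ^ 5 = - (golden ^ 5)"
  shows "binary_form k q (z, 1) = 0"
proof -
  define \<omega> where "\<omega> = z / - golden"
  define \<zeta> where "\<zeta> = \<omega> ^ 3"
  have "\<omega> ^ 5 = 1"
    using z golden_nonzero by (simp add: \<omega>_def power_divide)
  moreover have "\<zeta> ^ 10 = (\<omega> ^ 5) ^ 6" "\<zeta> ^ 2 = \<omega> ^ 5 * \<omega>"
    by (simp_all add: \<zeta>_def numeral_eq_Suc)
  ultimately have \<zeta>: "\<zeta> ^ 10 = 1" "\<zeta> ^ 2 = \<omega>"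
    by simp_all
  have unit: "cnj \<zeta> * \<zeta> = 1"
    by (rule cnj_root_of_unity[OF \<zeta>(1)]) simp
  have "cnj \<zeta> * z = cnj \<zeta> * (\<zeta> ^ 2 * - golden)"
    using golden_nonzero by (simp add: \<zeta>(2) \<omega>_def)
  also have "\<dots> = (cnj \<zeta> * \<zeta>) * (\<zeta> * - golden)"
    by (simp add: power2_eq_square)
  also have "\<dots> = \<zeta> * - golden"
    by (simp add: unit)
  finally have "mat_act (\<zeta>, 0, 0, cnj \<zeta>) (- golden, 1) = cscale (cnj \<zeta>) (z, 1)"
    by (simp add: mat_act_def cscale_def)
  moreover have "cnj \<zeta> \<noteq> 0"
    using unit by auto
  moreover have "binary_form k q (- golden, 1) = 0"
    using invariant_form_eq_0_iff[OF q golden_rotation_in_Istar mat_act_golden_rotation[of 1 0]]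
      golden_nonzero zero by (simp add: binary_form_at_infinity)
  ultimately show ?thesis
    using invariant_form_eq_0_iff[OF q diagonal_in_Istar[OF \<zeta>(1)]] by blast
qed

lemma vertex_equation_cases:
  assumes "z ^ 10 + 11 * z ^ 5 - 1 = 0"
  obtains "z ^ 5 = - (golden ^ 5)" | "z \<noteq> 0" "(- 1 / z) ^ 5 = - (golden ^ 5)"
proof -
  have "z \<noteq> 0"
    using assms by auto
  have "golden ^ 10 = 11 * golden ^ 5 + 1"
    using golden_square by algebra
  then have "(z ^ 5 + golden ^ 5) * (golden ^ 5 * z ^ 5 - 1) = golden ^ 5 * (z ^ 10 + 11 * z ^ 5 - 1)"
    by algebra
  then consider "z ^ 5 + golden ^ 5 = 0" | "golden ^ 5 * z ^ 5 = 1"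
    using assms by auto
  then show thesis
  proof cases
    case 1
    then show ?thesis
      using that(1) by (simp add: eq_neg_iff_add_eq_0)
  next
    case 2
    then have "golden ^ 5 = 1 / z ^ 5"
      using \<open>z \<noteq> 0\<close> by (simp add: field_simps)
    then show ?thesis
      using that(2) \<open>z \<noteq> 0\<close> by (simp add: power_divide)
  qed
qed

lemma invariant_form_zero_at_vertices:
  assumes q: "invariant_form k q" and zero: "coeff q k = 0" and "w \<in> V_I"
  shows "binary_form k q (homog_coords w) = 0"
proof (cases w)
  case None
  then show ?thesis
    using zero by (simp add: homog_coords_def binary_form_at_infinity)
next
  case (Some z)
  then consider "z = 0" | "z ^ 10 + 11 * z ^ 5 - 1 = 0"
    using assms(3) by (auto simp: V_I_def)
  then have "binary_form k q (z, 1) = 0"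
  proof cases
    case 1
    then show ?thesis
      using zero invariant_form_flip[OF q, of 0 1] by (simp add: binary_form_at_infinity)
  next
    case 2
    then show ?thesis
    proof (cases rule: vertex_equation_cases)
      case 1
      then show ?thesis
        by (rule invariant_form_zero_orbit[OF q zero])
    next
      case 2
      have "binary_form k q (- 1, z) = z ^ k * binary_form k q (- 1 / z, 1)"
        using binary_form_cscale[of k q z "(- 1 / z, 1)"] 2(1) by (simp add: cscale_def)
      then show ?thesis
        using invariant_form_flip[OF q, of 1 z] invariant_form_zero_orbit[OF q zero 2(2)] by simp
    qed
  qed
  then show ?thesis
    using Some by (simp add: homog_coords_def)
qed

lemma invariant_form_coeff:
  assumes q: "invariant_form k q" and "coeff q i \<noteq> 0"
  shows "10 dvd i + 9 * (k - i)"
proof -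
  have "i \<le> k"
    using invariant_form_degree[OF q] assms(2) by (meson le_degree le_trans)
  define \<zeta> where "\<zeta> = exp (2 * of_real pi * \<i> * of_nat 1 / of_nat 10)"
  have "\<zeta> ^ n = exp (2 * of_real pi * \<i> * of_nat n / of_nat 10)" for n
    unfolding \<zeta>_def by (simp add: mult_ac flip: exp_of_nat_mult)
  then have root: "\<zeta> ^ n = 1 \<longleftrightarrow> 10 dvd n" for n
    using complex_root_unity_eq_1[of 10 n] by simp
  then have "\<zeta> ^ 10 = 1"
    by simp
  then have "cnj \<zeta> * \<zeta> = \<zeta> ^ 9 * \<zeta>"
    using cnj_root_of_unity[of \<zeta> 10] by (simp add: numeral_eq_Suc mult_ac)
  then have cnj: "cnj \<zeta> = \<zeta> ^ 9"
    using \<open>\<zeta> ^ 10 = 1\<close> by auto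
  define r where "r = (\<Sum>l\<le>k. monom (coeff q l * (\<zeta> ^ l * (\<zeta> ^ 9) ^ (k - l))) l)"
  have "r = q"
  proof (rule binary_form_eqD)
    show "degree r \<le> k"
      unfolding r_def by (intro degree_sum_le) (auto intro: order_trans[OF degree_monom_le])
    show "degree q \<le> k"
      by (rule invariant_form_degree[OF q])
    fix p
    have "binary_form k r p = binary_form k q (mat_act (\<zeta>, 0, 0, cnj \<zeta>) p)"
      by (simp add: r_def binary_form_sum binary_form_monom)
        (simp add: binary_form_def mat_act_def cnj power_mult_distrib mult_ac)
    then show "binary_form k r p = binary_form k q p"
      using invariant_form_mat_act[OF q diagonal_in_Istar[OF \<open>\<zeta> ^ 10 = 1\<close>]] by simp
  qed
  moreover have "coeff r i = coeff q i * (\<zeta> ^ l * (\<zeta> ^ 9) ^ (k - l))" if "l = i" for l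
    using \<open>i \<le> k\<close> that by (simp add: r_def coeff_sum)
  ultimately have "\<zeta> ^ i * (\<zeta> ^ 9) ^ (k - i) = 1"
    using assms(2) by (metis mult_cancel_left1)
  then show ?thesis
    by (simp flip: power_mult power_add add: root)
qed

lemma odd_invariant_form_eq_0:
  assumes "invariant_form k q" "odd k"
  shows "q = 0"
proof (rule poly_eqI, rule ccontr)
  fix i assume "coeff q i \<noteq> coeff 0 i"
  then have nonzero: "coeff q i \<noteq> 0"
    by simp
  then have "i \<le> k"
    using invariant_form_degree[OF assms(1)] by (meson le_degree le_trans)
  then obtain l where "k = i + l"
    using le_Suc_ex by blast
  moreover have "even (i + 9 * (k - i))"
    using invariant_form_coeff[OF assms(1) nonzero] by (rule dvd_trans[rotated]) simp
  ultimately show False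
    using assms(2) by simp
qed

lemma invariant_form_10_top_coeff:
  assumes q: "invariant_form 10 q"
  shows "coeff q 10 = 0"
proof -
  have coeff_eq_0: "coeff q i = 0" if "i \<le> 10" "i \<notin> {0, 5, 10}" for i
  proof (rule ccontr)
    assume "coeff q i \<noteq> 0"
    from invariant_form_coeff[OF q this] that show False
      by simp presburger
  qed
  have form: "binary_form 10 q (x, y)
      = coeff q 0 * y ^ 10 + coeff q 5 * (x ^ 5 * y ^ 5) + coeff q 10 * x ^ 10" for x y
  proof -
    have "binary_form 10 q (x, y) = (\<Sum>i\<in>{0, 5, 10}. coeff q i * (x ^ i * y ^ (10 - i)))"
      unfolding binary_form_def fst_conv snd_conv
      by (rule sum.mono_neutral_right) (auto simp: coeff_eq_0)
    then show ?thesis by simp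
  qed
  have coeffs: "coeff q 5 = 0" "coeff q 0 = coeff q 10"
    using invariant_form_flip[OF q, of 1 1] invariant_form_flip[OF q, of 0 1] by (simp_all add: form)
  define t where "t = (\<i> * golden_scale) ^ 10"
  have "t * (1 + golden ^ 2) ^ 5 = (\<i> ^ 2 * (golden_scale ^ 2 * (1 + golden ^ 2))) ^ 5"
    unfolding t_def by (simp only: power_mult_distrib mult.assoc flip: power_mult) simp
  also have "\<dots> = - 1"
    by (simp add: golden_scale_square)
  also have "(1 + golden ^ 2) ^ 5 = 5 * (1 + golden ^ 10)"
    using golden_square by algebra
  finally have scale: "t * (5 * (1 + golden ^ 10)) = - 1" .
  have "t * binary_form 10 q (- golden, 1) = coeff q 10"
    using invariant_form_mat_act[OF q golden_rotation_in_Istar, of "(1, 0)"]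
      mat_act_golden_rotation[of 1 0]
    by (simp add: t_def binary_form_cscale binary_form_at_infinity)
  then have "t * (coeff q 10 * (1 + golden ^ 10)) = coeff q 10"
    by (simp add: form coeffs algebra_simps)
  then have "t * (5 * (1 + golden ^ 10)) * coeff q 10 = 5 * coeff q 10"
    by (metis mult.assoc mult.commute mult.left_commute)
  then show ?thesis
    unfolding scale by simp
qed

lemma invariant_form_degree_cases:
  assumes q: "invariant_form k q" and "coeff q k \<noteq> 0"
  obtains b c where "k = 20 * b + 30 * c" "c \<le> 1"
proof -
  have "10 dvd k"
    using invariant_form_coeff[OF assms] by simp
  then obtain n where n: "k = 10 * n" by blast
  have "n \<noteq> 1"
    using invariant_form_10_top_coeff q assms(2) n by auto
  show thesis
  proof (cases "even n")
    case True
    then show ?thesis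
      using that[of "n div 2" 0] n by simp
  next
    case False
    then obtain m where "n = 2 * m + 1"
      by (rule oddE)
    then have "k = 20 * (m - 1) + 30 * 1"
      using n \<open>n \<noteq> 1\<close> by simp
    then show ?thesis
      using that by blast
  qed
qed

interpretation poly_space: vector_space "smult :: 'a::field \<Rightarrow> 'a poly \<Rightarrow> 'a poly"
  by unfold_locales (simp_all add: smult_add_right smult_add_left)

definition icosahedral_monomial :: "nat \<Rightarrow> nat \<Rightarrow> nat \<Rightarrow> complex poly" where
  "icosahedral_monomial a b c = I12_poly ^ a * I20_poly ^ b * I30_poly ^ c"

definition icosahedral_monomials :: "nat \<Rightarrow> complex poly set" where
  "icosahedral_monomials k = {icosahedral_monomial a b c |a b c. 12 * a + 20 * b + 30 * c = k \<and> c \<le> 1}"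

lemma icosahedral_monomialsI:
  "12 * a + 20 * b + 30 * c = k \<Longrightarrow> c \<le> 1 \<Longrightarrow> icosahedral_monomial a b c \<in> icosahedral_monomials k"
  unfolding icosahedral_monomials_def by blast

lemma
  assumes "12 * a + 20 * b + 30 * c = k"
  shows degree_icosahedral_monomial: "degree (icosahedral_monomial a b c) \<le> k"
    and binary_form_icosahedral_monomial:
      "binary_form k (icosahedral_monomial a b c) p = I12 p ^ a * I20 p ^ b * I30 p ^ c"
proof -
  note degrees = degree_power_le_mult[OF degree_I12_poly_le, of a]
    degree_power_le_mult[OF degree_I20_poly, of b]
    degree_power_le_mult[OF degree_I30_poly, of c]
  have degree_12_20: "degree (I12_poly ^ a * I20_poly ^ b) \<le> 12 * a + 20 * b"
    using degree_mult_le[of "I12_poly ^ a" "I20_poly ^ b"] degrees by linarith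
  then show "degree (icosahedral_monomial a b c) \<le> k"
    unfolding icosahedral_monomial_def assms[symmetric]
    using degree_mult_le[of "I12_poly ^ a * I20_poly ^ b" "I30_poly ^ c"] degrees by linarith
  show "binary_form k (icosahedral_monomial a b c) p = I12 p ^ a * I20 p ^ b * I30 p ^ c"
    unfolding icosahedral_monomial_def assms[symmetric]
    by (simp only: binary_form_mult[OF degree_12_20 degrees(3)] binary_form_mult[OF degrees(1,2)]
        binary_form_power[OF degree_I12_poly_le] binary_form_power[OF degree_I20_poly]
        binary_form_power[OF degree_I30_poly] I12_eq_binary_form I20_eq_binary_form I30_eq_binary_form)
qed

lemma invariant_form_icosahedral_monomial:
  "12 * a + 20 * b + 30 * c = k \<Longrightarrow> invariant_form k (icosahedral_monomial a b c)"
  by (simp add: invariant_form_def degree_icosahedral_monomial binary_form_icosahedral_monomial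
      I12_invariant I20_invariant I30_invariant)

lemma subspace_invariant_form: "poly_space.subspace {q. invariant_form k q}"
  by (auto simp: poly_space.subspace_def invariant_form_def binary_form_0 binary_form_add
    binary_form_smult
      intro: degree_add_le order_trans[OF degree_smult_le])

lemma invariant_form_I12_poly_mult:
  assumes q: "invariant_form (12 + l) (I12_poly * r)" and r: "degree r \<le> l"
  shows "invariant_form l r"
  unfolding invariant_form_def
proof (intro conjI ballI allI)
  fix g p assume g: "g \<in> Istar"
  have mult: "binary_form (12 + l) (I12_poly * s) p = I12 p * binary_form l s p"
    if "degree s \<le> l" for s p
    using binary_form_mult[OF degree_I12_poly_le that] by (simp add: I12_eq_binary_form)
  have "I12_poly * act_form g l r = I12_poly * r"
  proof (rule binary_form_eqD)
    fix p
    have "binary_form (12 + l) (I12_poly * act_form g l r) p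
        = I12 (mat_act g p) * binary_form l r (mat_act g p)"
      by (simp add: mult degree_act_form binary_form_act_form I12_invariant[OF g])
    then show "binary_form (12 + l) (I12_poly * act_form g l r) p
        = binary_form (12 + l) (I12_poly * r) p"
      using invariant_form_mat_act[OF q g] by (simp add: mult[OF r])
  next
    show "degree (I12_poly * act_form g l r) \<le> 12 + l"
      using degree_mult_le[of I12_poly "act_form g l r"] degree_act_form[of g l r] degree_I12_poly_le
      by linarith
  qed (rule invariant_form_degree[OF q])
  then have "act_form g l r = r"
    by (simp add: I12_poly_nonzero)
  then show "binary_form l r (mat_act g p) = binary_form l r p"
    by (metis binary_form_act_form)
qed (rule r)

lemma I12_poly_mult_span:
  assumes "r \<in> poly_space.span (icosahedral_monomials l)"
  shows "I12_poly * r \<in> poly_space.span (icosahedral_monomials (12 + l))"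
  using assms
proof (induction rule: poly_space.span_induct)
  case (step r)
  then obtain a b c where abc: "r = icosahedral_monomial a b c" "12 * a + 20 * b + 30 * c = l" "c \<le> 1"
    by (auto simp: icosahedral_monomials_def)
  then have "I12_poly * r = icosahedral_monomial (Suc a) b c"
    by (simp add: icosahedral_monomial_def mult.assoc)
  then have "I12_poly * r \<in> icosahedral_monomials (12 + l)"
    using abc(2,3) icosahedral_monomialsI[of "Suc a" b c "12 + l"] by simp
  then show ?case
    by (rule poly_space.span_base)
next
  case base
  show ?case
    by (auto simp: poly_space.subspace_def distrib_left
      intro: poly_space.span_zero poly_space.span_add poly_space.span_scale)
qed

lemma invariant_form_vanishing_at_infinity_factor:
  assumes q: "invariant_form k q" and "coeff q k = 0" "q \<noteq> 0"
  obtains l r where "k = 12 + l" "invariant_form l r" "q = I12_poly * r"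
proof -
  obtain l r where r: "k = 12 + l" "degree r \<le> l" "q = I12_poly * r"
    using I12_poly_factor[OF invariant_form_degree[OF q]
      invariant_form_zero_at_vertices[OF q assms(2)] assms(3)] .
  then have "invariant_form l r"
    using invariant_form_I12_poly_mult q by blast
  then show thesis
    using that r by blast
qed

lemma icosahedral_monomial_not_vanishing_at_infinity:
  assumes "invariant_form k q" "coeff q k \<noteq> 0"
  obtains m where "m \<in> icosahedral_monomials k" "coeff m k = 1"
proof -
  obtain b c where bc: "k = 20 * b + 30 * c" "c \<le> 1"
    using invariant_form_degree_cases[OF assms] by blast
  have "coeff (icosahedral_monomial 0 b c) k = binary_form k (icosahedral_monomial 0 b c) (1, 0)"
    by (simp add: binary_form_at_infinity)
  also have "\<dots> = 1"
    using bc by (subst binary_form_icosahedral_monomial) (simp_all add: I20_def I30_def)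
  finally show thesis
    using that[OF icosahedral_monomialsI[of 0 b c]] bc by simp
qed

theorem klein_icosahedral_invariants:
  "invariant_form k q \<longleftrightarrow> q \<in> poly_space.span (icosahedral_monomials k)"
proof
  have monomials: "icosahedral_monomials k \<subseteq> {q. invariant_form k q}" for k
    by (auto simp: icosahedral_monomials_def invariant_form_icosahedral_monomial)
  show "invariant_form k q" if "q \<in> poly_space.span (icosahedral_monomials k)"
    using poly_space.span_minimal[OF monomials subspace_invariant_form] that by blast
  assume "invariant_form k q"
  then show "q \<in> poly_space.span (icosahedral_monomials k)"
  proof (induction k arbitrary: q rule: less_induct)
    case (less k)
    have vanishing: "r \<in> poly_space.span (icosahedral_monomials k)"
      if "invariant_form k r" "coeff r k = 0" for r
    proof (cases "r = 0")
      case False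
      then obtain l s where "k = 12 + l" "invariant_form l s" "r = I12_poly * s"
        using invariant_form_vanishing_at_infinity_factor[OF \<open>invariant_form k r\<close> \<open>coeff r k = 0\<close>]
        by blast
      then show ?thesis
        using I12_poly_mult_span less.IH[of l s] by simp
    qed (simp add: poly_space.span_zero)
    show ?case
    proof (cases "coeff q k = 0")
      case False
      then obtain m where m: "m \<in> icosahedral_monomials k" "coeff m k = 1"
        using icosahedral_monomial_not_vanishing_at_infinity[OF less.prems] by blast
      have "invariant_form k (q - smult (coeff q k) m)"
        using poly_space.subspace_diff[OF subspace_invariant_form]
          poly_space.subspace_scale[OF subspace_invariant_form] less.prems m(1) monomials by blast
      moreover have "coeff (q - smult (coeff q k) m) k = 0"
        by (simp add: m(2))
      ultimately have "q - smult (coeff q k) m \<in> poly_space.span (icosahedral_monomials k)"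
        by (rule vanishing)
      from poly_space.span_add[OF this
          poly_space.span_scale[OF poly_space.span_base[OF m(1)], of "coeff q k"]]
      show ?thesis
        by simp
    qed (rule vanishing[OF less.prems])
  qed
qed

subsection \<open>Siblings of binary forms\<close>

definition line_form :: "nat \<Rightarrow> complex poly \<Rightarrow> C2pt \<Rightarrow> complex poly" where
  "line_form k q p = (\<Sum>a\<le>k. smult (coeff q a) (line_monom a (k - a) p))"

definition form_sibling :: "nat \<Rightarrow> complex poly \<Rightarrow> nat \<Rightarrow> C2pt \<Rightarrow> complex" where
  "form_sibling k q j p = coeff (line_form k q p) j"

lemma form_sibling_eq_sum: "form_sibling k q j p = (\<Sum>a\<le>k. coeff q a * monom_sibling a (k - a) j p)"
  by (simp add: form_sibling_def line_form_def monom_sibling_def coeff_sum)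

lemma poly_line_form: "poly (line_form k q p) t = binary_form k q (p + cscale t (quat_j p))"
  by (simp add: line_form_def line_monom_def line_fst_def line_snd_def poly_sum poly_mult poly_power
      binary_form_def cscale_def)

lemma form_sibling_0: "form_sibling k q 0 p = binary_form k q p"
  by (simp add: form_sibling_eq_sum monom_sibling_0 binary_form_def)

lemma form_sibling_diff: "form_sibling k (q - r) j p = form_sibling k q j p - form_sibling k r j p"
  by (simp add: form_sibling_eq_sum algebra_simps sum_subtractf)

lemma form_sibling_smult: "form_sibling k (smult c q) j p = c * form_sibling k q j p"
  by (simp add: form_sibling_eq_sum sum_distrib_left mult.assoc)

lemma form_sibling_sum: "form_sibling k (\<Sum>i\<in>A. q i) j p = (\<Sum>i\<in>A. form_sibling k (q i) j p)"
  unfolding form_sibling_eq_sum coeff_sum sum_distrib_right by (rule sum.swap)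

lemma twist_minus_has_derivative:
  assumes "(f has_derivative D) (at p)"
  shows "twist_minus f p = (D (quat_j p) - \<i> * D (cscale \<i> (quat_j p))) / 2"
proof -
  have D: "D v = of_real (Re (fst v)) * D (1, 0) + of_real (Im (fst v)) * D (\<i>, 0)
      + of_real (Re (snd v)) * D (0, 1) + of_real (Im (snd v)) * D (0, \<i>)" for v
    using linear_sum_Basis[OF has_derivative_linear[OF assms], of v]
    by (simp add: sum_Basis_C2 inner_prod_def scaleR_conv_of_real)
  show ?thesis
    unfolding twist_minus_def d_alpha_def d_beta_def dirderiv_eq[OF assms] D[of "quat_j p"]
      D[of "cscale \<i> (quat_j p)"]
    by (simp add: quat_j_def cscale_def complex_eq_iff field_simps)
qed

lemma twist_minus_form_sibling:
  "twist_minus (form_sibling k q j) p = of_nat (Suc j) * form_sibling k q (Suc j) p"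
proof -
  let ?D = "\<lambda>v. \<Sum>a\<le>k. coeff q a * coeff (line_monom_D1 a (k - a) p v) j"
  have "(form_sibling k q j has_derivative ?D) (at p)"
    unfolding form_sibling_eq_sum[abs_def]
    by (intro has_derivative_sum has_derivative_mult_right
        has_jet_derivative[OF has_jet_monom_sibling UNIV_I])
  then have "twist_minus (form_sibling k q j) p = (?D (quat_j p) - \<i> * ?D (cscale \<i> (quat_j p))) / 2"
    by (rule twist_minus_has_derivative)
  also have "?D (quat_j p) - \<i> * ?D (cscale \<i> (quat_j p)) = (\<Sum>a\<le>k. coeff q a *
      (coeff (line_monom_D1 a (k - a) p (quat_j p)) j
        - \<i> * coeff (line_monom_D1 a (k - a) p (cscale \<i> (quat_j p))) j))"
    by (simp add: sum_distrib_left sum_subtractf algebra_simps)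
  finally show ?thesis
    unfolding monom_sibling_raising form_sibling_eq_sum
    by (simp add: sum_distrib_left sum_divide_distrib mult_ac del: of_nat_Suc)
qed

lemma funpow_twist_minus_binary_form:
  "(twist_minus ^^ j) (binary_form k q) = (\<lambda>p. fact j * form_sibling k q j p)"
proof (induction j)
  case (Suc j)
  have "(twist_minus ^^ Suc j) (binary_form k q) = twist_minus (form_sibling k (smult (fact j) q) j)"
    using Suc.IH by (simp add: form_sibling_smult[abs_def])
  also have "\<dots> = (\<lambda>p. fact (Suc j) * form_sibling k q (Suc j) p)"
    by (rule ext) (simp add: twist_minus_form_sibling form_sibling_smult)
  finally show ?case .
qed (simp add: form_sibling_0)

lemma form_sibling_mat_act:
  assumes "g \<in> SU2"
  shows "form_sibling k q j (mat_act g p) = form_sibling k (act_form g k q) j p"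
proof -
  have "poly (line_form k q (mat_act g p)) t = poly (line_form k (act_form g k q) p) t" for t
    unfolding poly_line_form binary_form_act_form mat_act_add mat_act_cscale mat_act_quat_j[OF assms] ..
  then show ?thesis
    unfolding form_sibling_def by (metis poly_eq_poly_eq_iff ext)
qed

definition form_mode :: "nat \<Rightarrow> complex poly \<Rightarrow> nat \<Rightarrow> C2pt \<Rightarrow> complex" where
  "form_mode k q j = restrS3 (form_sibling k q j)"

lemma form_mode_eq_sum: "form_mode k q j x = (\<Sum>a\<le>k. coeff q a * monom_mode a (k - a) j x)"
  by (simp add: form_mode_def restrS3_def monom_mode_def form_sibling_eq_sum)

lemma form_mode_off_S3: "x \<notin> S3 \<Longrightarrow> form_mode k q j x = 0"
  by (simp add: form_mode_def restrS3_def)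

lemma form_mode_diff: "form_mode k (q - r) j x = form_mode k q j x - form_mode k r j x"
  by (simp add: form_mode_def restrS3_def form_sibling_diff)

lemma form_mode_smult: "form_mode k (smult c q) j x = c * form_mode k q j x"
  by (simp add: form_mode_def restrS3_def form_sibling_smult)

lemma form_mode_sum: "form_mode k (\<Sum>i\<in>A. q i) j x = (\<Sum>i\<in>A. form_mode k (q i) j x)"
  by (simp add: form_mode_def restrS3_def form_sibling_sum)

lemma form_mode_mat_act:
  assumes "g \<in> SU2" "x \<in> S3"
  shows "form_mode k q j (mat_act g x) = form_mode k (act_form g k q) j x"
  using mat_act_S3[OF assms] assms by (simp add: form_mode_def restrS3_def form_sibling_mat_act)

lemma sphere_eigenfunction_form_mode: "sphere_eigenfunction k (form_mode k q j)"
proof -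
  have "sphere_eigenfunction k (monom_mode a (k - a) j)" if "a \<in> {..k}" for a
    using sphere_eigenfunction_monom_mode[of a "k - a" j] that by simp
  then show ?thesis
    unfolding form_mode_eq_sum[abs_def] by (rule sphere_eigenfunction_sum)
qed

lemma sum_form_mode_eq:
  "(\<Sum>j\<le>k. form_mode k (q j) j x) = (\<Sum>(a, j)\<in>{..k} \<times> {..k}. coeff (q j) a * monom_mode a (k - a) j x)"
  unfolding form_mode_eq_sum sum.cartesian_product[symmetric] by (rule sum.swap)

lemma form_mode_independent:
  assumes "\<And>x. x \<in> S3 \<Longrightarrow> (\<Sum>j\<le>k. form_mode k (q j) j x) = 0" "j \<le> k" "degree (q j) \<le> k"
  shows "q j = 0"
proof (rule poly_eqI)
  fix a
  show "coeff (q j) a = coeff 0 a"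
  proof (cases "a \<le> k")
    case True
    have "coeff (q j) a = 0"
      using assms(1)[unfolded sum_form_mode_eq] True assms(2)
      by (rule monom_mode_independent[where c = "\<lambda>a j. coeff (q j) a"])
    then show ?thesis by simp
  qed (use assms(3) in \<open>simp add: coeff_eq_0\<close>)
qed

lemma form_mode_in_modes:
  assumes "invariant_form k q"
  shows "form_mode k q j \<in> modes Istar k"
proof -
  have "form_mode k q j (mat_act (mat_inv2 g) x) = form_mode k q j x" if "g \<in> Istar" "x \<in> S3" for g x
  proof -
    have SU2: "g \<in> SU2"
      by (rule Istar_SU2[OF that(1)])
    have "act_form g k q = q"
      using invariant_form_mat_act[OF assms that(1)]
      by (intro binary_form_eqD[OF degree_act_form invariant_form_degree[OF assms]])
        (simp add: binary_form_act_form)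
    then show ?thesis
      using form_mode_mat_act[OF SU2 mat_act_S3[OF mat_inv2_SU2[OF SU2] that(2)], of k q j]
      by (simp add: mat_act_mat_inv2[OF SU2])
  qed
  then show ?thesis
    unfolding modes_iff using sphere_eigenfunction_form_mode form_mode_off_S3 by blast
qed

theorem modes_Istar_expansion:
  assumes F: "F \<in> modes Istar k"
  obtains q where "\<And>j. j \<le> k \<Longrightarrow> invariant_form k (q j)" "F = (\<lambda>x. \<Sum>j\<le>k. form_mode k (q j) j x)"
proof -
  obtain c where c: "\<And>x. x \<in> S3 \<Longrightarrow> F x = (\<Sum>(a, j)\<in>{..k} \<times> {..k}. c a j * monom_mode a (k - a) j x)"
    using sphere_eigenfunction_expansion F modes_iff by blast
  define q where "q j = (\<Sum>a\<le>k. monom (c a j) a)" for j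
  have degree: "degree (q j) \<le> k" for j
    unfolding q_def by (intro degree_sum_le) (auto intro: order_trans[OF degree_monom_le])
  have "coeff (q j) a = c a j" if "a \<le> k" for a j
    using that by (simp add: q_def coeff_sum)
  then have "F x = (\<Sum>j\<le>k. form_mode k (q j) j x)" if "x \<in> S3" for x
    unfolding sum_form_mode_eq c[OF that] by (intro sum.cong) auto
  moreover have "F x = 0" if "x \<notin> S3" for x
    using F that modes_iff by blast
  ultimately have expansion: "F = (\<lambda>x. \<Sum>j\<le>k. form_mode k (q j) j x)"
    by (metis (no_types, lifting) form_mode_off_S3 sum.neutral ext)
  have "invariant_form k (q j)" if "j \<le> k" for j
    unfolding invariant_form_def
  proof (intro conjI ballI allI)
    fix g p assume g: "g \<in> Istar"
    note SU2 = Istar_SU2[OF g]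
    have "(\<Sum>j\<le>k. form_mode k (act_form g k (q j) - q j) j x) = 0" if x: "x \<in> S3" for x
    proof -
      have "(\<Sum>j\<le>k. form_mode k (act_form g k (q j)) j x) = F (mat_act g x)"
        by (simp add: expansion form_mode_mat_act[OF SU2 x])
      also have "\<dots> = F x"
        using F g mat_act_S3[OF SU2 x] mat_inv2_mat_act[OF SU2, of x] unfolding modes_iff by metis
      finally show ?thesis
        by (simp add: expansion form_mode_diff sum_subtractf)
    qed
    then have "act_form g k (q j) - q j = 0"
      using \<open>j \<le> k\<close> degree_diff_le[OF degree_act_form degree] by (rule form_mode_independent)
    then show "binary_form k (q j) (mat_act g p) = binary_form k (q j) p"
      by (metis binary_form_act_form right_minus_eq)
  qed (rule degree)
  then show thesis
    using expansion by (rule that)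
qed

subsection \<open>The basis of modes\<close>

definition basis_form :: "nat \<Rightarrow> nat \<Rightarrow> complex poly" where
  "basis_form k i = (let m = k div 2 in
     icosahedral_monomial (5 * i + m mod 5) (3 * (nat (ktilde k) - i) + m mod 3) (m mod 2))"

lemma basis_form_exponents:
  assumes "even k" "i < nat (ktilde k + 1)"
  shows "12 * (5 * i + (k div 2) mod 5) + 20 * (3 * (nat (ktilde k) - i) + (k div 2) mod 3)
      + 30 * ((k div 2) mod 2) = k"
proof -
  define m where "m = k div 2"
  have k: "k = 2 * m"
    using assms(1) by (simp add: m_def)
  define l where "l = nat (ktilde k)"
  have l: "ktilde k = int l" "i \<le> l"
    using assms(2) by (simp_all add: l_def)
  have "m div 2 + m div 3 + m div 5 = m + l"
    using l(1) unfolding ktilde_def Let_def m_def[symmetric] by linarith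
  moreover have "2 * (m div 2) + m mod 2 = m" "3 * (m div 3) + m mod 3 = m"
    "5 * (m div 5) + m mod 5 = m"
    by simp_all
  ultimately have "30 * l + 6 * (m mod 5) + 10 * (m mod 3) + 15 * (m mod 2) = m"
    by linarith
  then have "6 * (5 * i + m mod 5) + 10 * (3 * (l - i) + m mod 3) + 15 * (m mod 2) = m"
    using l(2) by (simp add: diff_mult_distrib2)
  then show ?thesis
    unfolding m_def[symmetric] l(1) nat_int using k by linarith
qed

lemma icosahedral_monomial_eq_basis_form:
  assumes "12 * a + 20 * b + 30 * c = k" "c \<le> 1"
  shows "icosahedral_monomial a b c = basis_form k (a div 5)" "a div 5 < nat (ktilde k + 1)"
proof -
  define m where "m = k div 2"
  have m: "m = 6 * a + 10 * b + 15 * c"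
    using assms by (simp add: m_def)
  have "m = c + 2 * (3 * a + 5 * b + 7 * c)"
    using m by simp
  then have m2: "m mod 2 = c" "m div 2 = 3 * a + 5 * b + 7 * c"
    using assms(2)
    by (simp_all only: mod_mult_self2 div_mult_self2[OF zero_neq_numeral[symmetric]]) simp_all
  have "m = b + 3 * (2 * a + 3 * b + 5 * c)"
    using m by simp
  then have m3: "m mod 3 = b mod 3" "m div 3 = 2 * a + 3 * b + 5 * c + b div 3"
    by (simp_all only: mod_mult_self2 div_mult_self2[OF zero_neq_numeral[symmetric]])
  have "m = a + 5 * (a + 2 * b + 3 * c)"
    using m by simp
  then have m5: "m mod 5 = a mod 5" "m div 5 = a + 2 * b + 3 * c + a div 5"
    by (simp_all only: mod_mult_self2 div_mult_self2[OF zero_neq_numeral[symmetric]])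
  have ktilde: "ktilde k = int (a div 5 + b div 3)"
    unfolding ktilde_def Let_def m_def[symmetric] m2 m3 m5 by (simp add: m)
  then show "a div 5 < nat (ktilde k + 1)"
    by simp
  show "icosahedral_monomial a b c = basis_form k (a div 5)"
    unfolding basis_form_def Let_def m_def[symmetric] m2 m3 m5 ktilde nat_int by simp
qed

lemma icosahedral_monomials_eq_basis_forms:
  assumes "even k"
  shows "icosahedral_monomials k = basis_form k ` {..<nat (ktilde k + 1)}"
proof
  show "icosahedral_monomials k \<subseteq> basis_form k ` {..<nat (ktilde k + 1)}"
    unfolding icosahedral_monomials_def using icosahedral_monomial_eq_basis_form by blast
  show "basis_form k ` {..<nat (ktilde k + 1)} \<subseteq> icosahedral_monomials k"
    using basis_form_exponents[OF assms]
    by (auto simp: basis_form_def Let_def intro!: icosahedral_monomialsI)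
qed

lemma invariant_form_basis_form:
  assumes "even k" "i < nat (ktilde k + 1)"
  shows "invariant_form k (basis_form k i)"
  unfolding klein_icosahedral_invariants icosahedral_monomials_eq_basis_forms[OF assms(1)]
  using assms(2) by (intro poly_space.span_base) simp

lemma Bpoly_eq_binary_form:
  assumes "even k" "i < nat (ktilde k + 1)"
  shows "Bpoly k i = binary_form k (basis_form k i)"
  using binary_form_icosahedral_monomial[OF basis_form_exponents[OF assms]]
  by (simp add: fun_eq_iff Bpoly_def basis_form_def Let_def)

lemma sibling_eq_form_mode:
  assumes "even k" "i < nat (ktilde k + 1)"
  shows "sibling k i j = form_mode k (smult (fact j) (basis_form k i)) j"
  unfolding sibling_def Bpoly_eq_binary_form[OF assms] funpow_twist_minus_binary_form form_mode_def
  by (simp add: form_sibling_smult[abs_def])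

lemma
  shows coeff_icosahedral_monomial_below: "n < a \<Longrightarrow> coeff (icosahedral_monomial a b c) n = 0"
    and coeff_icosahedral_monomial_lowest: "coeff (icosahedral_monomial a b c) a \<noteq> 0"
proof -
  define L where "L = monom 1 10 + monom 11 5 - (1 :: complex poly)"
  have I12_poly_eq: "I12_poly = monom 1 1 * L"
    unfolding I12_poly_def L_def distrib_left right_diff_distrib mult_monom by simp
  have "I12_poly ^ a = monom 1 a * L ^ a"
    unfolding I12_poly_eq by (simp add: power_mult_distrib monom_power)
  then have "icosahedral_monomial a b c = monom 1 a * (L ^ a * I20_poly ^ b * I30_poly ^ c)"
    by (simp only: icosahedral_monomial_def mult.assoc)
  then have coeff: "coeff (icosahedral_monomial a b c) n
      = (if n < a then 0 else coeff (L ^ a * I20_poly ^ b * I30_poly ^ c) (n - a))" for n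
    by (simp add: coeff_monom_mult)
  show "n < a \<Longrightarrow> coeff (icosahedral_monomial a b c) n = 0"
    by (simp add: coeff)
  have "coeff (L ^ a * I20_poly ^ b * I30_poly ^ c) 0 = (- 1) ^ a"
    by (simp add: coeff_mult coeff_0_power L_def I20_poly_def I30_poly_def)
  then show "coeff (icosahedral_monomial a b c) a \<noteq> 0"
    by (simp add: coeff)
qed

lemma poly_independent_if_triangular:
  fixes f :: "nat \<Rightarrow> 'a::idom poly"
  assumes "(\<Sum>i<N. smult (c i) (f i)) = 0" "i < N"
    and lowest: "\<And>i. i < N \<Longrightarrow> coeff (f i) (n i) \<noteq> 0"
    and below: "\<And>i l. l < i \<Longrightarrow> i < N \<Longrightarrow> coeff (f i) (n l) = 0"
  shows "c i = 0"
  using assms(2)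
proof (induction i rule: less_induct)
  case (less i)
  have "0 = (\<Sum>l<N. c l * coeff (f l) (n i))"
    using arg_cong[OF assms(1), of "\<lambda>q. coeff q (n i)"] by (simp add: coeff_sum)
  also have "\<dots> = (\<Sum>l<N. if l = i then c i * coeff (f i) (n i) else 0)"
  proof (rule sum.cong[OF refl])
    fix l assume "l \<in> {..<N}"
    then show "c l * coeff (f l) (n i) = (if l = i then c i * coeff (f i) (n i) else 0)"
      using less.IH[of l] below[of i l] by (cases l i rule: linorder_cases) auto
  qed
  finally show ?case
    using lowest less.prems by simp
qed

lemma basis_form_independent:
  assumes "(\<Sum>i<N. smult (c i) (basis_form k i)) = 0" "i < N"
  shows "c i = 0"
  using assms
proof (rule poly_independent_if_triangular[where n = "\<lambda>i. 5 * i + (k div 2) mod 5"])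
  show "coeff (basis_form k i) (5 * i + (k div 2) mod 5) \<noteq> 0" for i
    by (simp add: basis_form_def Let_def coeff_icosahedral_monomial_lowest)
  show "coeff (basis_form k i) (5 * l + (k div 2) mod 5) = 0" if "l < i" for i l
    using that by (simp add: basis_form_def Let_def coeff_icosahedral_monomial_below)
qed

lemma (in module) span_image_finiteE:
  assumes "finite A" "x \<in> span (f ` A)"
  obtains c where "x = (\<Sum>i\<in>A. scale (c i) (f i))"
proof -
  obtain u where u: "x = (\<Sum>v\<in>f ` A. scale (u v) v)"
    using assms span_finite[of "f ` A"] by auto
  define B where "B = inv_into A f ` f ` A"
  have "B \<subseteq> A"
    by (auto simp: B_def inv_into_into)
  have "x = (\<Sum>i\<in>B. scale (u (f i)) (f i))"
    unfolding u B_def by (subst sum.reindex) (simp_all add: inj_on_inv_into f_inv_into_f)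
  also have "\<dots> = (\<Sum>i\<in>A. scale (if i \<in> B then u (f i) else 0) (f i))"
    using assms(1) \<open>B \<subseteq> A\<close> by (intro sum.mono_neutral_cong_left) auto
  finally show thesis
    by (rule that)
qed

lemma invariant_form_basis_expansion:
  assumes "even k" "invariant_form k q"
  obtains c where "q = (\<Sum>i<nat (ktilde k + 1). smult (c i) (basis_form k i))"
  using poly_space.span_image_finiteE[OF finite_lessThan] assms(2) that
  unfolding klein_icosahedral_invariants icosahedral_monomials_eq_basis_forms[OF assms(1)] by blast

lemma zero_in_modes: "(\<lambda>_. 0) \<in> modes Istar k"
proof -
  have "invariant_form k 0"
    by (simp add: invariant_form_def binary_form_0)
  from form_mode_in_modes[OF this, of 0] show ?thesis
    by (simp add: form_mode_eq_sum[abs_def])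
qed

lemma modes_Istar_odd:
  assumes "odd k"
  shows "modes Istar k = {\<lambda>_. 0}"
proof -
  have "F = (\<lambda>_. 0)" if F: "F \<in> modes Istar k" for F
  proof -
    obtain q where q: "\<And>j. j \<le> k \<Longrightarrow> invariant_form k (q j)" "F = (\<lambda>x. \<Sum>j\<le>k. form_mode k (q j) j x)"
      using modes_Istar_expansion[OF F] by blast
    then have "q j = 0" if "j \<le> k" for j
      using odd_invariant_form_eq_0 assms that by blast
    then show ?thesis
      by (simp add: q(2) form_mode_eq_sum)
  qed
  then show ?thesis
    using zero_in_modes by blast
qed

lemma sibling_in_modes:
  assumes "even k" "i < nat (ktilde k + 1)"
  shows "sibling k i j \<in> modes Istar k"
  unfolding sibling_eq_form_mode[OF assms]
  using poly_space.subspace_scale[OF subspace_invariant_form] invariant_form_basis_form[OF assms]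
  by (intro form_mode_in_modes) simp

lemma sum_siblings_eq:
  assumes "even k"
  shows "(\<Sum>i<nat (ktilde k + 1). \<Sum>j\<le>k. c i j * sibling k i j x)
    = (\<Sum>j\<le>k. form_mode k (\<Sum>i<nat (ktilde k + 1). smult (c i j * fact j) (basis_form k i)) j x)"
proof -
  have "(\<Sum>i<nat (ktilde k + 1). \<Sum>j\<le>k. c i j * sibling k i j x)
      = (\<Sum>i<nat (ktilde k + 1). \<Sum>j\<le>k. form_mode k (smult (c i j * fact j) (basis_form k i)) j x)"
    by (intro sum.cong refl) (simp add: sibling_eq_form_mode[OF assms] form_mode_smult)
  also have "\<dots> = (\<Sum>j\<le>k. \<Sum>i<nat (ktilde k + 1).
      form_mode k (smult (c i j * fact j) (basis_form k i)) j x)"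
    by (rule sum.swap)
  finally show ?thesis
    by (simp only: form_mode_sum)
qed

lemma siblings_independent:
  assumes "even k" and zero: "\<And>x. (\<Sum>i<nat (ktilde k + 1). \<Sum>j\<le>k. c i j * sibling k i j x) = 0"
    and "i < nat (ktilde k + 1)" "j \<le> k"
  shows "c i j = 0"
proof -
  let ?q = "\<lambda>j. \<Sum>i<nat (ktilde k + 1). smult (c i j * fact j) (basis_form k i)"
  have "?q j = 0"
  proof (rule form_mode_independent[where q = ?q])
    show "(\<Sum>j\<le>k. form_mode k (?q j) j x) = 0" for x
      using zero[of x] unfolding sum_siblings_eq[OF assms(1)] .
    show "degree (?q j) \<le> k"
      by (intro degree_sum_le)
        (auto intro!: order_trans[OF degree_smult_le]
          invariant_form_degree invariant_form_basis_form[OF assms(1)])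
  qed (rule assms(4))
  from basis_form_independent[OF this assms(3)] show ?thesis
    by simp
qed

lemma siblings_span:
  assumes "even k" and F: "F \<in> modes Istar k"
  obtains c where "F = (\<lambda>x. \<Sum>i<nat (ktilde k + 1). \<Sum>j\<le>k. c i j * sibling k i j x)"
proof -
  obtain q where q: "\<And>j. j \<le> k \<Longrightarrow> invariant_form k (q j)" "F = (\<lambda>x. \<Sum>j\<le>k. form_mode k (q j) j x)"
    using modes_Istar_expansion[OF F] by blast
  have "\<exists>d. q j = (\<Sum>i<nat (ktilde k + 1). smult (d i) (basis_form k i))" if "j \<le> k" for j
    using invariant_form_basis_expansion[OF assms(1) q(1)[OF that]] by blast
  then obtain d where d: "\<And>j. j \<le> k \<Longrightarrow> q j = (\<Sum>i<nat (ktilde k + 1). smult (d j i) (basis_form k i))"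
    by metis
  have "F = (\<lambda>x. \<Sum>i<nat (ktilde k + 1). \<Sum>j\<le>k. (d j i / fact j) * sibling k i j x)"
    unfolding sum_siblings_eq[OF assms(1)] q(2) by (auto simp: d intro!: sum.cong)
  then show thesis
    by (rule that)
qed

theorem theorem10p5:
  fixes k :: nat
  shows "(odd k \<longrightarrow> modes Istar k = {\<lambda>_. 0}) \<and>
         (even k \<longrightarrow>
            (\<forall>i < nat (ktilde k + 1). \<forall>j \<le> k. sibling k i j \<in> modes Istar k) \<and>
            (\<forall>c :: nat \<Rightarrow> nat \<Rightarrow> complex.
               (\<forall>x. (\<Sum>i < nat (ktilde k + 1). \<Sum>j \<le> k. c i j * sibling k i j x) = 0)
               \<longrightarrow> (\<forall>i < nat (ktilde k + 1). \<forall>j \<le> k. c i j = 0)) \<and>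
            (\<forall>F \<in> modes Istar k. \<exists>c :: nat \<Rightarrow> nat \<Rightarrow> complex.
               F = (\<lambda>x. \<Sum>i < nat (ktilde k + 1). \<Sum>j \<le> k. c i j * sibling k i j x)))"
proof (intro conjI impI allI ballI)
  show "modes Istar k = {\<lambda>_. 0}" if "odd k"
    using that by (rule modes_Istar_odd)
  assume k: "even k"
  show "sibling k i j \<in> modes Istar k" if "i < nat (ktilde k + 1)" for i j
    using k that by (rule sibling_in_modes)
  show "c i j = 0" if "\<forall>x. (\<Sum>i < nat (ktilde k + 1). \<Sum>j \<le> k. c i j * sibling k i j x) = 0"
    "i < nat (ktilde k + 1)" "j \<le> k" for c :: "nat \<Rightarrow> nat \<Rightarrow> complex" and i j
    using siblings_independent[OF k] that by blast
  show "\<exists>c. F = (\<lambda>x. \<Sum>i < nat (ktilde k + 1). \<Sum>j \<le> k. c i j * sibling k i j x)"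
    if "F \<in> modes Istar k" for F
    using siblings_span[OF k that] by blast
qed

end
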